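(* Let $m\ge 1$ and $\ell_1,\dots,\ell_m\ge 1$ be integers. Let $\mathcal{A}$ be a lattice point configuration such that $X_{\mathcal{A}}$ is equal to a Segre--Veronese embedding of one of the following forms: (a) $\mathbb{P}^1\times\cdots\times\mathbb{P}^1\hookrightarrow\mathbb{P}^N$ ($m$ copies of $\mathbb{P}^1$), of type $(\ell_1,\dots,\ell_m)$; or (b) $\mathbb{P}^{r-1}\times\mathbb{P}^1\times\cdots\times\mathbb{P}^1\hookrightarrow\mathbb{P}^N$ ($m$ copies of $\mathbb{P}^1$), $r\ge 3$, of type $(1,\ell_1,\dots,\ell_m)$. Set $k:=\sum_{j=1}^m\ell_j$ and $k_\ell:=k-1$. Then $X_{\mathcal{A}}$ is a smooth, equivariantly embedded toric variety, with $\mathcal{A}$ complete, which is $k_\ell$-selfdual with $c_{k_\ell}=1$ in case (a), and $k$-selfdual with $c_k=r-1$ in case (b).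
   Context: $\mathbb{K}$ is an algebraically closed field of characteristic zero. For a configuration $\mathcal{A}$ of distinct lattice points $a_0,\dots,a_N\in\mathbb{Z}^n$, $X_{\mathcal{A}}\subset\mathbb{P}^N$ is the Zariski closure of $\{(\mathbf{t}^{a_0}:\dots:\mathbf{t}^{a_N}) : \mathbf{t}\in(\mathbb{K}^* )^n\}$. The Segre--Veronese embedding of type $(\ell_1,\dots,\ell_m)$ is given by the complete linear system of $\mathcal{O}(\ell_1,\dots,\ell_m)$, i.e. by the configuration of all lattice points of $[0,\ell_1]\times\dots\times[0,\ell_m]$; the one of type $(1,\ell_1,\dots,\ell_m)$ is given by $\mathcal{O}(1,\ell_1,\dots,\ell_m)$, i.e. by the lattice points of the product of the unit $(r-1)$-simplex with $[0,\ell_1]\times\dots\times[0,\ell_m]$. $\mathcal{A}$ is complete if it consists of all the lattice points in its convex hull. For $p\in\mathbb{N}$, $A^{(p)}$ is the $\binom{n+p}{p}\times(N+1)$ integer matrix whose rows are the vectors $(a_0^\beta,\dots,a_N^\beta)$ for $\beta\in\mathbb{N}^n$, $|\beta|\le p$, and $c_p:=\dim\operatorname{Ker}A^{(p)}$. Higher duals: let $X\subset\mathbb{P}^N$ be a nondegenerate irreducible projective variety and $p\in\mathbb{N}$. For a smooth point $x\in X$, let $j_{p,x}:\mathbb{K}^{N+1}\to\mathcal{L}_x/\mathfrak{m}_x^{p+1}\mathcal{L}_x$, with $\mathcal{L}=\mathcal{O}_{\mathbb{P}^N}(1)|_X$, be the linear map sending a linear form to the Taylor expansion up to order $p$ at $x$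 of its restriction to $X$. The $p$-th osculating space is $\mathbb{T}^p_{X,x}=\mathbb{P}(\operatorname{Im} j_{p,x})\subset\mathbb{P}^N$; thus a hyperplane contains $\mathbb{T}^p_{X,x}$ iff its equation restricted to $X$ vanishes to order at least $p+1$ at $x$. Let $X_{p\text{-cst}}$ be the open dense subset of $X$ where the rank of $j_p$ is constant. The $p$-th dual variety $X^{(p)}\subset(\mathbb{P}^N)^\vee$ is the Zariski closure of $\{H : H\supseteq\mathbb{T}^p_{X,x}\text{ for some }x\in X_{p\text{-cst}}\}$. $X$ is $p$-selfdual if there is a linear isomorphism $\varphi:\mathbb{P}^N\to(\mathbb{P}^N)^\vee$ with $\varphi(X)=X^{(p)}$.
   Formalization: "𝒜 complete" fails literally in ℤⁿ (𝒜={0,2}⊂ℤ has X_𝒜=ℙ¹ but misses 1); it is proved instead that 𝒜 is complete in the affine lattice it generates, and complete in ℤⁿ whenever that lattice contains all lattice points of its affine hull. *)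

theory Defs
  imports
    "HOL-Analysis.Analysis"
    "HOL-Computational_Algebra.Computational_Algebra"
begin

text \<open>
  Conventions. The homogeneous coordinates of \<open>\<bbbP>\<^sup>N\<close> are indexed by a finite type \<open>'i\<close> with
  \<open>CARD('i) = N + 1\<close>. A point of \<open>\<bbbP>\<^sup>N\<close> is handled through its representatives, the nonzero vectors
  of \<open>'k ^ 'i\<close>, and a subset of \<open>\<bbbP>\<^sup>N\<close> is the set of all representatives of its points, i.e. a set
  of nonzero vectors closed under multiplication by nonzero scalars (Zariski open sets and Zariski
  closures, as defined below, are automatically of this kind). A hyperplane, i.e. a point of the
  dual projective space, is represented by the coefficient vector of an equation.
\<close>

section \<open>Forms and the Zariski topology of projective space\<close>

text \<open>The field will be infinite, so forms are identified with the functions they define.\<close>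

definition form :: "nat \<Rightarrow> (('k::field) ^ ('i::finite) \<Rightarrow> 'k) \<Rightarrow> bool" where
  "form d F \<longleftrightarrow>
     (\<exists>c :: ('i \<Rightarrow> nat) \<Rightarrow> 'k.
        F = (\<lambda>y. \<Sum>e | (\<Sum>i\<in>UNIV. e i) = d. c e * (\<Prod>i\<in>UNIV. y $ i ^ e i)))"

lemma finite_exponents: "finite {e :: 'i::finite \<Rightarrow> nat. (\<Sum>i\<in>UNIV. e i) = d}"
proof (rule finite_subset)
  show "{e :: 'i \<Rightarrow> nat. (\<Sum>i\<in>UNIV. e i) = d} \<subseteq> (\<Pi>\<^sub>E i\<in>UNIV. {..d})"
    by (auto simp: PiE_def extensional_def intro!: member_le_sum)
qed (auto intro: finite_PiE)

definition zariski :: "(('k::field) ^ ('i::finite)) topology" where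
  "zariski = topology_generated_by {{y. y \<noteq> 0 \<and> F y \<noteq> 0} | d F. form d F}"

definition lin :: "('k::field) ^ ('i::finite) \<Rightarrow> 'k ^ 'i \<Rightarrow> 'k" where
  "lin h y = (\<Sum>i\<in>UNIV. h $ i * y $ i)"

definition zariski_irreducible :: "(('k::field) ^ ('i::finite)) set \<Rightarrow> bool" where
  "zariski_irreducible X \<longleftrightarrow> X \<noteq> {} \<and>
     (\<forall>U V. openin (subtopology zariski X) U \<and> U \<noteq> {} \<and> openin (subtopology zariski X) V \<and> V \<noteq> {}
        \<longrightarrow> U \<inter> V \<noteq> {})"

definition dense_open :: "(('k::field) ^ ('i::finite)) set \<Rightarrow> ('k ^ 'i) set \<Rightarrow> bool" where
  "dense_open X U \<longleftrightarrow> openin (subtopology zariski X) U \<and> X \<subseteq> zariski closure_of U"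

section \<open>Local rings, dimension, smoothness\<close>

text \<open>
  Germs at a point \<open>x \<in> X\<close> are handled through functions representing them, with equality
  \<open>germ_eq\<close>. Elements of \<open>local_ring X x\<close> are the functions that coincide with a quotient of two
  forms of the same degree at all points of \<open>X\<close> where the denominator is nonzero,
  the denominator being nonzero at \<open>x\<close>; their values elsewhere are irrelevant.
\<close>

definition local_ring ::
    "(('k::field) ^ ('i::finite)) set \<Rightarrow> 'k ^ 'i \<Rightarrow> ('k ^ 'i \<Rightarrow> 'k) set" where
  "local_ring X x = {f. \<exists>d P Q. form d P \<and> form d Q \<and> Q x \<noteq> 0 \<and>
                          (\<forall>y\<in>X. Q y \<noteq> 0 \<longrightarrow> f y = P y / Q y)}"

definition germ_eq ::
    "(('k::field) ^ ('i::finite)) set \<Rightarrow> 'k ^ 'i \<Rightarrow> ('k ^ 'i \<Rightarrow> 'k) \<Rightarrow> ('k ^ 'i \<Rightarrow> 'k) \<Rightarrow> bool"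
  where
  "germ_eq X x f g \<longleftrightarrow> (\<exists>U. openin (subtopology zariski X) U \<and> x \<in> U \<and> (\<forall>y\<in>U. f y = g y))"

definition max_ideal ::
    "(('k::field) ^ ('i::finite)) set \<Rightarrow> 'k ^ 'i \<Rightarrow> ('k ^ 'i \<Rightarrow> 'k) set" where
  "max_ideal X x = {f \<in> local_ring X x. f x = 0}"

primrec max_ideal_power ::
    "(('k::field) ^ ('i::finite)) set \<Rightarrow> 'k ^ 'i \<Rightarrow> nat \<Rightarrow> ('k ^ 'i \<Rightarrow> 'k) set" where
  "max_ideal_power X x 0 = local_ring X x"
| "max_ideal_power X x (Suc q) =
     {f \<in> local_ring X x. \<exists>(n::nat) g h.
        (\<forall>s<n. g s \<in> max_ideal X x \<and> h s \<in> max_ideal_power X x q) \<and>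
        germ_eq X x f (\<lambda>y. \<Sum>s<n. g s y * h s y)}"

text \<open>
  For irreducible \<open>X\<close>, the dimension is the transcendence degree of the function field:
  the largest number of rational functions \<open>f 0, \<dots>, f (d - 1)\<close>, regular on a nonempty open
  \<open>U\<close>, whose monomials are linearly independent as functions on \<open>U\<close>.
\<close>

definition alg_indep_on :: "'a set \<Rightarrow> nat \<Rightarrow> (nat \<Rightarrow> 'a \<Rightarrow> 'k::field) \<Rightarrow> bool" where
  "alg_indep_on U d f \<longleftrightarrow>
     (\<forall>E (c :: (nat \<Rightarrow> nat) \<Rightarrow> 'k).
        finite E \<and> (\<forall>e\<in>E. \<forall>j\<ge>d. e j = 0) \<and>
        (\<forall>x\<in>U. (\<Sum>e\<in>E. c e * (\<Prod>j<d. f j x ^ e j)) = 0)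
        \<longrightarrow> (\<forall>e\<in>E. c e = 0))"

definition variety_dim :: "(('k::field) ^ ('i::finite)) set \<Rightarrow> nat" where
  "variety_dim X = (GREATEST d. \<exists>U f. openin (subtopology zariski X) U \<and> U \<noteq> {} \<and>
       (\<forall>j<d. \<forall>x\<in>U. f j \<in> local_ring X x) \<and> alg_indep_on U d f)"

text \<open>
  Smoothness is regularity of the local ring: its maximal ideal is generated by \<open>dim X\<close> elements.
\<close>

definition smooth_at :: "(('k::field) ^ ('i::finite)) set \<Rightarrow> 'k ^ 'i \<Rightarrow> bool" where
  "smooth_at X x \<longleftrightarrow> x \<in> X \<and>
     (\<exists>f. (\<forall>j<variety_dim X. f j \<in> max_ideal X x) \<and>
          (\<forall>g\<in>max_ideal X x. \<exists>h. (\<forall>j<variety_dim X. h j \<in> local_ring X x) \<and>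
               germ_eq X x g (\<lambda>y. \<Sum>j<variety_dim X. h j y * f j y)))"

definition smooth_variety :: "(('k::field) ^ ('i::finite)) set \<Rightarrow> bool" where
  "smooth_variety X \<longleftrightarrow> zariski_irreducible X \<and> closedin zariski X \<and> (\<forall>x\<in>X. smooth_at X x)"

section \<open>Higher dual varieties\<close>

text \<open>
  The kernel of \<open>j\<^bsub>p,x\<^esub>\<close>: a linear form \<open>g\<close> with \<open>g(x) \<noteq> 0\<close> trivializes \<open>\<L>\<close> near \<open>x\<close>, and in
  this trivialization the linear form \<open>h\<close> becomes the germ \<open>h / g\<close>, which has to lie in the
  \<open>(p+1)\<close>-st power of the maximal ideal. The choice of \<open>g\<close> is immaterial.
\<close>

definition jet_kernel :: "nat \<Rightarrow> (('k::field) ^ ('i::finite)) set \<Rightarrow> 'k ^ 'i \<Rightarrow> ('k ^ 'i) set" where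
  "jet_kernel p X x =
     {h. \<exists>g. lin g x \<noteq> 0 \<and> (\<lambda>y. lin h y / lin g y) \<in> max_ideal_power X x (Suc p)}"

definition jet_rank :: "nat \<Rightarrow> (('k::field) ^ ('i::finite)) set \<Rightarrow> 'k ^ 'i \<Rightarrow> nat" where
  "jet_rank p X x = CARD('i) - vec.dim (jet_kernel p X x)"

text \<open>
  \<open>Im j\<^bsub>p,x\<^esub>\<close> is a quotient of the space of linear forms, so \<open>\<bbbP>(Im j\<^bsub>p,x\<^esub>) \<subseteq> \<bbbP>\<^sup>N\<close> is the common zero
  locus of the linear forms in the kernel.
\<close>

definition osculating_space ::
    "nat \<Rightarrow> (('k::field) ^ ('i::finite)) set \<Rightarrow> 'k ^ 'i \<Rightarrow> ('k ^ 'i) set" where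
  "osculating_space p X x = {y. y \<noteq> 0 \<and> (\<forall>h\<in>jet_kernel p X x. lin h y = 0)}"

text \<open>
  Two dense open subsets of an irreducible \<open>X\<close> meet, so the constant value of the rank is the same
  on all the sets \<open>U\<close> below, and their union is the largest such set.
\<close>

definition const_rank_locus :: "nat \<Rightarrow> (('k::field) ^ ('i::finite)) set \<Rightarrow> ('k ^ 'i) set" where
  "const_rank_locus p X =
     \<Union>{U. dense_open X U \<and> (\<forall>x\<in>U. smooth_at X x) \<and> (\<exists>\<rho>. \<forall>x\<in>U. jet_rank p X x = \<rho>)}"

definition hyperplane :: "('k::field) ^ ('i::finite) \<Rightarrow> ('k ^ 'i) set" where
  "hyperplane h = {y. y \<noteq> 0 \<and> lin h y = 0}"

definition dual_variety :: "nat \<Rightarrow> (('k::field) ^ ('i::finite)) set \<Rightarrow> ('k ^ 'i) set" where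
  "dual_variety p X =
     zariski closure_of
       {h. h \<noteq> 0 \<and> (\<exists>x\<in>const_rank_locus p X. osculating_space p X x \<subseteq> hyperplane h)}"

definition selfdual :: "nat \<Rightarrow> (('k::field) ^ ('i::finite)) set \<Rightarrow> bool" where
  "selfdual p X \<longleftrightarrow>
     (\<exists>M :: 'k ^ 'i ^ 'i. invertible M \<and> (\<lambda>y. M *v y) ` X = dual_variety p X)"

section \<open>Lattice point configurations\<close>

definition monomial :: "int ^ 'n \<Rightarrow> ('k::field) ^ ('n::finite) \<Rightarrow> 'k" where
  "monomial u t = (\<Prod>j\<in>UNIV. t $ j powi (u $ j))"

text \<open>
  The parametrized points are listed through one representative each; their Zariski closure contains
  all the others.
\<close>

definition toric_variety :: "('i \<Rightarrow> int ^ 'n) \<Rightarrow> (('k::field) ^ ('i::finite)) set" where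
  "toric_variety a =
     zariski closure_of {(\<chi> i. monomial (a i) t) | t :: 'k ^ ('n::finite). \<forall>j. t $ j \<noteq> 0}"

text \<open>The kernel of \<open>A\<^sup>(\<^sup>p\<^sup>)\<close>, whose row of index \<open>\<beta>\<close> is \<open>(a\<^sub>i\<^sup>\<beta>)\<^sub>i\<close>, over the field \<open>'k\<close>.\<close>

definition lattice_power :: "int ^ 'n \<Rightarrow> ('n::finite \<Rightarrow> nat) \<Rightarrow> int" where
  "lattice_power u \<beta> = (\<Prod>j\<in>UNIV. (u $ j) ^ \<beta> j)"

definition power_matrix_kernel ::
    "nat \<Rightarrow> ('i \<Rightarrow> int ^ ('n::finite)) \<Rightarrow> (('k::field) ^ ('i::finite)) set" where
  "power_matrix_kernel p a =
     {v. \<forall>\<beta> :: 'n \<Rightarrow> nat. (\<Sum>j\<in>UNIV. \<beta> j) \<le> p \<longrightarrow>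
           (\<Sum>i\<in>UNIV. of_int (lattice_power (a i) \<beta>) * v $ i) = 0}"

definition real_point :: "int ^ ('n::finite) \<Rightarrow> real ^ 'n" where
  "real_point u = (\<chi> j. real_of_int (u $ j))"

definition lattice_points :: "(real ^ ('n::finite)) set \<Rightarrow> (int ^ 'n) set" where
  "lattice_points P = {u. real_point u \<in> P}"

text \<open>
  Completeness with respect to a lattice \<open>L\<close> of the ambient \<open>\<int>\<^sup>n\<close>; \<open>L = UNIV\<close> is completeness in
  \<open>\<int>\<^sup>n\<close> itself. The variety only depends on the configuration as a subset of the affine lattice it
  generates: \<open>{0, 2} \<subseteq> \<int>\<close> and \<open>{0, 1} \<subseteq> \<int>\<close> both define \<open>\<bbbP>\<^sup>1\<close>, but \<open>{0, 2}\<close> is complete only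
  in the lattice \<open>2\<int>\<close>.
\<close>

definition complete_in :: "(int ^ ('n::finite)) set \<Rightarrow> ('i::finite \<Rightarrow> int ^ 'n) \<Rightarrow> bool" where
  "complete_in L a \<longleftrightarrow> L \<inter> lattice_points (convex hull (real_point ` range a)) = range a"

definition affine_lattice :: "('i::finite \<Rightarrow> int ^ ('n::finite)) \<Rightarrow> (int ^ 'n) set" where
  "affine_lattice a = {\<Sum>i\<in>UNIV. z i *s a i | z. (\<Sum>i\<in>UNIV. z i) = 1}"

definition saturated :: "('i::finite \<Rightarrow> int ^ ('n::finite)) \<Rightarrow> bool" where
  "saturated a \<longleftrightarrow> affine_lattice a = lattice_points (affine hull (real_point ` range a))"

section \<open>Equivariantly embedded toric varieties\<close>

text \<open>
  The torus \<open>(\<bbbK>\<^sup>*)\<^sup>d\<close> is modelled by functions on \<open>nat\<close> of which only the first \<open>d\<close> values matter. It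
  acts on \<open>\<bbbP>\<^sup>N\<close> by diagonal matrices, with weights \<open>w\<close>.
\<close>

definition torus_act ::
    "nat \<Rightarrow> ('i \<Rightarrow> nat \<Rightarrow> int) \<Rightarrow> (nat \<Rightarrow> 'k) \<Rightarrow> ('k::field) ^ ('i::finite) \<Rightarrow> 'k ^ 'i" where
  "torus_act d w t y = (\<chi> i. (\<Prod>j<d. t j powi w i j) * y $ i)"

text \<open>
  A closed irreducible \<open>X\<close> is an equivariantly embedded toric variety if such an action preserves
  it and some orbit map is an isomorphism of the torus onto a dense open subset \<open>Orb\<close> of
  \<open>X\<close>; the functions \<open>g\<close> are the components of the inverse morphism.
\<close>

definition equivariant_toric :: "(('k::field) ^ ('i::finite)) set \<Rightarrow> bool" where
  "equivariant_toric X \<longleftrightarrow> closedin zariski X \<and> zariski_irreducible X \<and>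
     (\<exists>d w x0 Orb. x0 \<in> X \<and>
        (\<forall>t. (\<forall>j<d. t j \<noteq> 0) \<longrightarrow> torus_act d w t ` X = X) \<and>
        Orb = {s *s torus_act d w t x0 | s t. s \<noteq> 0 \<and> (\<forall>j<d. t j \<noteq> 0)} \<and>
        dense_open X Orb \<and>
        (\<forall>j<d. \<exists>g. (\<forall>x\<in>Orb. g \<in> local_ring X x) \<and>
                   (\<forall>t. (\<forall>l<d. t l \<noteq> 0) \<longrightarrow> g (torus_act d w t x0) = t j)))"

section \<open>Segre--Veronese configurations\<close>

definition segre_veronese_box :: "('m::finite \<Rightarrow> nat) \<Rightarrow> (int ^ 'm) set" where
  "segre_veronese_box l = lattice_points (cbox 0 (\<chi> j. real (l j)))"

text \<open>The coordinates \<open>Inl\<close> carry the unit simplex, of dimension \<open>CARD('s)\<close>.\<close>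

definition segre_veronese_simplex_box :: "('m::finite \<Rightarrow> nat) \<Rightarrow> (int ^ ('s::finite + 'm)) set" where
  "segre_veronese_simplex_box l =
     lattice_points {v. (\<chi> i. v $ Inl i) \<in> convex hull (insert 0 (Basis :: (real ^ 's) set)) \<and>
                        (\<chi> j. v $ Inr j) \<in> cbox 0 (\<chi> j. real (l j))}"

end

theory Submission
  imports Defs
begin

no_notation fps_nth (infixl \<open>$\<close> 75)

text \<open>
  Both varieties are the image of \<open>(w, s, t) \<mapsto> (w\<^sub>\<sigma> \<Prod>\<^sub>j s\<^sub>j\<^bsup>l j - u j\<^esup> t\<^sub>j\<^bsup>u j\<^esup>)\<close>, where \<open>w\<close> runs through
  the coordinates of \<open>\<bbbP>\<^bsup>r-1\<^esup>\<close>, with \<open>r = 1\<close> in case (a). They are homogeneous under the linear action of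
  \<open>GL\<^sub>r \<times> GL\<^sub>2\<^sup>m\<close>, so it is enough to study one point, the origin of a chart whose coordinate functions
  are monomials. There the jets of a linear form are its coefficients, sorted by degree, and the
  kernel in question consists of the forms \<open>\<omega>(w) \<Prod>\<^sub>j t\<^sub>j\<^bsup>l j\<^esup>\<close>, where in case (b) the linear form \<open>\<omega>\<close>
  vanishes at the point. Its translates are the forms
  \<open>\<omega>(w) \<Prod>\<^sub>j (\<alpha>\<^sub>j s\<^sub>j + \<beta>\<^sub>j t\<^sub>j)\<^bsup>l j\<^esup>\<close>, whose coefficient vectors are, up to the diagonal matrix of products of
  binomial coefficients, the points of the same variety.

  The variety determines the integral affine relations of the configuration, which is therefore
  affinely equivalent to the standard one; completeness and the kernel of \<open>A\<^sup>(\<^sup>p\<^sup>)\<close> are invariant under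
  such equivalences.
\<close>

section \<open>Forms\<close>

text \<open>The orders are dictated by the largest degrees in the chart. In case (a) a coordinate
  has degree at most \<open>k\<close>, reached only by the monomial with \<open>u i = l\<close>. In
  case (b) the maximum is \<open>k + 1\<close>, reached by the \<open>r - 1\<close> monomials with
  \<open>u i = l\<close> and a simplex coordinate other than \<open>o0\<close>. With
  \<open>p\<close> one below the maximum only these survive: they span the kernel of the jets at the
  origin, and their number is the dimension of the kernel of the power matrix. In case (b)
  \<open>\<omega>\<close> has to vanish at the point, but a linear form in \<open>r\<close>
  variables has a nontrivial zero, so every \<open>\<omega>\<close> occurs.

  Jet kernels are bounded from above by restriction to the curves
  \<open>x \<mapsto> param (\<lambda>c. q c * x)\<close>, which turn degree into order of vanishing
  at 0.

  The relations of the unknown \<open>a\<close> are read off at points with coordinates 1 and 2,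
  since 2 has infinite multiplicative order in characteristic zero. The affine map from
  \<open>a\<close> back to the standard exponents is in general only rational; this suffices,
  because points of the affine lattice of \<open>a\<close> have integral standard exponents.\<close>

lemma form_sumI:
  fixes g :: "'x \<Rightarrow> 'i::finite \<Rightarrow> nat" and k :: "'x \<Rightarrow> 'k::field"
  assumes S: "finite S" and d: "\<And>x. x \<in> S \<Longrightarrow> (\<Sum>i\<in>UNIV. g x i) = d"
    and F: "\<And>y. F y = (\<Sum>x\<in>S. k x * (\<Prod>i\<in>UNIV. (y $ i) ^ g x i))"
  shows "form d F"
proof -
  let ?E = "{e :: 'i \<Rightarrow> nat. (\<Sum>i\<in>UNIV. e i) = d}"
  \<comment> \<open>Several \<open>x\<close> may give the same exponent vector, so coefficients are
    collected over the fibres of \<open>g\<close>.\<close>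
  let ?c = "\<lambda>e. \<Sum>x | x \<in> S \<and> g x = e. k x"
  have "F y = (\<Sum>e\<in>?E. ?c e * (\<Prod>i\<in>UNIV. (y $ i) ^ e i))" for y
  proof -
    have "(\<Sum>e\<in>?E. ?c e * (\<Prod>i\<in>UNIV. (y $ i) ^ e i))
        = (\<Sum>e\<in>?E. \<Sum>x | x \<in> S \<and> g x = e. k x * (\<Prod>i\<in>UNIV. (y $ i) ^ g x i))"
      by (rule sum.cong) (auto simp: sum_distrib_right)
    also have "\<dots> = F y"
      unfolding F by (rule sum.group[OF S finite_exponents]) (use d in auto)
    finally show ?thesis by simp
  qed
  then show ?thesis unfolding form_def by (intro exI[of _ ?c]) auto
qed

lemma formE:
  assumes "form d F"
  obtains c where "\<And>y. F y = (\<Sum>e\<in>{e. (\<Sum>i\<in>UNIV. e i) = d}. c e * (\<Prod>i\<in>UNIV. (y $ i) ^ e i))"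
  using assms unfolding form_def by blast

lemma form_mult:
  assumes "form d F" and "form d' G"
  shows "form (d + d') (\<lambda>y. F y * G y)"
proof -
  from assms obtain c c' where
    c: "\<And>y. F y = (\<Sum>e\<in>{e. (\<Sum>i\<in>UNIV. e i) = d}. c e * (\<Prod>i\<in>UNIV. (y $ i) ^ e i))" and
    c': "\<And>y. G y = (\<Sum>e\<in>{e. (\<Sum>i\<in>UNIV. e i) = d'}. c' e * (\<Prod>i\<in>UNIV. (y $ i) ^ e i))"
    by (elim formE) blast
  have "F y * G y = (\<Sum>x\<in>{e. (\<Sum>i\<in>UNIV. e i) = d} \<times> {e. (\<Sum>i\<in>UNIV. e i) = d'}.
      (c (fst x) * c' (snd x)) * (\<Prod>i\<in>UNIV. (y $ i) ^ (fst x i + snd x i)))" for y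
    unfolding c c' sum_product sum.cartesian_product
    by (intro sum.cong) (auto simp: power_add prod.distrib)
  then show ?thesis
    by (intro form_sumI[where S = "{e. (\<Sum>i\<in>UNIV. e i) = d} \<times> {e. (\<Sum>i\<in>UNIV. e i) = d'}"
          and k = "\<lambda>x. c (fst x) * c' (snd x)" and g = "\<lambda>x i. fst x i + snd x i"])
       (auto simp: finite_exponents sum.distrib)
qed

lemma form_const: "form 0 (\<lambda>y. a)"
  by (rule form_sumI[where S = "{()}" and k = "\<lambda>_. a" and g = "\<lambda>_ _. 0"]) auto

lemma form_zero: "form d (\<lambda>y. 0)"
  by (rule form_sumI[where S = "{}"]) auto

lemma form_scale: "form d F \<Longrightarrow> form d (\<lambda>y. a * F y)"
  using form_mult[OF form_const, of d F a] by simp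

lemma form_add:
  assumes "form d F" and "form d G"
  shows "form d (\<lambda>y. F y + G y)"
proof -
  from assms obtain c c' where
    c: "\<And>y. F y = (\<Sum>e\<in>{e. (\<Sum>i\<in>UNIV. e i) = d}. c e * (\<Prod>i\<in>UNIV. (y $ i) ^ e i))" and
    c': "\<And>y. G y = (\<Sum>e\<in>{e. (\<Sum>i\<in>UNIV. e i) = d}. c' e * (\<Prod>i\<in>UNIV. (y $ i) ^ e i))"
    by (elim formE) blast
  show ?thesis
    by (rule form_sumI[where S = "{e. (\<Sum>i\<in>UNIV. e i) = d}" and k = "\<lambda>e. c e + c' e" and g = "\<lambda>e. e"])
       (auto simp: c c' finite_exponents distrib_right sum.distrib)
qed

lemma form_diff: "form d F \<Longrightarrow> form d G \<Longrightarrow> form d (\<lambda>y. F y - G y)"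
  using form_add[OF _ form_scale[of d G "-1"], of F] by simp

lemma form_sum: "(\<And>x. x \<in> A \<Longrightarrow> form d (F x)) \<Longrightarrow> form d (\<lambda>y. \<Sum>x\<in>A. F x y)"
  by (induction A rule: infinite_finite_induct) (auto intro: form_zero form_add)

lemma form_prod: "(\<And>x. x \<in> A \<Longrightarrow> form (d x) (F x)) \<Longrightarrow> form (\<Sum>x\<in>A. d x) (\<lambda>y. \<Prod>x\<in>A. F x y)"
  by (induction A rule: infinite_finite_induct) (auto intro: form_mult form_const)

lemma form_power: "form d F \<Longrightarrow> form (n * d) (\<lambda>y. F y ^ n)"
  by (induction n) (auto intro: form_mult form_const)

lemma form_coord: "form 1 (\<lambda>y. y $ i)"
proof (rule form_sumI[where S = "{()}" and k = "\<lambda>_. 1" and g = "\<lambda>_ j. if j = i then 1 else 0"])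
  fix y :: "'a ^ 'b"
  have "(\<Prod>j\<in>UNIV. (y $ j) ^ (if j = i then 1 else 0)) = (\<Prod>j\<in>UNIV. if j = i then y $ j else 1)"
    by (intro prod.cong) auto
  then show "y $ i = (\<Sum>x\<in>{()}. 1 * (\<Prod>j\<in>UNIV. (y $ j) ^ (if j = i then 1 else 0)))" by simp
qed auto

lemma form_lin: "form 1 (lin h)"
proof -
  have "form 1 (\<lambda>y. \<Sum>i\<in>UNIV. h $ i * y $ i)"
    by (intro form_sum form_scale form_coord)
  then show ?thesis by (simp add: lin_def[abs_def])
qed

lemma form_matrix:
  fixes L :: "'k::field ^ 'i::finite ^ 'i"
  assumes "form d F" shows "form d (\<lambda>y. F (L *v y))"
proof -
  obtain c where c: "\<And>y. F y = (\<Sum>e\<in>{e. (\<Sum>i\<in>UNIV. e i) = d}. c e * (\<Prod>i\<in>UNIV. (y $ i) ^ e i))"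
    using assms by (elim formE) blast
  have row: "form 1 (\<lambda>y. (L *v y) $ i)" for i
    using form_lin[of "row i L"] by (simp add: lin_def[abs_def] matrix_vector_mult_def row_def)
  have "form d (\<lambda>y. c e * (\<Prod>i\<in>UNIV. (L *v y) $ i ^ e i))" if "(\<Sum>i\<in>UNIV. e i) = d" for e
    using form_prod[of UNIV "\<lambda>i. e i * 1" "\<lambda>i y. (L *v y) $ i ^ e i"] form_power[OF row] that
    by (intro form_scale) simp
  then show ?thesis unfolding c by (intro form_sum) auto
qed

lemma form_homogeneous:
  assumes "form d F" shows "F (a *s y) = a ^ d * F y"
proof -
  obtain c where c: "\<And>y. F y = (\<Sum>e\<in>{e. (\<Sum>i\<in>UNIV. e i) = d}. c e * (\<Prod>i\<in>UNIV. (y $ i) ^ e i))"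
    using assms by (elim formE) blast
  show ?thesis
    unfolding c sum_distrib_left
    by (intro sum.cong) (auto simp: power_mult_distrib prod.distrib power_sum[symmetric])
qed

text \<open>Vanishing of forms on curves thereby becomes a question about univariate polynomials.
  Density of the torus points, irreducibility and orders of vanishing all rest on this.\<close>

lemma form_poly_curve:
  fixes F :: "'k::field ^ 'i::finite \<Rightarrow> 'k" and c :: "'i \<Rightarrow> 'k poly"
  assumes "form d F"
  obtains p where "\<And>x. F (\<chi> i. poly (c i) x) = poly p x"
proof -
  obtain k where k: "\<And>y. F y = (\<Sum>e\<in>{e. (\<Sum>i\<in>UNIV. e i) = d}. k e * (\<Prod>i\<in>UNIV. (y $ i) ^ e i))"
    using assms by (elim formE) blast
  show thesis
    by (rule that[of "\<Sum>e\<in>{e. (\<Sum>i\<in>UNIV. e i) = d}. smult (k e) (\<Prod>i\<in>UNIV. c i ^ e i)"])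
       (simp add: k poly_sum poly_prod)
qed

section \<open>The Zariski topology\<close>

lemma openin_zariski_basic: "form d F \<Longrightarrow> openin zariski {y. y \<noteq> 0 \<and> F y \<noteq> 0}"
  unfolding zariski_def by (rule topology_generated_by_Basis) blast

lemma topspace_zariski: "topspace zariski = {y. y \<noteq> 0}"
proof -
  have "openin zariski {y :: 'a ^ 'b. y \<noteq> 0}"
    using openin_zariski_basic[OF form_const[of 1]] by simp
  moreover have "topspace zariski \<subseteq> {y :: 'a ^ 'b. y \<noteq> 0}"
    unfolding zariski_def topology_generated_by_topspace by blast
  ultimately show ?thesis using openin_subset by fastforce
qed

text \<open>The nonvanishing sets are only given as a subbase. They form a base because a product of
  forms is a form, so one form describes a neighbourhood.\<close>

lemma openin_zariskiD:
  assumes "openin zariski U" and "x \<in> U"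
  obtains d R where "form d R" "R x \<noteq> 0" "\<And>y. y \<noteq> 0 \<Longrightarrow> R y \<noteq> 0 \<Longrightarrow> y \<in> U"
proof -
  have "generate_topology_on {{y. y \<noteq> 0 \<and> F y \<noteq> 0} | d F. form d F} U"
    using assms(1) unfolding zariski_def by (simp add: openin_topology_generated_by_iff)
  then have "\<forall>x\<in>U. \<exists>d R. form d R \<and> R x \<noteq> 0 \<and> (\<forall>y. y \<noteq> 0 \<longrightarrow> R y \<noteq> 0 \<longrightarrow> y \<in> U)"
  proof induction
    case (Int A B)
    show ?case
    proof
      fix x assume "x \<in> A \<inter> B"
      then have "x \<in> A" "x \<in> B" by auto
      obtain d R where "form d R" "R x \<noteq> 0" "\<forall>y. y \<noteq> 0 \<longrightarrow> R y \<noteq> 0 \<longrightarrow> y \<in> A"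
        using Int.IH(1) \<open>x \<in> A\<close> by meson
      moreover obtain d' R' where "form d' R'" "R' x \<noteq> 0" "\<forall>y. y \<noteq> 0 \<longrightarrow> R' y \<noteq> 0 \<longrightarrow> y \<in> B"
        using Int.IH(2) \<open>x \<in> B\<close> by meson
      ultimately show "\<exists>d R. form d R \<and> R x \<noteq> 0 \<and> (\<forall>y. y \<noteq> 0 \<longrightarrow> R y \<noteq> 0 \<longrightarrow> y \<in> A \<inter> B)"
        by (intro exI[of _ "d + d'"] exI[of _ "\<lambda>y. R y * R' y"]) (auto intro: form_mult)
    qed
  next
    case (UN K)
    show ?case
    proof
      fix x assume "x \<in> \<Union>K"
      then obtain k where "k \<in> K" "x \<in> k" by blast
      then obtain d R where "form d R" "R x \<noteq> 0" "\<forall>y. y \<noteq> 0 \<longrightarrow> R y \<noteq> 0 \<longrightarrow> y \<in> k"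
        using UN.IH by meson
      then show "\<exists>d R. form d R \<and> R x \<noteq> 0 \<and> (\<forall>y. y \<noteq> 0 \<longrightarrow> R y \<noteq> 0 \<longrightarrow> y \<in> \<Union>K)"
        using \<open>k \<in> K\<close> by blast
    qed
  qed auto
  with assms(2) obtain d R where "form d R" "R x \<noteq> 0" "\<forall>y. y \<noteq> 0 \<longrightarrow> R y \<noteq> 0 \<longrightarrow> y \<in> U" by meson
  then show thesis by (intro that[of d R]) auto
qed

text \<open>The passage from topology to equations: from here on closures are handled only through
  the forms vanishing on a set.\<close>

lemma closure_of_zariski:
  assumes "0 \<notin> S"
  shows "zariski closure_of S = {y. y \<noteq> 0 \<and> (\<forall>d F. form d F \<and> (\<forall>s\<in>S. F s = 0) \<longrightarrow> F y = 0)}"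
proof (intro set_eqI iffI)
  fix y assume y: "y \<in> zariski closure_of S"
  then have "y \<noteq> 0" by (auto simp: in_closure_of topspace_zariski)
  moreover have "F y = 0" if F: "form d F" "\<forall>s\<in>S. F s = 0" for d F
  proof (rule ccontr)
    assume "F y \<noteq> 0"
    then have "y \<in> {y. y \<noteq> 0 \<and> F y \<noteq> 0}" using \<open>y \<noteq> 0\<close> by simp
    then obtain s where "s \<in> S" "s \<in> {y. y \<noteq> 0 \<and> F y \<noteq> 0}"
      using y openin_zariski_basic[OF F(1)] unfolding in_closure_of by meson
    then show False using F(2) by simp
  qed
  ultimately show "y \<in> {y. y \<noteq> 0 \<and> (\<forall>d F. form d F \<and> (\<forall>s\<in>S. F s = 0) \<longrightarrow> F y = 0)}" by blast
next
  fix y assume y: "y \<in> {y. y \<noteq> 0 \<and> (\<forall>d F. form d F \<and> (\<forall>s\<in>S. F s = 0) \<longrightarrow> F y = 0)}"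
  have "\<exists>s. s \<in> S \<and> s \<in> T" if T: "y \<in> T" "openin zariski T" for T
  proof -
    obtain d R where R: "form d R" "R y \<noteq> 0" "\<And>z. z \<noteq> 0 \<Longrightarrow> R z \<noteq> 0 \<Longrightarrow> z \<in> T"
      by (rule openin_zariskiD[OF T(2,1)]) blast
    then obtain s where "s \<in> S" "R s \<noteq> 0" using y by blast
    then show ?thesis using R(3) assms by metis
  qed
  with y show "y \<in> zariski closure_of S" by (auto simp: in_closure_of topspace_zariski)
qed

lemma openin_subtopology_zariski_basic:
  assumes "0 \<notin> X" "form d F"
  shows "openin (subtopology zariski X) {y \<in> X. F y \<noteq> 0}"
  unfolding openin_subtopology
  by (rule exI, rule conjI, rule openin_zariski_basic[OF assms(2)]) (use assms(1) in auto)

lemma openin_subtopology_zariskiD: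
  assumes "0 \<notin> X" "openin (subtopology zariski X) U" and "x \<in> U"
  obtains d R where "form d R" "R x \<noteq> 0" "\<And>y. y \<in> X \<Longrightarrow> R y \<noteq> 0 \<Longrightarrow> y \<in> U"
proof -
  obtain T where T: "openin zariski T" "U = T \<inter> X"
    using assms(2) by (auto simp: openin_subtopology)
  then have "x \<in> T" using assms(3) by blast
  with T(1) obtain d R where "form d R" "R x \<noteq> 0" "\<And>y. y \<noteq> 0 \<Longrightarrow> R y \<noteq> 0 \<Longrightarrow> y \<in> T"
    by (rule openin_zariskiD) blast
  moreover have "y \<noteq> 0" if "y \<in> X" for y using that assms(1) by auto
  ultimately show thesis using T(2) by (intro that[of d R]) auto
qed

text \<open>Irreducibility in the shape in which it is used: forms restricted to \<open>X\<close>
  have no zero divisors.\<close>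

lemma irreducible_nonzero:
  assumes "0 \<notin> X" "zariski_irreducible X" "form d F" "form d' G"
    "x \<in> X" "F x \<noteq> 0" "y \<in> X" "G y \<noteq> 0"
  obtains z where "z \<in> X" "F z \<noteq> 0" "G z \<noteq> 0"
proof -
  have "{y \<in> X. F y \<noteq> 0} \<inter> {y \<in> X. G y \<noteq> 0} \<noteq> {}"
    using assms(2) openin_subtopology_zariski_basic[OF assms(1,3)]
      openin_subtopology_zariski_basic[OF assms(1,4)] assms(5-8)
    unfolding zariski_irreducible_def by (metis (mono_tags, lifting) empty_iff mem_Collect_eq)
  then show thesis using that by blast
qed

lemma irreducibleI:
  assumes "0 \<notin> X" "X \<noteq> {}"
    and "\<And>d F d' G x y. form d F \<Longrightarrow> form d' G \<Longrightarrow> x \<in> X \<Longrightarrow> F x \<noteq> 0 \<Longrightarrow> y \<in> X \<Longrightarrow> G y \<noteq> 0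
           \<Longrightarrow> \<exists>z\<in>X. F z \<noteq> 0 \<and> G z \<noteq> 0"
  shows "zariski_irreducible X"
  unfolding zariski_irreducible_def
proof (intro conjI allI impI)
  fix U V
  assume *: "openin (subtopology zariski X) U \<and> U \<noteq> {} \<and> openin (subtopology zariski X) V \<and> V \<noteq> {}"
  then obtain x y where "x \<in> U" "y \<in> V" by blast
  from * have "openin (subtopology zariski X) U" "openin (subtopology zariski X) V" by auto
  obtain d F where F: "form d F" "F x \<noteq> 0" "\<And>y. y \<in> X \<Longrightarrow> F y \<noteq> 0 \<Longrightarrow> y \<in> U"
    using openin_subtopology_zariskiD[OF assms(1) \<open>openin _ U\<close> \<open>x \<in> U\<close>] by metis
  obtain d' G where G: "form d' G" "G y \<noteq> 0" "\<And>y. y \<in> X \<Longrightarrow> G y \<noteq> 0 \<Longrightarrow> y \<in> V"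
    using openin_subtopology_zariskiD[OF assms(1) \<open>openin _ V\<close> \<open>y \<in> V\<close>] by metis
  have "x \<in> X" "y \<in> X"
    using * \<open>x \<in> U\<close> \<open>y \<in> V\<close> openin_subset by fastforce+
  from assms(3)[OF F(1) G(1) this(1) F(2) this(2) G(2)] show "U \<inter> V \<noteq> {}"
    using F(3) G(3) by blast
qed fact

lemma dense_open_nonvanishing:
  assumes "0 \<notin> X" "zariski_irreducible X" "form d F" "x \<in> X" "F x \<noteq> 0"
  shows "dense_open X {y \<in> X. F y \<noteq> 0}"
proof -
  have "y \<in> zariski closure_of {y \<in> X. F y \<noteq> 0}" if "y \<in> X" for y
  proof -
    have "G y = 0" if "form e G" "\<forall>s\<in>{y \<in> X. F y \<noteq> 0}. G s = 0" for e G
      using irreducible_nonzero[OF assms(1-3) that(1) assms(4,5) \<open>y \<in> X\<close>] that(2) by blast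
    moreover have "0 \<notin> {y \<in> X. F y \<noteq> 0}" "y \<noteq> 0" using assms(1) \<open>y \<in> X\<close> by auto
    ultimately show ?thesis unfolding closure_of_zariski[OF \<open>0 \<notin> {y \<in> X. F y \<noteq> 0}\<close>] by blast
  qed
  then show ?thesis
    unfolding dense_open_def using openin_subtopology_zariski_basic[OF assms(1,3)] by blast
qed

section \<open>Polynomial functions over infinite fields\<close>

text \<open>Induction on the variables. For fixed values of the others the sum is a polynomial in
  the new variable \<open>c\<close> that vanishes everywhere, so its coefficient at
  \<open>n i c\<close> is zero; on the indices \<open>?I\<close> contributing to it the remaining
  exponents still separate.\<close>

lemma multivariate_zero:
  fixes h :: "'x \<Rightarrow> 'k::field_char_0" and n :: "'x \<Rightarrow> 'c \<Rightarrow> nat"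
  assumes "finite C" "finite I"
    and "\<And>i i'. i \<in> I \<Longrightarrow> i' \<in> I \<Longrightarrow> \<forall>c\<in>C. n i c = n i' c \<Longrightarrow> i = i'"
    and "\<And>q. (\<Sum>i\<in>I. h i * (\<Prod>c\<in>C. q c ^ n i c)) = 0"
    and "i \<in> I"
  shows "h i = 0"
  using assms
proof (induction C arbitrary: I h i rule: finite_induct)
  case empty
  then have "I = {i}" by blast
  with empty show ?case by simp
next
  case (insert c C)
  let ?I = "{i' \<in> I. n i' c = n i c}"
  show ?case
  proof (rule insert.IH[of ?I])
    fix q :: "'c \<Rightarrow> 'k"
    define p where "p = (\<Sum>i'\<in>I. monom (h i' * (\<Prod>c\<in>C. q c ^ n i' c)) (n i' c))"
    have "poly p x = 0" for x
    proof -
      have "(\<Prod>c'\<in>C. (q(c := x)) c' ^ n i' c') = (\<Prod>c'\<in>C. q c' ^ n i' c')" for i'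
        using insert.hyps by (intro prod.cong) auto
      then show ?thesis
        using insert.prems(3)[of "q(c := x)"] insert.hyps
        by (simp add: p_def poly_sum poly_monom mult_ac)
    qed
    then have "p = 0" using poly_all_0_iff_0 by blast
    then have "coeff p (n i c) = 0" by simp
    moreover have "coeff p (n i c) = (\<Sum>i'\<in>I. if n i' c = n i c then h i' * (\<Prod>c\<in>C. q c ^ n i' c) else 0)"
      by (simp add: p_def coeff_sum)
    ultimately show "(\<Sum>i'\<in>?I. h i' * (\<Prod>c\<in>C. q c ^ n i' c)) = 0"
      using insert.prems(1) by (simp add: sum.inter_filter)
  qed (use insert.prems in auto)
qed

section \<open>Local rings and linear automorphisms\<close>

lemma germ_eq_iff:
  assumes "0 \<notin> X" "x \<in> X"
  shows "germ_eq X x f g \<longleftrightarrow> (\<exists>d R. form d R \<and> R x \<noteq> 0 \<and> (\<forall>y\<in>X. R y \<noteq> 0 \<longrightarrow> f y = g y))"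
proof
  assume "germ_eq X x f g"
  then obtain U where U: "openin (subtopology zariski X) U" "x \<in> U" "\<forall>y\<in>U. f y = g y"
    unfolding germ_eq_def by blast
  from openin_subtopology_zariskiD[OF assms(1) U(1,2)] obtain d R where
    "form d R" "R x \<noteq> 0" "\<And>y. y \<in> X \<Longrightarrow> R y \<noteq> 0 \<Longrightarrow> y \<in> U" by metis
  with U(3) show "\<exists>d R. form d R \<and> R x \<noteq> 0 \<and> (\<forall>y\<in>X. R y \<noteq> 0 \<longrightarrow> f y = g y)" by blast
next
  assume "\<exists>d R. form d R \<and> R x \<noteq> 0 \<and> (\<forall>y\<in>X. R y \<noteq> 0 \<longrightarrow> f y = g y)"
  then obtain d R where R: "form d R" "R x \<noteq> 0" "\<forall>y\<in>X. R y \<noteq> 0 \<longrightarrow> f y = g y" by blast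
  show "germ_eq X x f g"
    unfolding germ_eq_def
    by (rule exI[of _ "{y \<in> X. R y \<noteq> 0}"])
       (use openin_subtopology_zariski_basic[OF assms(1) R(1)] R assms(2) in auto)
qed

lemma local_ringI:
  "form d P \<Longrightarrow> form d Q \<Longrightarrow> Q x \<noteq> 0 \<Longrightarrow> (\<And>y. y \<in> X \<Longrightarrow> Q y \<noteq> 0 \<Longrightarrow> f y = P y / Q y) \<Longrightarrow> f \<in> local_ring X x"
  unfolding local_ring_def by blast

lemma local_ring_quotient: "form d P \<Longrightarrow> form d Q \<Longrightarrow> Q x \<noteq> 0 \<Longrightarrow> (\<lambda>y. P y / Q y) \<in> local_ring X x"
  by (rule local_ringI) auto

lemma local_ringE:
  assumes "f \<in> local_ring X x"
  obtains d P Q where "form d P" "form d Q" "Q x \<noteq> 0"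
    "\<And>y. y \<in> X \<Longrightarrow> Q y \<noteq> 0 \<Longrightarrow> f y = P y / Q y"
  using assms unfolding local_ring_def by blast

lemma local_ring_const: "(\<lambda>y. a) \<in> local_ring X x"
  by (rule local_ringI[OF form_const[of a] form_const[of 1]]) auto

lemma local_ring_mult:
  assumes "f \<in> local_ring X x" "g \<in> local_ring X x"
  shows "(\<lambda>y. f y * g y) \<in> local_ring X x"
proof -
  obtain d P Q where P: "form d P" "form d Q" "Q x \<noteq> 0" "\<And>y. y \<in> X \<Longrightarrow> Q y \<noteq> 0 \<Longrightarrow> f y = P y / Q y"
    using assms(1) by (elim local_ringE) blast
  obtain d' P' Q' where P': "form d' P'" "form d' Q'" "Q' x \<noteq> 0"
    "\<And>y. y \<in> X \<Longrightarrow> Q' y \<noteq> 0 \<Longrightarrow> g y = P' y / Q' y"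
    using assms(2) by (elim local_ringE) blast
  show ?thesis
    by (rule local_ringI[OF form_mult[OF P(1) P'(1)] form_mult[OF P(2) P'(2)]]) (use P P' in auto)
qed

lemma local_ring_add:
  assumes "f \<in> local_ring X x" "g \<in> local_ring X x"
  shows "(\<lambda>y. f y + g y) \<in> local_ring X x"
proof -
  obtain d P Q where P: "form d P" "form d Q" "Q x \<noteq> 0" "\<And>y. y \<in> X \<Longrightarrow> Q y \<noteq> 0 \<Longrightarrow> f y = P y / Q y"
    using assms(1) by (elim local_ringE) blast
  obtain d' P' Q' where P': "form d' P'" "form d' Q'" "Q' x \<noteq> 0"
    "\<And>y. y \<in> X \<Longrightarrow> Q' y \<noteq> 0 \<Longrightarrow> g y = P' y / Q' y"
    using assms(2) by (elim local_ringE) blast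
  have "form (d + d') (\<lambda>y. P y * Q' y + Q y * P' y)"
    by (intro form_add form_mult P P')
  then show ?thesis
    by (rule local_ringI[OF _ form_mult[OF P(2) P'(2)]]) (use P P' in \<open>auto simp: add_frac_eq mult_ac\<close>)
qed

lemma local_ring_sum: "(\<And>a. a \<in> A \<Longrightarrow> f a \<in> local_ring X x) \<Longrightarrow> (\<lambda>y. \<Sum>a\<in>A. f a y) \<in> local_ring X x"
  by (induction A rule: infinite_finite_induct) (auto intro: local_ring_const local_ring_add)

lemma local_ring_prod: "(\<And>a. a \<in> A \<Longrightarrow> f a \<in> local_ring X x) \<Longrightarrow> (\<lambda>y. \<Prod>a\<in>A. f a y) \<in> local_ring X x"
  by (induction A rule: infinite_finite_induct) (auto intro: local_ring_const local_ring_mult)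

lemma local_ring_power: "f \<in> local_ring X x \<Longrightarrow> (\<lambda>y. f y ^ n) \<in> local_ring X x"
  by (induction n) (auto intro: local_ring_const local_ring_mult)

text \<open>The inverse belongs to the data because functions at \<open>x\<close> are carried to
  \<open>L *v x\<close> by pulling back along \<open>L'\<close>.\<close>

definition linear_aut :: "('k::field ^ 'i::finite) set \<Rightarrow> 'k ^ 'i ^ 'i \<Rightarrow> 'k ^ 'i ^ 'i \<Rightarrow> bool" where
  "linear_aut X L L' \<longleftrightarrow> L ** L' = mat 1 \<and> L' ** L = mat 1 \<and>
     (\<forall>y\<in>X. L *v y \<in> X) \<and> (\<forall>y\<in>X. L' *v y \<in> X)"

lemma linear_aut_inverse:
  assumes "linear_aut X L L'" shows "L *v (L' *v y) = y" "L' *v (L *v y) = y"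
  using assms unfolding linear_aut_def by (auto simp: matrix_vector_mul_assoc)

lemma linear_aut_mem:
  assumes "linear_aut X L L'" shows "y \<in> X \<Longrightarrow> L *v y \<in> X" "y \<in> X \<Longrightarrow> L' *v y \<in> X"
  using assms unfolding linear_aut_def by auto

lemma local_ring_pullback:
  assumes "\<forall>y\<in>X. L *v y \<in> X" "f \<in> local_ring X (L *v x)"
  shows "(\<lambda>y. f (L *v y)) \<in> local_ring X x"
proof -
  obtain d P Q where P: "form d P" "form d Q" "Q (L *v x) \<noteq> 0"
    "\<And>y. y \<in> X \<Longrightarrow> Q y \<noteq> 0 \<Longrightarrow> f y = P y / Q y"
    using assms(2) by (elim local_ringE) blast
  show ?thesis
    by (rule local_ringI[OF form_matrix[OF P(1)] form_matrix[OF P(2)]]) (use P assms(1) in auto)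
qed

lemma germ_eq_pullback:
  assumes "\<forall>y\<in>X. L *v y \<in> X" "0 \<notin> X" "x \<in> X" "germ_eq X (L *v x) f g"
  shows "germ_eq X x (\<lambda>y. f (L *v y)) (\<lambda>y. g (L *v y))"
proof -
  have "L *v x \<in> X" using assms by blast
  with assms(2,4) obtain d R where R: "form d R" "R (L *v x) \<noteq> 0" "\<forall>y\<in>X. R y \<noteq> 0 \<longrightarrow> f y = g y"
    by (auto simp: germ_eq_iff)
  show ?thesis
    unfolding germ_eq_iff[OF assms(2,3)]
    by (intro exI[of _ d] exI[of _ "\<lambda>y. R (L *v y)"] conjI form_matrix R) (use R assms(1) in auto)
qed

lemma max_ideal_pullback:
  assumes "\<forall>y\<in>X. L *v y \<in> X" "f \<in> max_ideal X (L *v x)"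
  shows "(\<lambda>y. f (L *v y)) \<in> max_ideal X x"
  using assms local_ring_pullback[OF assms(1), of f x] unfolding max_ideal_def by simp

lemma max_ideal_power_pullback:
  assumes "\<forall>y\<in>X. L *v y \<in> X" "0 \<notin> X" "x \<in> X" "f \<in> max_ideal_power X (L *v x) q"
  shows "(\<lambda>y. f (L *v y)) \<in> max_ideal_power X x q"
  using assms(4)
proof (induction q arbitrary: f)
  case 0
  then show ?case using local_ring_pullback[OF assms(1)] by simp
next
  case (Suc q)
  then obtain n :: nat and g h where f: "f \<in> local_ring X (L *v x)"
    and gh: "\<forall>s<n. g s \<in> max_ideal X (L *v x) \<and> h s \<in> max_ideal_power X (L *v x) q"
    and eq: "germ_eq X (L *v x) f (\<lambda>y. \<Sum>s<n. g s y * h s y)" by auto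
  have "\<forall>s<n. (\<lambda>y. g s (L *v y)) \<in> max_ideal X x \<and> (\<lambda>y. h s (L *v y)) \<in> max_ideal_power X x q"
    using gh Suc.IH max_ideal_pullback[OF assms(1)] by blast
  moreover have "(\<lambda>y. f (L *v y)) \<in> local_ring X x" using local_ring_pullback[OF assms(1) f] .
  moreover have "germ_eq X x (\<lambda>y. f (L *v y)) (\<lambda>y. \<Sum>s<n. g s (L *v y) * h s (L *v y))"
    using germ_eq_pullback[OF assms(1-3) eq] .
  ultimately show ?case
    unfolding max_ideal_power.simps mem_Collect_eq
    by (intro conjI exI[of _ n] exI[of _ "\<lambda>s y. g s (L *v y)"] exI[of _ "\<lambda>s y. h s (L *v y)"])
qed

lemma smooth_at_linear_aut:
  assumes aut: "linear_aut X L L'" and X: "0 \<notin> X" and smooth: "smooth_at X x"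
  shows "smooth_at X (L *v x)"
proof -
  have x: "x \<in> X" "L *v x \<in> X" using smooth aut unfolding smooth_at_def linear_aut_def by auto
  have stab: "\<forall>y\<in>X. L *v y \<in> X" "\<forall>y\<in>X. L' *v y \<in> X" using aut unfolding linear_aut_def by auto
  have inv_x: "L' *v (L *v x) = x" by (rule linear_aut_inverse[OF aut])
  let ?d = "variety_dim X"
  obtain f where f: "\<forall>j<?d. f j \<in> max_ideal X x"
    and gen: "\<forall>g\<in>max_ideal X x. \<exists>h. (\<forall>j<?d. h j \<in> local_ring X x) \<and>
               germ_eq X x g (\<lambda>y. \<Sum>j<?d. h j y * f j y)"
    using smooth unfolding smooth_at_def by blast
  show ?thesis
    unfolding smooth_at_def
  proof (rule conjI, rule x(2), rule exI[of _ "\<lambda>j y. f j (L' *v y)"], intro conjI ballI allI impI)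
    fix j assume "j < ?d"
    then show "(\<lambda>y. f j (L' *v y)) \<in> max_ideal X (L *v x)"
      using f max_ideal_pullback[OF stab(2), of "f j" "L *v x"] inv_x by auto
  next
    fix g assume "g \<in> max_ideal X (L *v x)"
    from gen[rule_format, OF max_ideal_pullback[OF stab(1) this]] obtain h where
      h: "\<forall>j<?d. h j \<in> local_ring X x"
      and eq: "germ_eq X x (\<lambda>y. g (L *v y)) (\<lambda>y. \<Sum>j<?d. h j y * f j y)" by blast
    have "germ_eq X (L *v x) (\<lambda>y. g (L *v (L' *v y))) (\<lambda>y. \<Sum>j<?d. h j (L' *v y) * f j (L' *v y))"
      by (rule germ_eq_pullback[OF stab(2) X x(2)]) (use eq inv_x in simp)
    moreover have "(\<lambda>y. h j (L' *v y)) \<in> local_ring X (L *v x)" if "j < ?d" for j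
      using h local_ring_pullback[OF stab(2), of "h j" "L *v x"] inv_x that by auto
    ultimately show "\<exists>h. (\<forall>j<?d. h j \<in> local_ring X (L *v x)) \<and>
        germ_eq X (L *v x) g (\<lambda>y. \<Sum>j<?d. h j y * f j (L' *v y))"
      by (intro exI[of _ "\<lambda>j y. h j (L' *v y)"]) (simp add: linear_aut_inverse[OF aut])
  qed
qed

lemma lin_matrix:
  fixes L :: "'k::field ^ 'i::finite ^ 'i"
  shows "lin h (L *v y) = lin (transpose L *v h) y"
  unfolding lin_def matrix_vector_mult_def transpose_def
  by (simp add: sum_distrib_left sum_distrib_right)
     (subst sum.swap, simp add: mult_ac)

text \<open>Pullback along \<open>L\<close> acts on linear forms by the transpose, and the
  trivializing form \<open>g\<close> is transported in the same way.\<close>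

lemma jet_kernel_linear_aut:
  assumes aut: "linear_aut X L L'" and X: "0 \<notin> X" "x \<in> X"
  shows "h \<in> jet_kernel p X (L *v x) \<longleftrightarrow> transpose L *v h \<in> jet_kernel p X x"
proof -
  have stab: "\<forall>y\<in>X. L *v y \<in> X" "\<forall>y\<in>X. L' *v y \<in> X" using aut unfolding linear_aut_def by auto
  note inv = linear_aut_inverse[OF aut]
  show ?thesis
  proof
    assume "h \<in> jet_kernel p X (L *v x)"
    then obtain g where g: "lin g (L *v x) \<noteq> 0"
      "(\<lambda>y. lin h y / lin g y) \<in> max_ideal_power X (L *v x) (Suc p)"
      unfolding jet_kernel_def by blast
    from max_ideal_power_pullback[OF stab(1) X g(2)] g(1)
    show "transpose L *v h \<in> jet_kernel p X x"
      unfolding jet_kernel_def mem_Collect_eq lin_matrix by blast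
  next
    assume "transpose L *v h \<in> jet_kernel p X x"
    then obtain g where g: "lin g x \<noteq> 0"
      "(\<lambda>y. lin (transpose L *v h) y / lin g y) \<in> max_ideal_power X x (Suc p)"
      unfolding jet_kernel_def by blast
    have "L *v x \<in> X" using stab X by blast
    from max_ideal_power_pullback[OF stab(2) X(1) this, unfolded inv, OF g(2)]
    have "(\<lambda>y. lin h y / lin (transpose L' *v g) y) \<in> max_ideal_power X (L *v x) (Suc p)"
      by (simp only: lin_matrix[symmetric] inv)
    moreover have "lin (transpose L' *v g) (L *v x) \<noteq> 0"
      using g(1) by (simp only: lin_matrix[symmetric] inv not_False_eq_True)
    ultimately show "h \<in> jet_kernel p X (L *v x)"
      unfolding jet_kernel_def by blast
  qed
qed

lemma transpose_inverse:
  fixes L :: "'k::field ^ 'i::finite ^ 'i"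
  assumes "L ** L' = mat 1"
  shows "transpose L' *v (transpose L *v h) = h"
proof -
  have "transpose L' ** transpose L = mat 1"
    using assms by (metis matrix_transpose_mul transpose_mat)
  then show ?thesis by (simp only: matrix_vector_mul_assoc matrix_vector_mul_lid)
qed

lemma dim_matrix_image:
  fixes L :: "'k::field ^ 'i::finite ^ 'j::finite"
  assumes "inj ((*v) L)" shows "vec.dim ((*v) L ` S) = vec.dim S"
  by (rule vec.dim_image_eq) (use assms in \<open>auto intro: inj_on_subset\<close>)

lemma jet_rank_linear_aut:
  assumes aut: "linear_aut X L L'" and X: "0 \<notin> X" "x \<in> X"
  shows "jet_rank p X (L *v x) = jet_rank p X x"
proof -
  have LL: "L ** L' = mat 1" "L' ** L = mat 1" using aut unfolding linear_aut_def by auto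
  have "jet_kernel p X x = (*v) (transpose L) ` jet_kernel p X (L *v x)"
  proof
    show "jet_kernel p X x \<subseteq> (*v) (transpose L) ` jet_kernel p X (L *v x)"
    proof
      fix h assume "h \<in> jet_kernel p X x"
      then have "transpose L' *v h \<in> jet_kernel p X (L *v x)"
        by (simp only: jet_kernel_linear_aut[OF aut X] transpose_inverse[OF LL(2)])
      then show "h \<in> (*v) (transpose L) ` jet_kernel p X (L *v x)"
        by (metis image_eqI transpose_inverse[OF LL(2)])
    qed
  qed (use jet_kernel_linear_aut[OF aut X] in blast)
  moreover have "inj ((*v) (transpose L))"
    by (rule inj_on_inverseI[of _ "(*v) (transpose L')"]) (rule transpose_inverse[OF LL(1)])
  ultimately show ?thesis unfolding jet_rank_def by (simp only: dim_matrix_image)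
qed

section \<open>Counting monomials\<close>

text \<open>Gaussian elimination, by induction on the equations: a pivot \<open>b0\<close> in
  equation \<open>a\<close> eliminates one unknown, leaving a system with one equation and one
  unknown less.\<close>

lemma underdetermined_system:
  fixes M :: "'a \<Rightarrow> 'b \<Rightarrow> 'k::field"
  assumes "finite A" "finite B" "card A < card B"
  obtains c where "\<exists>b\<in>B. c b \<noteq> 0" "\<And>a. a \<in> A \<Longrightarrow> (\<Sum>b\<in>B. c b * M a b) = 0"
proof -
  have "\<exists>c. (\<exists>b\<in>B. c b \<noteq> 0) \<and> (\<forall>a\<in>A. (\<Sum>b\<in>B. c b * M a b) = 0)"
    using assms
  proof (induction A arbitrary: B M rule: finite_induct)
    case empty
    then have "B \<noteq> {}" by auto
    then show ?case by (intro exI[of _ "\<lambda>_. 1"]) auto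
  next
    case (insert a A)
    show ?case
    proof (cases "\<forall>b\<in>B. M a b = 0")
      case True
      have "card A < card B" using insert by simp
      from insert.IH[OF insert.prems(1) this, of M] True show ?thesis by auto
    next
      case False
      then obtain b0 where b0: "b0 \<in> B" "M a b0 \<noteq> 0" by blast
      let ?B = "B - {b0}"
      have "card A < card ?B" using insert b0 by simp
      from insert.IH[OF _ this, of "\<lambda>a' b. M a' b - M a' b0 * M a b / M a b0"] insert.prems(1)
      obtain c where c: "\<exists>b\<in>?B. c b \<noteq> 0"
        "\<forall>a'\<in>A. (\<Sum>b\<in>?B. c b * (M a' b - M a' b0 * M a b / M a b0)) = 0" by auto
      \<comment> \<open>The value that equation \<open>a\<close> forces on the pivot unknown, up to
        sign.\<close>
      let ?s = "(\<Sum>b\<in>?B. c b * M a b) / M a b0"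
      let ?c = "c(b0 := - ?s)"
      have split: "(\<Sum>b\<in>B. ?c b * M a' b) = - ?s * M a' b0 + (\<Sum>b\<in>?B. c b * M a' b)" for a'
      proof -
        have "(\<Sum>b\<in>?B. ?c b * M a' b) = (\<Sum>b\<in>?B. c b * M a' b)" by (intro sum.cong) auto
        then show ?thesis using insert.prems(1) b0(1) by (simp add: sum.remove[of B b0])
      qed
      have "(\<Sum>b\<in>B. ?c b * M a' b) = 0" if "a' \<in> insert a A" for a'
      proof (cases "a' = a")
        case True
        then show ?thesis unfolding split using b0 by simp
      next
        case False
        then have "a' \<in> A" using that by simp
        have "(\<Sum>b\<in>?B. c b * (M a' b - M a' b0 * M a b / M a b0))
            = (\<Sum>b\<in>?B. c b * M a' b) - (\<Sum>b\<in>?B. M a' b0 * (c b * M a b) / M a b0)"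
          by (simp add: right_diff_distrib sum_subtractf mult_ac)
        also have "(\<Sum>b\<in>?B. M a' b0 * (c b * M a b) / M a b0) = ?s * M a' b0"
          by (simp add: sum_distrib_left[symmetric] sum_divide_distrib[symmetric])
        finally show ?thesis unfolding split using c(2) \<open>a' \<in> A\<close> by simp
      qed
      moreover have "\<exists>b\<in>B. ?c b \<noteq> 0" using c(1) by auto
      ultimately show ?thesis by blast
    qed
  qed
  then show thesis using that by blast
qed

text \<open>The degree is bounded in each variable separately, so that the number of monomials is
  simply \<open>(D + 1) ^ card C\<close>.\<close>

definition mpoly :: "'c set \<Rightarrow> nat \<Rightarrow> (('c \<Rightarrow> 'k::field) \<Rightarrow> 'k) \<Rightarrow> bool" where
  "mpoly C D F \<longleftrightarrow> (\<exists>k. \<forall>q. F q = (\<Sum>e\<in>C \<rightarrow>\<^sub>E {..D}. k e * (\<Prod>c\<in>C. q c ^ e c)))"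

lemma mpoly_sumI:
  fixes g :: "'x \<Rightarrow> 'c \<Rightarrow> nat"
  assumes "finite C" "finite S" and D: "\<And>x c. x \<in> S \<Longrightarrow> c \<in> C \<Longrightarrow> g x c \<le> D"
    and F: "\<And>q. F q = (\<Sum>x\<in>S. k x * (\<Prod>c\<in>C. q c ^ g x c))"
  shows "mpoly C D F"
proof -
  let ?k = "\<lambda>e. \<Sum>x | x \<in> S \<and> restrict (g x) C = e. k x"
  have "F q = (\<Sum>e\<in>C \<rightarrow>\<^sub>E {..D}. ?k e * (\<Prod>c\<in>C. q c ^ e c))" for q
  proof -
    have "(\<Sum>e\<in>C \<rightarrow>\<^sub>E {..D}. ?k e * (\<Prod>c\<in>C. q c ^ e c))
        = (\<Sum>e\<in>C \<rightarrow>\<^sub>E {..D}. \<Sum>x | x \<in> S \<and> restrict (g x) C = e. k x * (\<Prod>c\<in>C. q c ^ g x c))"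
      by (auto simp: sum_distrib_right intro!: sum.cong prod.cong)
    also have "\<dots> = F q"
      unfolding F
    proof (rule sum.group)
      show "(\<lambda>x. restrict (g x) C) ` S \<subseteq> C \<rightarrow>\<^sub>E {..D}" using D by auto
    qed (use assms in \<open>auto intro!: finite_PiE\<close>)
    finally show ?thesis by simp
  qed
  then show ?thesis unfolding mpoly_def by (intro exI[of _ ?k] allI)
qed

lemma mpolyE:
  assumes "mpoly C D F"
  obtains k where "\<And>q. F q = (\<Sum>e\<in>C \<rightarrow>\<^sub>E {..D}. k e * (\<Prod>c\<in>C. q c ^ e c))"
  using assms unfolding mpoly_def by blast

lemma mpoly_mono:
  assumes "finite C" "mpoly C D F" "D \<le> D'" shows "mpoly C D' F"
proof -
  obtain k where k: "\<And>q. F q = (\<Sum>e\<in>C \<rightarrow>\<^sub>E {..D}. k e * (\<Prod>c\<in>C. q c ^ e c))"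
    using assms(2) by (elim mpolyE) blast
  show ?thesis
    by (rule mpoly_sumI[OF assms(1) _ _ k]) (use assms in \<open>auto intro!: finite_PiE simp: PiE_iff\<close>)
qed

lemma mpoly_one: "finite C \<Longrightarrow> mpoly C 0 (\<lambda>q. 1)"
  by (rule mpoly_sumI[where S = "{()}" and g = "\<lambda>_ _. 0" and k = "\<lambda>_. 1"]) auto

lemma mpoly_mult:
  assumes "finite C" "mpoly C D F" "mpoly C D' G"
  shows "mpoly C (D + D') (\<lambda>q. F q * G q)"
proof -
  obtain k where k: "\<And>q. F q = (\<Sum>e\<in>C \<rightarrow>\<^sub>E {..D}. k e * (\<Prod>c\<in>C. q c ^ e c))"
    using assms(2) by (elim mpolyE) blast
  obtain k' where k': "\<And>q. G q = (\<Sum>e\<in>C \<rightarrow>\<^sub>E {..D'}. k' e * (\<Prod>c\<in>C. q c ^ e c))"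
    using assms(3) by (elim mpolyE) blast
  let ?S = "(C \<rightarrow>\<^sub>E {..D}) \<times> (C \<rightarrow>\<^sub>E {..D'})"
  have "F q * G q = (\<Sum>x\<in>?S. (k (fst x) * k' (snd x)) * (\<Prod>c\<in>C. q c ^ (fst x c + snd x c)))" for q
    unfolding k k' sum_product sum.cartesian_product
    by (intro sum.cong) (auto simp: power_add prod.distrib)
  moreover have "finite ?S" using assms(1) by (auto intro!: finite_PiE)
  ultimately show ?thesis
    by (intro mpoly_sumI[OF assms(1), where S = ?S and k = "\<lambda>x. k (fst x) * k' (snd x)"
          and g = "\<lambda>x c. fst x c + snd x c"]) (auto simp: PiE_iff intro!: add_mono)
qed

lemma mpoly_power: "finite C \<Longrightarrow> mpoly C D F \<Longrightarrow> mpoly C (a * D) (\<lambda>q. F q ^ a)"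
  by (induction a) (auto intro: mpoly_one mpoly_mult)

lemma mpoly_prod:
  assumes "finite C" shows "(\<And>j. j \<in> J \<Longrightarrow> mpoly C (D j) (F j)) \<Longrightarrow> mpoly C (\<Sum>j\<in>J. D j) (\<lambda>q. \<Prod>j\<in>J. F j q)"
  by (induction J rule: infinite_finite_induct) (auto intro: mpoly_one mpoly_mult assms)

lemma mpoly_form:
  fixes P :: "'k::field ^ 'i::finite \<Rightarrow> 'k" and n :: "'i \<Rightarrow> 'c \<Rightarrow> nat"
  assumes "finite C" "form d P"
  shows "\<exists>D. mpoly C D (\<lambda>q. P (\<chi> i. \<Prod>c\<in>C. q c ^ n i c))"
proof -
  obtain k where k: "\<And>y. P y = (\<Sum>e\<in>{e. (\<Sum>i\<in>UNIV. e i) = d}. k e * (\<Prod>i\<in>UNIV. (y $ i) ^ e i))"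
    using assms(2) by (elim formE) blast
  let ?S = "{e :: 'i \<Rightarrow> nat. (\<Sum>i\<in>UNIV. e i) = d}"
  let ?g = "\<lambda>e c. \<Sum>i\<in>UNIV. n i c * e i"
  let ?D = "\<Sum>e\<in>?S. \<Sum>c\<in>C. ?g e c"
  have "mpoly C ?D (\<lambda>q. P (\<chi> i. \<Prod>c\<in>C. q c ^ n i c))"
  proof (rule mpoly_sumI[OF assms(1) finite_exponents])
    fix q :: "'c \<Rightarrow> 'k"
    have "(\<Prod>i\<in>UNIV. (\<Prod>c\<in>C. q c ^ n i c) ^ e i) = (\<Prod>c\<in>C. q c ^ ?g e c)" for e
      unfolding power_sum prod_power_distrib power_mult by (rule prod.swap)
    then show "P (\<chi> i. \<Prod>c\<in>C. q c ^ n i c) = (\<Sum>e\<in>?S. k e * (\<Prod>c\<in>C. q c ^ ?g e c))"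
      unfolding k by simp
  next
    fix e c assume "e \<in> ?S" "c \<in> C"
    have "?g e c \<le> (\<Sum>c\<in>C. ?g e c)"
      by (rule member_le_sum) (use \<open>c \<in> C\<close> assms in auto)
    also have "\<dots> \<le> ?D"
      by (rule member_le_sum[of e ?S "\<lambda>e. \<Sum>c\<in>C. ?g e c"]) (use \<open>e \<in> ?S\<close> finite_exponents in auto)
    finally show "?g e c \<le> ?D" .
  qed
  then show ?thesis ..
qed

text \<open>The denominator has the exponent \<open>E\<close> whatever \<open>e\<close> is, so a
  linear combination of many monomials can be cleared at once.\<close>

lemma prod_clear_denominators:
  fixes P Q :: "'j \<Rightarrow> 'k::field"
  assumes "\<And>j. j \<in> J \<Longrightarrow> Q j \<noteq> 0" "\<And>j. j \<in> J \<Longrightarrow> e j \<le> E"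
  shows "(\<Prod>j\<in>J. (P j / Q j) ^ e j) * (\<Prod>j\<in>J. Q j ^ E) = (\<Prod>j\<in>J. P j ^ e j * Q j ^ (E - e j))"
  unfolding prod.distrib[symmetric]
  by (rule prod.cong) (use assms in \<open>auto simp: power_divide power_diff\<close>)

section \<open>Varieties with a monomial chart\<close>

text \<open>The part of \<open>X\<close> with \<open>y $ i0 \<noteq> 0\<close> is an affine space
  with coordinates \<open>y $ idx c / y $ i0\<close>, and every coordinate of the projective space
  restricts to a monomial in them, with exponent vector \<open>n i\<close>. The exponent vectors are
  distinct and contain 0 and the unit vectors.\<close>

locale monomial_chart =
  fixes X :: "('k::field_char_0 ^ 'i::finite) set" and i0 :: 'i
    and C :: "'c::finite set" and n :: "'i \<Rightarrow> 'c \<Rightarrow> nat" and idx :: "'c \<Rightarrow> 'i"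
  assumes zero_notin: "0 \<notin> X" and irreducible: "zariski_irreducible X"
    and n_i0: "c \<in> C \<Longrightarrow> n i0 c = 0"
    and n_inj: "(\<And>c. c \<in> C \<Longrightarrow> n i c = n i' c) \<Longrightarrow> i = i'"
    and n_idx: "c \<in> C \<Longrightarrow> c' \<in> C \<Longrightarrow> n (idx c) c' = (if c = c' then 1 else 0)"
    and chart: "y \<in> X \<Longrightarrow> y $ i0 \<noteq> 0 \<Longrightarrow> y $ i / y $ i0 = (\<Prod>c\<in>C. (y $ idx c / y $ i0) ^ n i c)"
    and param_mem': "(\<chi> i. \<Prod>c\<in>C. q c ^ n i c) \<in> X"
begin

definition param :: "('c \<Rightarrow> 'k) \<Rightarrow> 'k ^ 'i" where
  "param q = (\<chi> i. \<Prod>c\<in>C. q c ^ n i c)"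

definition coord :: "'c \<Rightarrow> 'k ^ 'i \<Rightarrow> 'k" where
  "coord c y = y $ idx c / y $ i0"

definition deg :: "'i \<Rightarrow> nat" where
  "deg i = (\<Sum>c\<in>C. n i c)"

lemma finite_C: "finite C" by simp

lemma param_mem: "param q \<in> X" unfolding param_def by (rule param_mem')

lemma param_i0: "param q $ i0 = 1"
  by (simp add: param_def n_i0)

lemma param_idx: "c \<in> C \<Longrightarrow> param q $ idx c = q c"
proof -
  assume c: "c \<in> C"
  have "(\<Prod>c'\<in>C. q c' ^ n (idx c) c') = (\<Prod>c'\<in>C. if c' = c then q c' else 1)"
    by (rule prod.cong) (auto simp: n_idx c)
  then show ?thesis using c by (simp add: param_def)
qed

lemma coord_param: "c \<in> C \<Longrightarrow> coord c (param q) = q c"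
  by (simp add: coord_def param_i0 param_idx)

lemma deg_eq_0: "deg i = 0 \<longleftrightarrow> i = i0"
  using n_inj[of i i0] by (auto simp: deg_def n_i0)

lemma param_0: "param (\<lambda>_. 0) = axis i0 1"
proof (rule vec_eq_iff[THEN iffD2], rule allI)
  fix i show "param (\<lambda>_. 0) $ i = axis i0 1 $ i"
    using deg_eq_0[of i] by (auto simp: param_def axis_def deg_def power_0_left)
qed

lemma origin_mem: "axis i0 1 \<in> X"
  using param_mem[of "\<lambda>_. 0"] by (simp add: param_0)

lemma chart_param:
  assumes "y \<in> X" "y $ i0 \<noteq> 0" shows "y = y $ i0 *s param (\<lambda>c. coord c y)"
proof (rule vec_eq_iff[THEN iffD2], rule allI)
  fix i show "y $ i = (y $ i0 *s param (\<lambda>c. coord c y)) $ i"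
    using chart[OF assms, of i] assms(2) by (simp add: param_def coord_def field_simps)
qed

lemma coord_local_ring: "x $ i0 \<noteq> 0 \<Longrightarrow> coord c \<in> local_ring X x"
  unfolding coord_def[abs_def] by (rule local_ring_quotient[OF form_coord form_coord])

text \<open>Take \<open>card C + 1\<close> of the functions. Their monomials with exponents up to
  \<open>E\<close> become, after clearing denominators in the chart, polynomials in
  \<open>card C\<close> variables of degree linear in \<open>E\<close>. For large \<open>E\<close>
  there are more monomials than dimensions, which forces a linear relation.\<close>

lemma alg_indep_bound:
  assumes U: "openin (subtopology zariski X) U" "U \<noteq> {}"
    and f: "\<forall>j<d. \<forall>x\<in>U. f j \<in> local_ring X x" and indep: "alg_indep_on U d f"
  shows "d \<le> card C"
proof (rule ccontr)
  assume "\<not> d \<le> card C"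
  define m where "m = Suc (card C)"
  have md: "m \<le> d" using \<open>\<not> d \<le> card C\<close> by (simp add: m_def)
  have UX: "U \<subseteq> X" using openin_subset[OF U(1)] by auto
  obtain u where "u \<in> U" using U(2) by blast
  obtain dR R where R: "form dR R" "R u \<noteq> 0" "\<And>y. y \<in> X \<Longrightarrow> R y \<noteq> 0 \<Longrightarrow> y \<in> U"
    using openin_subtopology_zariskiD[OF zero_notin U(1) \<open>u \<in> U\<close>] by metis
  have "axis i0 1 $ i0 \<noteq> (0::'k)" by (simp add: axis_def)
  then obtain x where x: "x \<in> X" "R x \<noteq> 0" "x $ i0 \<noteq> 0"
    using irreducible_nonzero[OF zero_notin irreducible R(1) form_coord[of i0] _ R(2) origin_mem]
      UX \<open>u \<in> U\<close> by blast
  have quot: "\<exists>d P Q. \<forall>j<m. form (d j) (P j) \<and> form (d j) (Q j) \<and> Q j x \<noteq> 0 \<and>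
        (\<forall>y\<in>X. Q j y \<noteq> 0 \<longrightarrow> f j y = P j y / Q j y)" if "x \<in> U" for x
  proof -
    have "\<forall>j. \<exists>d P Q. j < m \<longrightarrow> form d P \<and> form d Q \<and> Q x \<noteq> 0 \<and>
        (\<forall>y\<in>X. Q y \<noteq> 0 \<longrightarrow> f j y = P y / Q y)"
      using f md that unfolding local_ring_def by fastforce
    from this[THEN choice] obtain d where "\<forall>j. \<exists>P Q. j < m \<longrightarrow> form (d j) P \<and> form (d j) Q \<and> Q x \<noteq> 0 \<and>
        (\<forall>y\<in>X. Q y \<noteq> 0 \<longrightarrow> f j y = P y / Q y)" ..
    from this[THEN choice] obtain P where "\<forall>j. \<exists>Q. j < m \<longrightarrow> form (d j) (P j) \<and> form (d j) Q \<and> Q x \<noteq> 0 \<and>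
        (\<forall>y\<in>X. Q y \<noteq> 0 \<longrightarrow> f j y = P j y / Q y)" ..
    from this[THEN choice] show ?thesis by blast
  qed
  obtain dd P Q where PQ: "\<forall>j<m. form (dd j) (P j) \<and> form (dd j) (Q j) \<and> Q j x \<noteq> 0 \<and>
        (\<forall>y\<in>X. Q j y \<noteq> 0 \<longrightarrow> f j y = P j y / Q j y)"
    using quot[OF R(3)[OF x(1,2)]] by blast
  have "\<exists>D. mpoly C D (\<lambda>q. P j (param q)) \<and> mpoly C D (\<lambda>q. Q j (param q))" if "j < m" for j
  proof -
    have "form (dd j) (P j)" "form (dd j) (Q j)" using PQ that by auto
    from mpoly_form[OF finite_C this(1), of n] mpoly_form[OF finite_C this(2), of n]
    obtain D1 D2 where "mpoly C D1 (\<lambda>q. P j (param q))" "mpoly C D2 (\<lambda>q. Q j (param q))"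
      unfolding param_def by (elim exE)
    then show ?thesis
      by (intro exI[of _ "max D1 D2"] conjI)
         (rule mpoly_mono[OF finite_C _ max.cobounded1] mpoly_mono[OF finite_C _ max.cobounded2], assumption)+
  qed
  then have "\<forall>j. \<exists>D. j < m \<longrightarrow> mpoly C D (\<lambda>q. P j (param q)) \<and> mpoly C D (\<lambda>q. Q j (param q))"
    by blast
  from this[THEN choice] obtain D' where
    D': "\<forall>j. j < m \<longrightarrow> mpoly C (D' j) (\<lambda>q. P j (param q)) \<and> mpoly C (D' j) (\<lambda>q. Q j (param q))" ..
  define D where "D = (\<Sum>j<m. D' j)"
  have D: "mpoly C D (\<lambda>q. P j (param q))" "mpoly C D (\<lambda>q. Q j (param q))" if "j < m" for j
  proof -
    have "D' j \<le> D" unfolding D_def by (rule member_le_sum) (use that in auto)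
    then show "mpoly C D (\<lambda>q. P j (param q))" "mpoly C D (\<lambda>q. Q j (param q))"
      by (rule mpoly_mono[OF finite_C conjunct1[OF D'[rule_format, OF that]]],
          rule mpoly_mono[OF finite_C conjunct2[OF D'[rule_format, OF that]]])
  qed
  \<comment> \<open>Chosen so that \<open>(m * D + 1) ^ card C\<close> is absorbed by one factor:
    the number of unknown coefficients in \<open>A\<close> is at most
    \<open>E * (E + 1) ^ card C\<close>, which is less than \<open>(E + 1) ^ m\<close>.\<close>
  define E where "E = (m * D + 1) ^ card C"
  define A where "A = (C \<rightarrow>\<^sub>E {..m * (E * D)})"
  \<comment> \<open>Exponents are continued by 0 beyond \<open>m\<close>, as
    \<open>alg_indep_on\<close> demands.\<close>
  define B where "B = (\<lambda>e j. if j < m then e j else (0::nat)) ` ({..<m} \<rightarrow>\<^sub>E {..E})"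
  have B: "e j \<le> E" "j \<ge> m \<Longrightarrow> e j = 0" if eB: "e \<in> B" for e j
  proof -
    obtain e' where e': "e = (\<lambda>j. if j < m then e' j else 0)" "e' \<in> {..<m} \<rightarrow>\<^sub>E {..E}"
      using eB unfolding B_def by (elim imageE)
    have "e' j \<in> {..E}" if "j < m" using PiE_mem[OF e'(2)] that by simp
    then show "e j \<le> E" "j \<ge> m \<Longrightarrow> e j = 0" unfolding e'(1) by simp_all
  qed
  have "inj_on (\<lambda>e j. if j < m then e j else (0::nat)) ({..<m} \<rightarrow>\<^sub>E {..E})"
  proof (rule inj_onI)
    fix e e' assume *: "e \<in> {..<m} \<rightarrow>\<^sub>E {..E}" "e' \<in> {..<m} \<rightarrow>\<^sub>E {..E}"
      "(\<lambda>j. if j < m then e j else (0::nat)) = (\<lambda>j. if j < m then e' j else 0)"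
    show "e = e'"
    proof (rule PiE_ext[OF *(1,2)])
      fix j assume "j \<in> {..<m}"
      then show "e j = e' j" using fun_cong[OF *(3), of j] by simp
    qed
  qed
  then have "card B = (E + 1) ^ m"
    unfolding B_def by (simp add: card_image card_PiE)
  have "finite A" "finite B" unfolding A_def B_def by (auto intro!: finite_PiE)
  have "card A = (m * (E * D) + 1) ^ card C" unfolding A_def by (simp add: card_PiE)
  also have "\<dots> \<le> ((m * D + 1) * (E + 1)) ^ card C" by (intro power_mono) (auto simp: algebra_simps)
  also have "\<dots> = E * (E + 1) ^ card C" by (simp only: E_def power_mult_distrib)
  also have "\<dots> < (E + 1) ^ m" by (simp add: m_def)
  finally have "card A < card B" using \<open>card B = _\<close> by simp
  define G where "G e q = (\<Prod>j<m. P j (param q) ^ e j * Q j (param q) ^ (E - e j))" for e q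
  have "mpoly C (m * (E * D)) (G e)" if "e \<in> B" for e
  proof -
    have "mpoly C (\<Sum>j<m. e j * D + (E - e j) * D) (G e)"
      unfolding G_def[abs_def]
      by (intro mpoly_prod mpoly_mult mpoly_power finite_C D) auto
    moreover have "e j * D + (E - e j) * D = E * D" for j
      using B(1)[OF that, of j] by (metis add_mult_distrib le_add_diff_inverse)
    ultimately show ?thesis by simp
  qed
  then have "\<forall>e. \<exists>k. e \<in> B \<longrightarrow> (\<forall>q. G e q = (\<Sum>a\<in>A. k a * (\<Prod>c\<in>C. q c ^ a c)))"
    unfolding mpoly_def A_def by blast
  from this[THEN choice] obtain k where
    k: "\<And>e q. e \<in> B \<Longrightarrow> G e q = (\<Sum>a\<in>A. k e a * (\<Prod>c\<in>C. q c ^ a c))" by blast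
  obtain c where c: "\<exists>e\<in>B. c e \<noteq> 0" "\<And>a. a \<in> A \<Longrightarrow> (\<Sum>e\<in>B. c e * k e a) = 0"
    using underdetermined_system[OF \<open>finite A\<close> \<open>finite B\<close> \<open>card A < card B\<close>, of "\<lambda>a e. k e a"] by blast
  have G0: "(\<Sum>e\<in>B. c e * G e q) = 0" for q
  proof -
    have "(\<Sum>e\<in>B. c e * G e q) = (\<Sum>e\<in>B. \<Sum>a\<in>A. c e * k e a * (\<Prod>c\<in>C. q c ^ a c))"
      by (rule sum.cong) (simp_all add: k sum_distrib_left mult.assoc)
    also have "\<dots> = (\<Sum>a\<in>A. (\<Sum>e\<in>B. c e * k e a) * (\<Prod>c\<in>C. q c ^ a c))"
      by (subst sum.swap) (simp add: sum_distrib_right)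
    finally show ?thesis by (simp add: c(2))
  qed
  have clear: "(\<Sum>e\<in>B. c e * (\<Prod>j<m. (p j / r j) ^ e j)) * (\<Prod>j<m. r j ^ E)
      = (\<Sum>e\<in>B. c e * (\<Prod>j<m. p j ^ e j * r j ^ (E - e j)))"
    if "\<And>j. j < m \<Longrightarrow> r j \<noteq> 0" for p r :: "nat \<Rightarrow> 'k"
    unfolding sum_distrib_right mult.assoc
    by (intro sum.cong refl arg_cong[where f = "(*) _"] prod_clear_denominators) (use that B in auto)
  \<comment> \<open>At another point \<open>x'\<close> the functions may need other quotients. If
    the relation failed there, its numerator \<open>T\<close> would be nonzero, and irreducibility
    would give a point \<open>z\<close> of the chart where \<open>T\<close> and all denominators of
    both representations are nonzero. At \<open>z\<close> the relation \<open>G0\<close> contradicts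
    this.\<close>
  have relation: "(\<Sum>e\<in>B. c e * (\<Prod>j<m. f j x' ^ e j)) = 0" if x': "x' \<in> U" for x'
  proof (rule ccontr)
    assume nz: "(\<Sum>e\<in>B. c e * (\<Prod>j<m. f j x' ^ e j)) \<noteq> 0"
    have "x' \<in> X" using UX x' by blast
    obtain dd' P' Q' where PQ': "\<forall>j<m. form (dd' j) (P' j) \<and> form (dd' j) (Q' j) \<and> Q' j x' \<noteq> 0 \<and>
        (\<forall>y\<in>X. Q' j y \<noteq> 0 \<longrightarrow> f j y = P' j y / Q' j y)"
      using quot[OF x'] by (elim exE) (rule that)
    define T where "T y = (\<Sum>e\<in>B. c e * (\<Prod>j<m. P' j y ^ e j * Q' j y ^ (E - e j)))" for y
    have "form (\<Sum>j<m. E * dd' j) (\<lambda>y. \<Prod>j<m. P' j y ^ e j * Q' j y ^ (E - e j))" if "e \<in> B" for e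
    proof -
      have "form (\<Sum>j<m. e j * dd' j + (E - e j) * dd' j) (\<lambda>y. \<Prod>j<m. P' j y ^ e j * Q' j y ^ (E - e j))"
        by (intro form_prod form_mult form_power) (use PQ' in auto)
      moreover have "e j * dd' j + (E - e j) * dd' j = E * dd' j" for j
        using B(1)[OF that, of j] by (metis add_mult_distrib le_add_diff_inverse)
      ultimately show ?thesis by simp
    qed
    then have T: "form (\<Sum>j<m. E * dd' j) T" unfolding T_def[abs_def] by (intro form_sum form_scale)
    have relT: "(\<Sum>e\<in>B. c e * (\<Prod>j<m. f j y ^ e j)) * (\<Prod>j<m. Q' j y ^ E) = T y"
      if "y \<in> X" "\<And>j. j < m \<Longrightarrow> Q' j y \<noteq> 0" for y
    proof -
      have "(\<Sum>e\<in>B. c e * (\<Prod>j<m. f j y ^ e j)) = (\<Sum>e\<in>B. c e * (\<Prod>j<m. (P' j y / Q' j y) ^ e j))"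
        by (intro sum.cong refl arg_cong[where f = "(*) _"] prod.cong) (use PQ' that in auto)
      then show ?thesis unfolding T_def using clear[of "\<lambda>j. Q' j y" "\<lambda>j. P' j y"] that by simp
    qed
    have "T x' \<noteq> 0"
      using relT[OF \<open>x' \<in> X\<close>] nz PQ' by (metis (no_types, lifting) finite_lessThan lessThan_iff mult_eq_0_iff power_eq_0_iff prod_zero_iff)
    then have nz1: "T x' * (\<Prod>j<m. Q' j x') \<noteq> 0" using PQ' by simp
    have nz2: "x $ i0 * (\<Prod>j<m. Q j x) \<noteq> 0" using PQ x by simp
    have form2: "form (1 + (\<Sum>j<m. dd j)) (\<lambda>y. y $ i0 * (\<Prod>j<m. Q j y))"
      by (intro form_mult form_coord form_prod) (use PQ in auto)
    have form1: "form ((\<Sum>j<m. E * dd' j) + (\<Sum>j<m. dd' j)) (\<lambda>y. T y * (\<Prod>j<m. Q' j y))"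
      by (intro form_mult T form_prod) (use PQ' in auto)
    obtain z where z: "z \<in> X" "T z * (\<Prod>j<m. Q' j z) \<noteq> 0" "z $ i0 * (\<Prod>j<m. Q j z) \<noteq> 0"
      by (rule irreducible_nonzero[OF zero_notin irreducible form1 form2 \<open>x' \<in> X\<close> nz1 x(1) nz2])
    have Q': "Q' j z \<noteq> 0" and Q: "Q j z \<noteq> 0" if "j < m" for j using z that by auto
    define q where "q = (\<lambda>c. coord c z)"
    have zq: "z = z $ i0 *s param q" unfolding q_def using chart_param z by simp
    have hom: "P j z = z $ i0 ^ dd j * P j (param q)" "Q j z = z $ i0 ^ dd j * Q j (param q)" if "j < m" for j
      using PQ that zq form_homogeneous[of "dd j" "P j" "z $ i0" "param q"]
        form_homogeneous[of "dd j" "Q j" "z $ i0" "param q"] by metis+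
    have Qq: "Q j (param q) \<noteq> 0" if "j < m" for j using Q[OF that] hom(2)[OF that] by auto
    have "f j z = P j (param q) / Q j (param q)" if "j < m" for j
      using PQ that z Q[OF that] hom[OF that] by auto
    then have "(\<Sum>e\<in>B. c e * (\<Prod>j<m. f j z ^ e j))
        = (\<Sum>e\<in>B. c e * (\<Prod>j<m. (P j (param q) / Q j (param q)) ^ e j))"
      by (intro sum.cong refl arg_cong[where f = "(*) _"] prod.cong) auto
    moreover have "(\<Sum>e\<in>B. c e * (\<Prod>j<m. (P j (param q) / Q j (param q)) ^ e j)) * (\<Prod>j<m. Q j (param q) ^ E) = 0"
      using clear[of "\<lambda>j. Q j (param q)" "\<lambda>j. P j (param q)"] Qq G0[of q] by (simp add: G_def)
    ultimately have "(\<Sum>e\<in>B. c e * (\<Prod>j<m. f j z ^ e j)) = 0" using Qq by simp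
    then show False using relT[OF z(1) Q'] z(2) by simp
  qed
  have "(\<Sum>e\<in>B. c e * (\<Prod>j<d. f j x' ^ e j)) = 0" if "x' \<in> U" for x'
  proof -
    have "(\<Prod>j<d. f j x' ^ e j) = (\<Prod>j<m. f j x' ^ e j)" if "e \<in> B" for e
      by (rule prod.mono_neutral_right) (use md B(2)[OF that] in auto)
    then show ?thesis using relation[OF that] by simp
  qed
  moreover have "\<forall>e\<in>B. \<forall>j\<ge>d. e j = 0" using B(2) md by auto
  ultimately have "\<forall>e\<in>B. c e = 0"
    using indep \<open>finite B\<close> unfolding alg_indep_on_def by blast
  then show False using c(1) by blast
qed

text \<open>The lower bound comes from the chart coordinates, which take arbitrary values on
  \<open>param\<close> and are therefore algebraically independent.\<close>

lemma variety_dim_eq: "variety_dim X = card C"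
  unfolding variety_dim_def
proof (rule Greatest_equality)
  fix d assume "\<exists>U f. openin (subtopology zariski X) U \<and> U \<noteq> {} \<and>
       (\<forall>j<d. \<forall>x\<in>U. f j \<in> local_ring X x) \<and> alg_indep_on U d f"
  then show "d \<le> card C" using alg_indep_bound by blast
next
  obtain h where h: "bij_betw h {0..<card C} C" using ex_bij_betw_nat_finite[OF finite_C] by blast
  let ?U = "{y \<in> X. y $ i0 \<noteq> 0}"
  have hC: "h j \<in> C" if "j < card C" for j using h that by (auto simp: bij_betw_def)
  have "alg_indep_on ?U (card C) (\<lambda>j. coord (h j))"
    unfolding alg_indep_on_def
  proof (intro allI impI ballI, elim conjE)
    fix E and c :: "(nat \<Rightarrow> nat) \<Rightarrow> 'k" and e
    assume E: "finite E" "\<forall>e\<in>E. \<forall>j\<ge>card C. e j = 0" "e \<in> E"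
      and rel: "\<forall>x\<in>?U. (\<Sum>e\<in>E. c e * (\<Prod>j<card C. coord (h j) x ^ e j)) = 0"
    have inj: "i = i'" if "i \<in> E" "i' \<in> E" "\<forall>c\<in>{..<card C}. i c = i' c" for i i' :: "nat \<Rightarrow> nat"
      using E(2) that by (metis ext lessThan_iff not_le)
    have "(\<Sum>i\<in>E. c i * (\<Prod>j<card C. q j ^ i j)) = 0" for q :: "nat \<Rightarrow> 'k"
    proof -
      define q' where "q' = (\<lambda>c. q (the_inv_into {0..<card C} h c))"
      have "q' (h j) = q j" if "j < card C" for j
        using h that by (simp add: q'_def the_inv_into_f_f bij_betw_def)
      then have "coord (h j) (param q') = q j" if "j < card C" for j
        using that hC by (simp add: coord_param)
      then have "(\<Prod>j<card C. coord (h j) (param q') ^ e j) = (\<Prod>j<card C. q j ^ e j)" for e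
        by simp
      then show ?thesis
        using rel[rule_format, of "param q'"] by (simp add: param_mem param_i0)
    qed
    from multivariate_zero[where n = "\<lambda>e. e" and h = c, OF finite_lessThan E(1) inj this E(3)]
    show "c e = 0" .
  qed
  moreover have "openin (subtopology zariski X) ?U"
    by (rule openin_subtopology_zariski_basic[OF zero_notin form_coord])
  moreover have "?U \<noteq> {}" using param_mem param_i0 by fastforce
  ultimately show "\<exists>U f. openin (subtopology zariski X) U \<and> U \<noteq> {} \<and>
       (\<forall>j<card C. \<forall>x\<in>U. f j \<in> local_ring X x) \<and> alg_indep_on U (card C) f"
    by (intro exI[of _ ?U] exI[of _ "\<lambda>j. coord (h j)"]) (auto intro: coord_local_ring)
qed

end

section \<open>Orders of vanishing along curves\<close>

text \<open>The germ at 0 of a rational function of one variable, with a numerator divisible by the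
  \<open>q\<close>-th power of the variable. As in \<open>local_ring\<close>, values at zeros of the
  denominator do not matter.\<close>

definition vanishes_to_order :: "nat \<Rightarrow> ('k::field \<Rightarrow> 'k) \<Rightarrow> bool" where
  "vanishes_to_order q f \<longleftrightarrow> (\<exists>P Q. poly Q 0 \<noteq> 0 \<and> monom 1 q dvd P \<and>
     (\<forall>t. poly Q t \<noteq> 0 \<longrightarrow> f t = poly P t / poly Q t))"

lemma vanishes_to_orderI:
  "poly Q 0 \<noteq> 0 \<Longrightarrow> monom 1 q dvd P \<Longrightarrow> (\<And>t. poly Q t \<noteq> 0 \<Longrightarrow> f t = poly P t / poly Q t)
    \<Longrightarrow> vanishes_to_order q f"
  unfolding vanishes_to_order_def by blast

lemma vanishes_to_orderE:
  assumes "vanishes_to_order q f"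
  obtains P Q where "poly Q 0 \<noteq> 0" "monom 1 q dvd P" "\<And>t. poly Q t \<noteq> 0 \<Longrightarrow> f t = poly P t / poly Q t"
  using assms unfolding vanishes_to_order_def by blast

lemma vanishes_to_order_zero: "vanishes_to_order q (\<lambda>t. 0)"
  by (rule vanishes_to_orderI[of 1 _ 0]) auto

lemma vanishes_to_order_add:
  assumes "vanishes_to_order q f" "vanishes_to_order q g"
  shows "vanishes_to_order q (\<lambda>t. f t + g t)"
proof -
  obtain P Q where P: "poly Q 0 \<noteq> 0" "monom 1 q dvd P" "\<And>t. poly Q t \<noteq> 0 \<Longrightarrow> f t = poly P t / poly Q t"
    using assms(1) by (elim vanishes_to_orderE) blast
  obtain P' Q' where P': "poly Q' 0 \<noteq> 0" "monom 1 q dvd P'"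
    "\<And>t. poly Q' t \<noteq> 0 \<Longrightarrow> g t = poly P' t / poly Q' t"
    using assms(2) by (elim vanishes_to_orderE) blast
  show ?thesis
    by (rule vanishes_to_orderI[of "Q * Q'" _ "P * Q' + Q * P'"])
       (use P P' in \<open>auto simp: add_frac_eq mult_ac\<close>)
qed

lemma vanishes_to_order_mult:
  assumes "vanishes_to_order q f" "vanishes_to_order q' g"
  shows "vanishes_to_order (q + q') (\<lambda>t. f t * g t)"
proof -
  obtain P Q where P: "poly Q 0 \<noteq> 0" "monom 1 q dvd P" "\<And>t. poly Q t \<noteq> 0 \<Longrightarrow> f t = poly P t / poly Q t"
    using assms(1) by (elim vanishes_to_orderE) blast
  obtain P' Q' where P': "poly Q' 0 \<noteq> 0" "monom 1 q' dvd P'"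
    "\<And>t. poly Q' t \<noteq> 0 \<Longrightarrow> g t = poly P' t / poly Q' t"
    using assms(2) by (elim vanishes_to_orderE) blast
  have "monom 1 (q + q') dvd P * P'"
    using mult_dvd_mono[OF P(2) P'(2)] by (simp add: mult_monom)
  then show ?thesis
    by (intro vanishes_to_orderI[of "Q * Q'" _ "P * P'"]) (use P P' in auto)
qed

lemma vanishes_to_order_sum:
  "(\<And>a. a \<in> A \<Longrightarrow> vanishes_to_order q (f a)) \<Longrightarrow> vanishes_to_order q (\<lambda>t. \<Sum>a\<in>A. f a t)"
  by (induction A rule: infinite_finite_induct) (auto intro: vanishes_to_order_zero vanishes_to_order_add)

lemma local_ring_curve:
  fixes \<gamma> :: "'i::finite \<Rightarrow> 'k::field poly"
  assumes y_def: "\<And>t. y t = (\<chi> i. poly (\<gamma> i) t)" and y: "\<And>t. y t \<in> X" and f: "f \<in> local_ring X (y 0)"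
  shows "vanishes_to_order 0 (\<lambda>t. f (y t))"
proof -
  obtain d F G where F: "form d F" "form d G" "G (y 0) \<noteq> 0" "\<And>z. z \<in> X \<Longrightarrow> G z \<noteq> 0 \<Longrightarrow> f z = F z / G z"
    using f by (elim local_ringE) blast
  obtain P where P: "\<And>t. F (y t) = poly P t"
    unfolding y_def by (rule form_poly_curve[OF F(1), of \<gamma>]) blast
  obtain Q where Q: "\<And>t. G (y t) = poly Q t"
    unfolding y_def by (rule form_poly_curve[OF F(2), of \<gamma>]) blast
  show ?thesis
    by (rule vanishes_to_orderI[of Q _ P]) (use F y P Q in auto)
qed

text \<open>Each factor from the maximal ideal vanishes at the starting point of the curve and
  contributes one order. This is what bounds jet kernels from above.\<close>

lemma max_ideal_power_curve:
  fixes \<gamma> :: "'i::finite \<Rightarrow> 'k::field poly"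
  assumes y_def: "\<And>t. y t = (\<chi> i. poly (\<gamma> i) t)" and X: "0 \<notin> X" and y: "\<And>t. y t \<in> X" and f: "f \<in> max_ideal_power X (y 0) q"
  shows "vanishes_to_order q (\<lambda>t. f (y t))"
  using f
proof (induction q arbitrary: f)
  case 0
  then show ?case using local_ring_curve[of y \<gamma> X f, OF y_def y] by simp
next
  case (Suc q)
  then obtain n :: nat and g h where gh: "\<forall>s<n. g s \<in> max_ideal X (y 0) \<and> h s \<in> max_ideal_power X (y 0) q"
    and eq: "germ_eq X (y 0) f (\<lambda>y. \<Sum>s<n. g s y * h s y)" by auto
  have "vanishes_to_order 1 (\<lambda>t. g s (y t))" if "s < n" for s
  proof -
    have "g s \<in> local_ring X (y 0)" "g s (y 0) = 0" using gh that by (auto simp: max_ideal_def)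
    then have "vanishes_to_order 0 (\<lambda>t. g s (y t))"
      using local_ring_curve[of y \<gamma> X "g s", OF y_def y] by simp
    then obtain P Q where PQ: "poly Q 0 \<noteq> 0" "\<And>t. poly Q t \<noteq> 0 \<Longrightarrow> g s (y t) = poly P t / poly Q t"
      by (elim vanishes_to_orderE) blast
    have "poly P 0 = 0" using PQ \<open>g s (y 0) = 0\<close> by (metis divide_eq_0_iff)
    then have "monom 1 1 dvd P" by (simp add: monom_altdef poly_eq_0_iff_dvd)
    then show ?thesis using PQ by (intro vanishes_to_orderI[of Q _ P]) auto
  qed
  moreover have "vanishes_to_order q (\<lambda>t. h s (y t))" if "s < n" for s
    using gh Suc.IH that by blast
  ultimately have "vanishes_to_order (1 + q) (\<lambda>t. g s (y t) * h s (y t))" if "s < n" for s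
    using that vanishes_to_order_mult by blast
  then have "vanishes_to_order (Suc q) (\<lambda>t. \<Sum>s<n. g s (y t) * h s (y t))"
    by (intro vanishes_to_order_sum) simp
  then obtain P Q where PQ: "poly Q 0 \<noteq> 0" "monom 1 (Suc q) dvd P"
    "\<And>t. poly Q t \<noteq> 0 \<Longrightarrow> (\<Sum>s<n. g s (y t) * h s (y t)) = poly P t / poly Q t"
    by (elim vanishes_to_orderE) blast
  obtain d R where R: "form d R" "R (y 0) \<noteq> 0" "\<forall>z\<in>X. R z \<noteq> 0 \<longrightarrow> f z = (\<Sum>s<n. g s z * h s z)"
    using eq unfolding germ_eq_iff[OF X y] by (elim exE conjE)
  obtain r where r: "\<And>t. R (y t) = poly r t"
    unfolding y_def by (rule form_poly_curve[OF R(1), of \<gamma>]) blast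
  \<comment> \<open>The factor \<open>r\<close> in numerator and denominator discards the parameters
    that leave the neighbourhood on which the germs agree.\<close>
  show ?case
    by (rule vanishes_to_orderI[of "Q * r" _ "P * r"]) (use PQ R r y in auto)
qed

section \<open>The origin of a monomial chart\<close>

context monomial_chart
begin

lemma prod_param_powers:
  "(\<Prod>i\<in>UNIV. (param q $ i) ^ e i) = (\<Prod>c\<in>C. q c ^ (\<Sum>i\<in>UNIV. n i c * e i))"
  unfolding param_def vec_lambda_beta prod_power_distrib power_mult[symmetric] power_sum
  by (rule prod.swap)

lemma coord_origin: "c \<in> C \<Longrightarrow> coord c (axis i0 1) = 0"
  using coord_param[of c "\<lambda>_. 0"] by (simp add: param_0)

lemma coord_max_ideal: "c \<in> C \<Longrightarrow> coord c \<in> max_ideal X (axis i0 1)"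
  unfolding max_ideal_def by (simp add: coord_origin coord_local_ring)

lemma prod_split_power:
  assumes "c \<in> C" "e c > 0"
  shows "(\<Prod>c'\<in>C. q c' ^ e c') = q c * (\<Prod>c'\<in>C. q c' ^ (e(c := e c - 1)) c' :: 'k)"
proof -
  have "(\<Prod>c'\<in>C. q c' ^ e c') = q c ^ e c * (\<Prod>c'\<in>C - {c}. q c' ^ e c')"
    using assms(1) by (simp add: prod.remove)
  moreover have "(\<Prod>c'\<in>C. q c' ^ (e(c := e c - 1)) c') = q c ^ (e c - 1) * (\<Prod>c'\<in>C - {c}. q c' ^ e c')"
    using assms(1) by (simp add: prod.remove)
  moreover have "q c ^ e c = q c * q c ^ (e c - 1)"
    using assms(2) by (metis power_eq_if less_not_refl)
  ultimately show ?thesis by simp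
qed

text \<open>The chart coordinates generate the maximal ideal: the numerator of \<open>g\<close>,
  pulled back to affine space, has no constant term. Each remaining monomial is divisible by a
  chosen coordinate \<open>v e\<close>, and grouping the monomials by this choice gives the
  cofactors \<open>W\<close>.\<close>

lemma smooth_origin: "smooth_at X (axis i0 1)"
  unfolding smooth_at_def variety_dim_eq
proof (rule conjI, rule origin_mem)
  obtain h where h: "bij_betw h {0..<card C} C" using ex_bij_betw_nat_finite[OF finite_C] by blast
  then have h': "bij_betw h {..<card C} C" by (simp add: atLeast0LessThan)
  have hC: "h j \<in> C" if "j < card C" for j using h that by (auto simp: bij_betw_def)
  show "\<exists>f. (\<forall>j<card C. f j \<in> max_ideal X (axis i0 1)) \<and>
     (\<forall>g\<in>max_ideal X (axis i0 1). \<exists>h. (\<forall>j<card C. h j \<in> local_ring X (axis i0 1)) \<and>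
        germ_eq X (axis i0 1) g (\<lambda>y. \<Sum>j<card C. h j y * f j y))"
  proof (rule exI[of _ "\<lambda>j. coord (h j)"], intro conjI allI impI ballI)
    fix g assume g: "g \<in> max_ideal X (axis i0 1)"
    then have "g \<in> local_ring X (axis i0 1)" and g0: "g (axis i0 1) = 0" by (auto simp: max_ideal_def)
    then obtain d P Q where PQ: "form d P" "form d Q" "Q (axis i0 1) \<noteq> 0"
      "\<And>y. y \<in> X \<Longrightarrow> Q y \<noteq> 0 \<Longrightarrow> g y = P y / Q y" by (elim local_ringE) blast
    obtain k where k: "\<And>y. P y = (\<Sum>e\<in>{e. (\<Sum>i\<in>UNIV. e i) = d}. k e * (\<Prod>i\<in>UNIV. (y $ i) ^ e i))"
      using PQ(1) by (elim formE) blast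
    define S where "S = {e :: 'i \<Rightarrow> nat. (\<Sum>i\<in>UNIV. e i) = d}"
    define N where "N e c = (\<Sum>i\<in>UNIV. n i c * e i)" for e c
    have "finite S" unfolding S_def by (rule finite_exponents)
    have Pq: "P (param q) = (\<Sum>e\<in>S. k e * (\<Prod>c\<in>C. q c ^ N e c))" for q
      unfolding k prod_param_powers N_def S_def ..
    \<comment> \<open>Exponents outside \<open>S1\<close> contribute constants, whose sum is the
      value of \<open>P\<close> at the origin and hence zero.\<close>
    define S1 where "S1 = {e \<in> S. \<exists>c\<in>C. N e c > 0}"
    have "P (axis i0 1) = 0" using PQ(3,4) origin_mem g0 by (metis divide_eq_0_iff)
    then have "(\<Sum>e\<in>S. k e * (\<Prod>c\<in>C. 0 ^ N e c)) = 0" using Pq[of "\<lambda>_. 0"] by (simp add: param_0)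
    moreover have "(\<Sum>e\<in>S1. k e * (\<Prod>c\<in>C. 0 ^ N e c)) = 0"
      by (rule sum.neutral) (auto simp: S1_def)
    moreover have sub: "S1 \<subseteq> S" unfolding S1_def by blast
    moreover have "(\<Sum>e\<in>S - S1. k e * (\<Prod>c\<in>C. q c ^ N e c)) = (\<Sum>e\<in>S - S1. k e)" for q
      by (intro sum.cong) (auto simp: S1_def)
    ultimately have "(\<Sum>e\<in>S - S1. k e * (\<Prod>c\<in>C. q c ^ N e c)) = 0" for q
      using sum.subset_diff[OF sub \<open>finite S\<close>, of "\<lambda>e. k e * (\<Prod>c\<in>C. 0 ^ N e c)"] by simp
    then have Pq1: "P (param q) = (\<Sum>e\<in>S1. k e * (\<Prod>c\<in>C. q c ^ N e c))" for q
      unfolding Pq using sum.subset_diff[OF sub \<open>finite S\<close>, of "\<lambda>e. k e * (\<Prod>c\<in>C. q c ^ N e c)"] by simp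
    have "\<forall>e. \<exists>c. e \<in> S1 \<longrightarrow> c \<in> C \<and> N e c > 0" unfolding S1_def by blast
    from this[THEN choice] obtain v where v: "\<And>e. e \<in> S1 \<Longrightarrow> v e \<in> C" "\<And>e. e \<in> S1 \<Longrightarrow> N e (v e) > 0" by blast
    define W where "W c q = (\<Sum>e\<in>{e \<in> S1. v e = c}. k e * (\<Prod>c'\<in>C. q c' ^ ((N e)(c := N e c - 1)) c'))" for c q
    have "finite S1" using sub \<open>finite S\<close> by (rule finite_subset)
    have Pq2: "P (param q) = (\<Sum>j<card C. q (h j) * W (h j) q)" for q
    proof -
      have "(\<Sum>j<card C. q (h j) * W (h j) q) = (\<Sum>c\<in>C. q c * W c q)"
        by (rule sum.reindex_bij_betw[OF h'])
      also have "\<dots> = (\<Sum>c\<in>C. \<Sum>e\<in>{e \<in> S1. v e = c}. k e * (\<Prod>c\<in>C. q c ^ N e c))"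
      proof (rule sum.cong[OF refl])
        fix c assume "c \<in> C"
        have "q c * (k e * (\<Prod>c'\<in>C. q c' ^ ((N e)(c := N e c - 1)) c')) = k e * (\<Prod>c\<in>C. q c ^ N e c)"
          if "e \<in> {e \<in> S1. v e = c}" for e
          using prod_split_power[OF \<open>c \<in> C\<close>, of "N e" q] v(2)[of e] that by (simp add: mult_ac)
        then show "q c * W c q = (\<Sum>e\<in>{e \<in> S1. v e = c}. k e * (\<Prod>c\<in>C. q c ^ N e c))"
          unfolding W_def sum_distrib_left by (rule sum.cong[OF refl])
      qed
      also have "\<dots> = P (param q)"
        unfolding Pq1 by (rule sum.group[OF \<open>finite S1\<close> finite_C]) (use v in auto)
      finally show ?thesis by simp
    qed
    \<comment> \<open>The factor \<open>(y $ i0) ^ d / Q y\<close> undoes the dehomogenization of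
      \<open>P\<close> and restores the denominator.\<close>
    let ?h = "\<lambda>j y. W (h j) (\<lambda>c. coord c y) * ((y $ i0) ^ d / Q y)"
    have i0_power: "form d (\<lambda>y. (y $ i0) ^ d)" using form_power[OF form_coord, of d i0] by simp
    have "?h j \<in> local_ring X (axis i0 1)" for j
      unfolding W_def
      by (intro local_ring_mult[OF _ local_ring_quotient[OF i0_power PQ(2,3)]] local_ring_sum
            local_ring_mult local_ring_const local_ring_prod local_ring_power coord_local_ring) simp
    moreover have "germ_eq X (axis i0 1) g (\<lambda>y. \<Sum>j<card C. ?h j y * coord (h j) y)"
      unfolding germ_eq_iff[OF zero_notin origin_mem]
    proof (intro exI[of _ "1 + d"] exI[of _ "\<lambda>y. y $ i0 * Q y"] conjI ballI impI)
      show "form (1 + d) (\<lambda>y. y $ i0 * Q y)" by (rule form_mult[OF form_coord PQ(2)])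
      show "axis i0 1 $ i0 * Q (axis i0 1) \<noteq> 0" using PQ(3) by simp
      fix y assume y: "y \<in> X" "y $ i0 * Q y \<noteq> 0"
      have "P y = y $ i0 ^ d * P (param (\<lambda>c. coord c y))"
        using form_homogeneous[OF PQ(1), of "y $ i0" "param (\<lambda>c. coord c y)"] chart_param[of y] y by simp
      then have "g y = (\<Sum>j<card C. coord (h j) y * W (h j) (\<lambda>c. coord c y)) * ((y $ i0) ^ d / Q y)"
        using PQ(4)[of y] y unfolding Pq2 by simp
      then show "g y = (\<Sum>j<card C. ?h j y * coord (h j) y)"
        by (simp add: sum_distrib_left sum_distrib_right mult_ac)
    qed
    ultimately show "\<exists>h'. (\<forall>j<card C. h' j \<in> local_ring X (axis i0 1)) \<and>
        germ_eq X (axis i0 1) g (\<lambda>y. \<Sum>j<card C. h' j y * coord (h j) y)"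
      by (intro exI[of _ ?h] conjI allI impI)
  qed (use hC coord_max_ideal in auto)
qed

lemma germ_eq_refl: "x \<in> X \<Longrightarrow> (\<And>y. y \<in> X \<Longrightarrow> f y = g y) \<Longrightarrow> germ_eq X x f g"
  unfolding germ_eq_iff[OF zero_notin]
  by (intro exI[of _ 0] exI[of _ "\<lambda>_. 1"]) (auto intro: form_const)

lemma monomial_max_ideal_power:
  "q \<le> (\<Sum>c\<in>C. e c) \<Longrightarrow> (\<lambda>y. \<Prod>c\<in>C. coord c y ^ e c) \<in> max_ideal_power X (axis i0 1) q"
proof (induction q arbitrary: e)
  case 0
  show ?case by (auto intro!: local_ring_prod local_ring_power coord_local_ring)
next
  case (Suc q)
  then obtain c where c: "c \<in> C" "e c > 0" by (metis Suc_le_D not_gr_zero sum.neutral nat.distinct(1))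
  let ?e = "e(c := e c - 1)"
  have "(\<Sum>c'\<in>C. e c') = Suc (\<Sum>c'\<in>C. ?e c')"
    using c by (simp add: sum.remove[of C c])
  then have "(\<lambda>y. \<Prod>c\<in>C. coord c y ^ ?e c) \<in> max_ideal_power X (axis i0 1) q"
    using Suc by (intro Suc.IH) simp
  moreover have "(\<lambda>y. \<Prod>c\<in>C. coord c y ^ e c) \<in> local_ring X (axis i0 1)"
    by (auto intro!: local_ring_prod local_ring_power coord_local_ring)
  moreover have "germ_eq X (axis i0 1) (\<lambda>y. \<Prod>c\<in>C. coord c y ^ e c)
      (\<lambda>y. \<Sum>s<(1::nat). coord c y * (\<Prod>c\<in>C. coord c y ^ ?e c))"
    by (rule germ_eq_refl[OF origin_mem]) (simp add: prod_split_power[where e = e, OF c] del: fun_upd_apply)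
  ultimately show ?case
    unfolding max_ideal_power.simps mem_Collect_eq
    by (intro conjI exI[of _ "1::nat"] exI[of _ "\<lambda>s. coord c"]
          exI[of _ "\<lambda>s y. \<Prod>c\<in>C. coord c y ^ ?e c"] allI impI) (use coord_max_ideal c in auto)
qed

lemma lin_axis: "lin (axis i 1) y = y $ i" "lin h (axis i 1) = h $ i"
  by (simp_all add: lin_def axis_def if_distrib[of "\<lambda>x. _ * x"] if_distrib[of "\<lambda>x. x * _"] cong: if_cong)

text \<open>Along the curve through \<open>param q\<close> that scales all chart coordinates,
  coordinate \<open>j\<close> becomes a multiple of the \<open>deg j\<close>-th power of the
  parameter. Vanishing to order \<open>p + 1\<close> kills the part of degree \<open>deg i\<close>;
  since \<open>q\<close> is arbitrary, every coefficient of that degree is zero.\<close>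

lemma jet_kernel_originD:
  assumes "h \<in> jet_kernel p X (axis i0 1)" "deg i \<le> p"
  shows "h $ i = 0"
proof -
  obtain g where g: "lin g (axis i0 1) \<noteq> 0"
    "(\<lambda>y. lin h y / lin g y) \<in> max_ideal_power X (axis i0 1) (Suc p)"
    using assms(1) unfolding jet_kernel_def by blast
  have vanish: "(\<Sum>j\<in>{j. deg j = deg i}. h $ j * (\<Prod>c\<in>C. q c ^ n j c)) = 0" for q
  proof -
    define \<gamma> where "\<gamma> j = monom (\<Prod>c\<in>C. q c ^ n j c) (deg j)" for j
    have curve: "(\<chi> j. poly (\<gamma> j) t) = param (\<lambda>c. q c * t)" for t
      by (simp add: \<gamma>_def param_def poly_monom deg_def power_mult_distrib prod.distrib power_sum vec_eq_iff)
    have curve0: "(\<chi> j. poly (\<gamma> j) 0) = axis i0 1" unfolding curve by (simp add: param_0)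
    define L where "L h = (\<Sum>j\<in>UNIV. smult (h $ j) (\<gamma> j))" for h
    have L: "lin h (\<chi> j. poly (\<gamma> j) t) = poly (L h) t" for h t
      by (simp add: L_def lin_def poly_sum)
    have "vanishes_to_order (Suc p) (\<lambda>t. lin h (\<chi> j. poly (\<gamma> j) t) / lin g (\<chi> j. poly (\<gamma> j) t))"
      by (rule max_ideal_power_curve[OF refl zero_notin]) (use g curve0 curve param_mem in auto)
    then obtain P Q where PQ: "poly Q 0 \<noteq> 0" "monom 1 (Suc p) dvd P"
      "\<And>t. poly Q t \<noteq> 0 \<Longrightarrow> poly (L h) t / poly (L g) t = poly P t / poly Q t"
      unfolding L by (elim vanishes_to_orderE) blast
    have Lg: "poly (L g) 0 \<noteq> 0" using g(1) L[of g 0] curve0 by simp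
    \<comment> \<open>The extra factor \<open>Q * L g\<close> covers the parameters at which the
      quotients are undefined, so that the polynomial vanishes everywhere.\<close>
    have "poly (Q * L g * (L h * Q - P * L g)) t = 0" for t
    proof (cases "poly Q t = 0 \<or> poly (L g) t = 0")
      case False
      then show ?thesis using PQ(3)[of t] by (simp add: field_simps)
    qed auto
    then have "Q * L g * (L h * Q - P * L g) = 0" by (rule poly_all_0_iff_0[THEN iffD1, OF allI])
    moreover have "Q \<noteq> 0" "L g \<noteq> 0" using PQ(1) Lg by auto
    ultimately have "L h * Q = P * L g" by simp
    then have dvd: "monom 1 (Suc p) dvd L h * Q" using PQ(2) by (metis dvd_mult2)
    have "coeff (L h) (deg i) = 0"
    proof (cases "L h = 0")
      case False
      then have "Suc p \<le> order 0 (L h * Q)" using dvd \<open>Q \<noteq> 0\<close> by (simp add: monom_1_dvd_iff)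
      also have "\<dots> = order 0 (L h)" using False \<open>Q \<noteq> 0\<close> PQ(1) by (simp add: order_mult order_0I)
      finally have "monom 1 (Suc p) dvd L h" using False by (simp add: monom_1_dvd_iff)
      then show ?thesis using assms(2) by (auto simp: monom_1_dvd_iff')
    qed simp
    moreover have "coeff (L h) (deg i) = (\<Sum>j\<in>UNIV. if deg j = deg i then h $ j * (\<Prod>c\<in>C. q c ^ n j c) else 0)"
      by (simp add: L_def coeff_sum \<gamma>_def if_distrib[of "\<lambda>x. _ * x"] cong: if_cong)
    ultimately show ?thesis by (simp add: sum.If_cases)
  qed
  show ?thesis
    by (rule multivariate_zero[where n = n and h = "\<lambda>j. h $ j" and I = "{j. deg j = deg i}", OF finite_C _ _ vanish])
       (auto intro: n_inj)
qed

text \<open>In the trivialization by \<open>y $ i0\<close> the form is a combination of monomials of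
  degree larger than \<open>p\<close>; each splits into one chart coordinate and a monomial of
  degree at least \<open>p\<close>.\<close>

lemma jet_kernel_originI:
  assumes "\<And>i. deg i \<le> p \<Longrightarrow> h $ i = 0"
  shows "h \<in> jet_kernel p X (axis i0 1)"
proof -
  let ?I = "{i. deg i > p}"
  obtain e where e: "bij_betw e {0..<card ?I} ?I" using ex_bij_betw_nat_finite[of ?I] by auto
  then have e': "bij_betw e {..<card ?I} ?I" by (simp add: atLeast0LessThan)
  have "\<forall>i. \<exists>c. deg i > p \<longrightarrow> c \<in> C \<and> n i c > 0"
    unfolding deg_def by (metis not_gr_zero sum.neutral not_less_zero)
  from this[THEN choice] obtain v where v: "\<And>i. deg i > p \<Longrightarrow> v i \<in> C" "\<And>i. deg i > p \<Longrightarrow> n i (v i) > 0" by blast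
  let ?n = "\<lambda>i. (n i)(v i := n i (v i) - 1)"
  let ?g = "\<lambda>s y. h $ e s * coord (v (e s)) y"
  let ?h = "\<lambda>s y. \<Prod>c\<in>C. coord c y ^ ?n (e s) c"
  let ?F = "\<lambda>y. lin h y / lin (axis i0 1) y"
  have mem: "deg (e s) > p" if "s < card ?I" for s using e' that by (auto simp: bij_betw_def)
  have g: "?g s \<in> max_ideal X (axis i0 1)" if "s < card ?I" for s
    using v(1)[OF mem[OF that]] unfolding max_ideal_def
    by (auto simp: coord_origin intro!: local_ring_mult local_ring_const coord_local_ring)
  have h: "?h s \<in> max_ideal_power X (axis i0 1) p" if "s < card ?I" for s
  proof (rule monomial_max_ideal_power)
    let ?i = "e s"
    have "(\<Sum>c\<in>C. n ?i c) = Suc (\<Sum>c\<in>C. ?n ?i c)"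
      using v[OF mem[OF that]] by (simp add: sum.remove[of C "v ?i"])
    then show "p \<le> (\<Sum>c\<in>C. ?n ?i c)" using mem[OF that] unfolding deg_def by simp
  qed
  have "germ_eq X (axis i0 1) ?F (\<lambda>y. \<Sum>s<card ?I. ?g s y * ?h s y)"
    unfolding germ_eq_iff[OF zero_notin origin_mem]
  proof (intro exI[of _ 1] exI[of _ "\<lambda>y. y $ i0"] conjI ballI impI)
    fix y assume y: "y \<in> X" "y $ i0 \<noteq> 0"
    have "(\<Sum>s<card ?I. ?g s y * ?h s y) = (\<Sum>s<card ?I. h $ e s * (y $ e s / y $ i0))"
    proof (rule sum.cong[OF refl])
      fix s assume "s \<in> {..<card ?I}"
      then have "v (e s) \<in> C" "n (e s) (v (e s)) > 0" using v mem by auto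
      from prod_split_power[where e = "n (e s)" and q = "\<lambda>c. coord c y", OF this]
      show "?g s y * ?h s y = h $ e s * (y $ e s / y $ i0)"
        unfolding chart[OF y] coord_def[symmetric] by (simp only: mult.assoc)
    qed
    also have "\<dots> = (\<Sum>i\<in>?I. h $ i * (y $ i / y $ i0))" by (rule sum.reindex_bij_betw[OF e'])
    also have "\<dots> = (\<Sum>i\<in>UNIV. h $ i * (y $ i / y $ i0))"
      by (rule sum.mono_neutral_left) (use assms in \<open>auto simp: not_less\<close>)
    also have "\<dots> = lin h y / y $ i0" by (simp add: lin_def sum_divide_distrib)
    finally show "?F y = (\<Sum>s<card ?I. ?g s y * ?h s y)" by (simp add: lin_axis)
  qed (simp_all add: form_coord[unfolded One_nat_def])
  moreover have "?F \<in> local_ring X (axis i0 1)"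
    by (rule local_ring_quotient[OF form_lin form_lin]) (simp add: lin_axis)
  ultimately have "?F \<in> max_ideal_power X (axis i0 1) (Suc p)"
    unfolding max_ideal_power.simps mem_Collect_eq
    by (intro conjI exI[of _ "card ?I"] exI[of _ ?g] exI[of _ ?h]) (use g h in auto)
  moreover have "lin (axis i0 1) (axis i0 1 :: 'k ^ 'i) \<noteq> 0" by (simp add: lin_axis)
  ultimately show ?thesis unfolding jet_kernel_def by blast
qed

lemma jet_kernel_origin: "h \<in> jet_kernel p X (axis i0 1) \<longleftrightarrow> (\<forall>i. deg i \<le> p \<longrightarrow> h $ i = 0)"
  using jet_kernel_originI jet_kernel_originD by blast

text \<open>At the origin the osculating space contains the coordinate points
  \<open>axis i 1\<close> with \<open>deg i \<le> p\<close>, and these detect all the coefficients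
  that have to vanish.\<close>

lemma osculating_origin:
  assumes "osculating_space p X (axis i0 1) \<subseteq> hyperplane h"
  shows "h \<in> jet_kernel p X (axis i0 1)"
  unfolding jet_kernel_origin
proof (intro allI impI)
  fix i assume "deg i \<le> p"
  then have "axis i 1 \<in> osculating_space p X (axis i0 1)"
    by (auto simp: osculating_space_def jet_kernel_origin lin_axis)
  then show "h $ i = 0" using assms by (auto simp: hyperplane_def lin_axis)
qed

end

section \<open>The torus acting on a variety with a monomial chart\<close>

lemma closed_cone:
  assumes "closedin zariski X" "y \<in> X" "s \<noteq> 0" shows "s *s y \<in> X"
proof -
  have X: "X \<subseteq> {y. y \<noteq> 0}" using closedin_subset[OF assms(1)] by (simp add: topspace_zariski)
  then have X0: "0 \<notin> X" by blast
  have "X = zariski closure_of X" using assms(1) by (simp add: closure_of_closedin)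
  also have "s *s y \<in> \<dots>"
    unfolding closure_of_zariski[OF X0]
    using assms X by (auto simp: form_homogeneous)
  finally show ?thesis .
qed

context monomial_chart
begin

text \<open>The dense orbit is the locus where all coordinates are nonzero. It lies in the chart,
  where it is parametrized by the nonzero values of the chart coordinates; these coordinates are the
  inverse of the orbit map.\<close>

lemma equivariant_toricI:
  assumes closed: "closedin zariski X"
    and torus: "\<And>t y. \<forall>c. t c \<noteq> 0 \<Longrightarrow> y \<in> X \<Longrightarrow> (\<chi> i. (\<Prod>c\<in>C. t c ^ n i c) * y $ i) \<in> X"
  shows "equivariant_toric X"
proof -
  obtain h where h: "bij_betw h {0..<card C} C" using ex_bij_betw_nat_finite[OF finite_C] by blast
  then have h': "bij_betw h {..<card C} C" by (simp add: atLeast0LessThan)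
  have hC: "h j \<in> C" if "j < card C" for j using h that by (auto simp: bij_betw_def)
  let ?d = "card C"
  define w where "w i j = int (n i (h j))" for i j
  \<comment> \<open>Moves a torus element from \<open>nat\<close> to the index type of the chart.
    The value 1 outside \<open>C\<close> makes all entries nonzero, as the hypothesis
    \<open>torus\<close> requires.\<close>
  define tau where "tau t c = (if c \<in> C then t (the_inv_into {0..<card C} h c) else 1)" for t :: "nat \<Rightarrow> 'k" and c
  have tau_h: "tau t (h j) = t j" if "j < ?d" for t j
    using h that hC by (simp add: tau_def the_inv_into_f_f bij_betw_def)
  have tau_nz: "tau t c \<noteq> 0" if "\<forall>j<?d. t j \<noteq> 0" for t c
  proof (cases "c \<in> C")
    case True
    then obtain j where "j < ?d" "c = h j" using h' by (auto simp: bij_betw_def)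
    then show ?thesis using tau_h that by simp
  qed (simp add: tau_def)
  have act: "torus_act ?d w t y = (\<chi> i. (\<Prod>c\<in>C. tau t c ^ n i c) * y $ i)" for t and y :: "'k ^ 'i"
  proof -
    have "(\<Prod>j<?d. t j powi w i j) = (\<Prod>c\<in>C. tau t c ^ n i c)" for i
    proof -
      have "(\<Prod>j<?d. t j powi w i j) = (\<Prod>j<?d. tau t (h j) ^ n i (h j))"
        by (rule prod.cong) (auto simp: w_def tau_h)
      also have "\<dots> = (\<Prod>c\<in>C. tau t c ^ n i c)" by (rule prod.reindex_bij_betw[OF h'])
      finally show ?thesis .
    qed
    then show ?thesis by (simp add: torus_act_def)
  qed
  let ?x0 = "param (\<lambda>_. 1)"
  have act_x0: "torus_act ?d w t ?x0 = param (tau t)" for t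
    unfolding act by (simp add: param_def)
  let ?Orb = "{s *s torus_act ?d w t ?x0 | s t. s \<noteq> 0 \<and> (\<forall>j<?d. t j \<noteq> 0)}"
  have Orb: "?Orb = {y \<in> X. (\<Prod>i\<in>UNIV. y $ i) \<noteq> 0}"
  proof (intro set_eqI iffI)
    fix y assume "y \<in> ?Orb"
    then obtain s t where st: "y = s *s param (tau t)" "s \<noteq> 0" "\<forall>j<?d. t j \<noteq> 0"
      unfolding act_x0 by blast
    moreover have "param (tau t) $ i \<noteq> 0" for i using tau_nz[OF st(3)] by (simp add: param_def)
    ultimately show "y \<in> {y \<in> X. (\<Prod>i\<in>UNIV. y $ i) \<noteq> 0}"
      using closed_cone[OF closed param_mem] by simp
  next
    fix y assume "y \<in> {y \<in> X. (\<Prod>i\<in>UNIV. y $ i) \<noteq> 0}"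
    then have y: "y \<in> X" "\<And>i. y $ i \<noteq> 0" by auto
    let ?t = "\<lambda>j. coord (h j) y"
    have "param (\<lambda>c. coord c y) = param (tau ?t)"
    proof -
      have "coord c y = tau ?t c" if c: "c \<in> C" for c
      proof -
        obtain j where "j < ?d" "c = h j" using h' c by (auto simp: bij_betw_def)
        then show ?thesis using tau_h by simp
      qed
      then show ?thesis by (simp add: param_def)
    qed
    then have "y = y $ i0 *s torus_act ?d w ?t ?x0"
      unfolding act_x0 using chart_param[OF y(1) y(2)] by simp
    moreover have "?t j \<noteq> 0" for j using y(2) by (simp add: coord_def)
    ultimately show "y \<in> ?Orb" using y(2) by blast
  qed
  have "torus_act ?d w t ` X = X" if t: "\<forall>j<?d. t j \<noteq> 0" for t
  proof
    show "torus_act ?d w t ` X \<subseteq> X" using torus tau_nz[OF t] unfolding act by auto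
    show "X \<subseteq> torus_act ?d w t ` X"
    proof
      fix y assume "y \<in> X"
      have "(\<chi> i. (\<Prod>c\<in>C. inverse (tau t c) ^ n i c) * y $ i) \<in> X"
        using torus[of "\<lambda>c. inverse (tau t c)"] tau_nz[OF t] \<open>y \<in> X\<close> by simp
      moreover have "(\<Prod>c\<in>C. tau t c ^ n i c) * (\<Prod>c\<in>C. inverse (tau t c) ^ n i c) = 1" for i
        unfolding prod.distrib[symmetric] power_mult_distrib[symmetric] using tau_nz[OF t] by simp
      then have "y = torus_act ?d w t (\<chi> i. (\<Prod>c\<in>C. inverse (tau t c) ^ n i c) * y $ i)"
        unfolding act by (simp add: vec_eq_iff mult.assoc[symmetric])
      ultimately show "y \<in> torus_act ?d w t ` X" by blast
    qed
  qed
  moreover have "dense_open X ?Orb"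
  proof -
    have "form (\<Sum>i\<in>(UNIV::'i set). 1) (\<lambda>y::'k ^ 'i. \<Prod>i\<in>UNIV. y $ i)" by (intro form_prod form_coord)
    moreover have "(\<Prod>i\<in>UNIV. param (\<lambda>_. 1) $ i) \<noteq> (0::'k)" by (simp add: param_def)
    ultimately show ?thesis
      unfolding Orb by (rule dense_open_nonvanishing[OF zero_notin irreducible _ param_mem])
  qed
  moreover have "\<exists>g. (\<forall>x\<in>?Orb. g \<in> local_ring X x) \<and>
      (\<forall>t. (\<forall>l<?d. t l \<noteq> 0) \<longrightarrow> g (torus_act ?d w t ?x0) = t j)" if "j < ?d" for j
  proof (intro exI[of _ "coord (h j)"] conjI ballI allI impI)
    fix x assume "x \<in> ?Orb"
    then show "coord (h j) \<in> local_ring X x" unfolding Orb by (auto intro: coord_local_ring)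
  next
    fix t show "coord (h j) (torus_act ?d w t ?x0) = t j"
      unfolding act_x0 by (simp add: coord_param hC that tau_h)
  qed
  ultimately show ?thesis
    unfolding equivariant_toric_def
    using closed irreducible param_mem
    by (intro conjI exI[of _ ?d] exI[of _ w] exI[of _ ?x0] exI[of _ ?Orb]) auto
qed

end

section \<open>Exponents of a monomial chart\<close>

lemma prod_powi:
  fixes x :: "'k::field"
  assumes "x \<noteq> 0" shows "(\<Prod>c\<in>A. x powi f c) = x powi (\<Sum>c\<in>A. f c)"
  by (induction A rule: infinite_finite_induct) (auto simp: power_int_add assms)

lemma powi_power: "(x powi z) ^ m = (x :: 'k::field) powi (int m * z)"
  by (metis mult.commute power_int_mult power_int_of_nat)

text \<open>In characteristic zero 2 has infinite multiplicative order, so exponents can be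
  recovered from powers of 2.\<close>

lemma two_powi_inject: "(2 :: 'k::field_char_0) powi a = 2 powi b \<longleftrightarrow> a = b"
proof -
  have one: "z = 0" if "(2 :: 'k) powi z = 1" "z \<ge> 0" for z
  proof -
    have "(of_nat (2 ^ nat z) :: 'k) = of_nat 1" using that by (simp add: power_int_def)
    then have "(2::nat) ^ nat z = 1" by (simp only: of_nat_eq_iff)
    then show ?thesis using that(2) by simp
  qed
  have "a = b" if "(2 :: 'k) powi a = 2 powi b"
  proof -
    have "(2 :: 'k) powi (a - b) = 1" "(2 :: 'k) powi (b - a) = 1"
      using that by (simp_all add: power_int_diff)
    then show ?thesis using one[of "a - b"] one[of "b - a"] by linarith
  qed
  then show ?thesis by blast
qed

lemma monomial_prod:
  assumes "\<And>j. t $ j \<noteq> 0"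
  shows "(\<Prod>c\<in>A. monomial (f c) t ^ m c) = (\<Prod>j\<in>UNIV. t $ j powi (\<Sum>c\<in>A. int (m c) * f c $ j))"
  unfolding monomial_def prod_power_distrib powi_power
  by (subst prod.swap) (simp add: prod_powi assms)

lemma monomial_nonzero: "(\<And>j. t $ j \<noteq> 0) \<Longrightarrow> monomial u t \<noteq> 0"
  by (simp add: monomial_def power_int_not_zero)

lemma toric_points_nonzero:
  "0 \<notin> {(\<chi> i. monomial (a i) t) | t :: 'k::field ^ 'n::finite. \<forall>j. t $ j \<noteq> 0}"
  by (auto simp: vec_eq_iff monomial_nonzero)

lemma toric_point_mem:
  fixes t :: "'k::field ^ 'n::finite"
  assumes "\<And>j. t $ j \<noteq> 0" shows "(\<chi> i. monomial (a i) t) \<in> toric_variety a"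
  unfolding toric_variety_def closure_of_zariski[OF toric_points_nonzero]
proof (intro CollectI conjI allI impI)
  show "(\<chi> i. monomial (a i) t) \<noteq> 0" using monomial_nonzero[OF assms] by (simp add: vec_eq_iff)
qed (use assms in blast)

lemma common_denominator:
  fixes x :: "'c \<Rightarrow> rat"
  assumes "finite C"
  obtains N :: int where "N \<noteq> 0" "\<And>c. c \<in> C \<Longrightarrow> \<exists>z. of_int N * x c = of_int z"
proof -
  have "\<exists>N::int. N \<noteq> 0 \<and> (\<forall>c\<in>C. \<exists>z. of_int N * x c = of_int z)"
    using assms
  proof (induction C rule: finite_induct)
    case empty
    show ?case by (intro exI[of _ 1]) simp
  next
    case (insert c C)
    then obtain N :: int where N: "N \<noteq> 0" "\<forall>c\<in>C. \<exists>z. of_int N * x c = of_int z" by blast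
    obtain p q where pq: "x c = of_int p / of_int q" "q > 0"
      by (metis quotient_of_div quotient_of_denom_pos surj_pair)
    have "\<exists>z. of_int (N * q) * x c' = of_int z" if c': "c' \<in> C" for c'
    proof -
      obtain z where "of_int N * x c' = of_int z" using N c' by blast
      then have "of_int (N * q) * x c' = of_int (z * q)" by (simp add: mult_ac)
      then show ?thesis ..
    qed
    moreover have "of_int (N * q) * x c = of_int (N * p)" using pq by simp
    ultimately have "\<forall>c'\<in>insert c C. \<exists>z. of_int (N * q) * x c' = of_int z" by blast
    moreover have "N * q \<noteq> 0" using N(1) pq(2) by simp
    ultimately show ?case by blast
  qed
  then show thesis using that by blast
qed

context monomial_chart
begin

text \<open>The chart equation, evaluated at the torus point with 2 in position \<open>j\<close> and
  1 elsewhere, is an identity between powers of 2. So \<open>a\<close> is an integral affine image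
  of the exponents \<open>n\<close>.\<close>

lemma exponent_relation:
  fixes a :: "'i \<Rightarrow> int ^ 'd::finite"
  assumes X: "X = toric_variety a"
  shows "a i $ j - a i0 $ j = (\<Sum>c\<in>C. int (n i c) * (a (idx c) $ j - a i0 $ j))"
proof -
  define t :: "'k ^ 'd" where "t = (\<chi> j'. if j' = j then 2 else 1)"
  have mono: "monomial u t = 2 powi (u $ j)" for u
  proof -
    have "monomial u t = (\<Prod>j'\<in>UNIV. if j' = j then 2 powi (u $ j) else 1)"
      unfolding monomial_def t_def by (rule prod.cong) auto
    then show ?thesis by simp
  qed
  have t: "t $ j \<noteq> 0" for j by (simp add: t_def)
  let ?y = "\<chi> i. monomial (a i) t"
  have "?y \<in> X" unfolding X by (rule toric_point_mem[OF t])
  from chart[OF this, of i]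
  have "(2::'k) powi (a i $ j) / 2 powi (a i0 $ j)
      = (\<Prod>c\<in>C. (2 powi (a (idx c) $ j) / 2 powi (a i0 $ j)) ^ n i c)"
    by (simp add: mono power_int_not_zero)
  then have "(2::'k) powi (a i $ j - a i0 $ j) = 2 powi (\<Sum>c\<in>C. int (n i c) * (a (idx c) $ j - a i0 $ j))"
    by (simp add: power_int_diff[symmetric] powi_power prod_powi)
  then show ?thesis by (simp only: two_powi_inject)
qed

text \<open>An integral relation yields a binomial form that vanishes on the torus points and hence
  on \<open>X\<close>. But \<open>X\<close> contains the point of the chart whose coordinate
  \<open>c0\<close> is 2 and whose other coordinates are 1, and there the binomial compares two
  powers of 2.\<close>

lemma exponents_independent_int:
  fixes z :: "'c \<Rightarrow> int"
    and a :: "'i \<Rightarrow> int ^ 'd::finite"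
  assumes X: "X = toric_variety a"
    and rel: "\<And>j. (\<Sum>c\<in>C. z c * (a (idx c) $ j - a i0 $ j)) = 0" and c0: "c0 \<in> C"
  shows "z c0 = 0"
proof -
  define P where "P c = nat (z c)" for c
  define M where "M c = nat (- z c)" for c
  have zPM: "z c = int (P c) - int (M c)" for c by (simp add: P_def M_def)
  \<comment> \<open>Positive part against negative part of \<open>z\<close>; the crossed powers of
    \<open>y $ i0\<close> make both terms homogeneous of the degree \<open>?d\<close>.\<close>
  let ?F = "\<lambda>y. (y $ i0) ^ (\<Sum>c\<in>C. M c) * (\<Prod>c\<in>C. (y $ idx c) ^ P c)
              - (y $ i0) ^ (\<Sum>c\<in>C. P c) * (\<Prod>c\<in>C. (y $ idx c) ^ M c) :: 'k"
  let ?d = "(\<Sum>c\<in>C. M c) + (\<Sum>c\<in>C. P c)"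
  have pw: "form m (\<lambda>y::'k ^ 'i. (y $ i) ^ m)" for m i using form_power[OF form_coord, of m i] by simp
  have "form ?d ?F"
    by (rule form_diff, rule form_mult[OF pw form_prod[OF pw]], subst add.commute,
        rule form_mult[OF pw form_prod[OF pw]])
  moreover have "?F (\<chi> i. monomial (a i) t) = 0" if t: "\<forall>j. t $ j \<noteq> 0" for t :: "'k ^ 'd"
  proof -
    have tnz: "\<And>j. t $ j \<noteq> 0" using t by blast
    have one: "monomial (a i0) t ^ m = (\<Prod>j\<in>UNIV. t $ j powi (int m * a i0 $ j))" for m
      using monomial_prod[OF tnz, of "\<lambda>_. a i0" "\<lambda>_. m" "{()}"] by simp
    have side: "monomial (a i0) t ^ m * (\<Prod>c\<in>C. monomial (a (idx c)) t ^ P c)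
        = (\<Prod>j\<in>UNIV. t $ j powi (int m * a i0 $ j + (\<Sum>c\<in>C. int (P c) * a (idx c) $ j)))" for m P
      unfolding one monomial_prod[OF tnz] prod.distrib[symmetric] using tnz by (simp add: power_int_add)
    have "int (\<Sum>c\<in>C. M c) * a i0 $ j + (\<Sum>c\<in>C. int (P c) * a (idx c) $ j)
        = int (\<Sum>c\<in>C. P c) * a i0 $ j + (\<Sum>c\<in>C. int (M c) * a (idx c) $ j)" for j
    proof -
      have "0 = (\<Sum>c\<in>C. (int (P c) - int (M c)) * (a (idx c) $ j - a i0 $ j))"
        using rel[of j] by (simp add: zPM)
      also have "\<dots> = (\<Sum>c\<in>C. int (P c) * a (idx c) $ j) - (\<Sum>c\<in>C. int (P c)) * a i0 $ j
          - ((\<Sum>c\<in>C. int (M c) * a (idx c) $ j) - (\<Sum>c\<in>C. int (M c)) * a i0 $ j)"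
        by (simp add: left_diff_distrib right_diff_distrib sum_subtractf sum_distrib_right)
      finally show ?thesis by simp
    qed
    then show ?thesis by (simp add: side)
  qed
  ultimately have "?F y = 0" if "y \<in> X" for y
    using that unfolding X toric_variety_def closure_of_zariski[OF toric_points_nonzero] by blast
  from this[OF param_mem[of "\<lambda>c. if c = c0 then 2 else 1"]]
  have "(\<Prod>c\<in>C. (if c = c0 then 2 else 1 :: 'k) ^ P c) = (\<Prod>c\<in>C. (if c = c0 then 2 else 1) ^ M c)"
    by (simp add: param_i0 param_idx)
  moreover have "(\<Prod>c\<in>C. (if c = c0 then 2 else 1 :: 'k) ^ m c) = 2 powi (int (m c0))" for m :: "'c \<Rightarrow> nat"
  proof -
    have "(\<Prod>c\<in>C. (if c = c0 then 2 else 1 :: 'k) ^ m c) = (\<Prod>c\<in>C. if c = c0 then 2 ^ m c0 else 1)"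
      by (rule prod.cong) auto
    then show ?thesis using c0 by simp
  qed
  ultimately show ?thesis by (simp add: zPM two_powi_inject del: power_int_of_nat)
qed

lemma exponents_independent:
  fixes x :: "'c \<Rightarrow> rat"
    and a :: "'i \<Rightarrow> int ^ 'd::finite"
  assumes X: "X = toric_variety a"
    and rel: "\<And>j. (\<Sum>c\<in>C. x c * of_int (a (idx c) $ j - a i0 $ j)) = 0" and c0: "c0 \<in> C"
  shows "x c0 = 0"
proof -
  obtain N :: int where N: "N \<noteq> 0" "\<And>c. c \<in> C \<Longrightarrow> \<exists>z. of_int N * x c = of_int z"
    using common_denominator[OF finite_C] by blast
  then obtain z where z: "\<And>c. c \<in> C \<Longrightarrow> of_int N * x c = of_int (z c)" by metis
  have "(\<Sum>c\<in>C. z c * (a (idx c) $ j - a i0 $ j)) = 0" for j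
  proof -
    have "of_int (\<Sum>c\<in>C. z c * (a (idx c) $ j - a i0 $ j))
        = (\<Sum>c\<in>C. of_int N * x c * of_int (a (idx c) $ j - a i0 $ j))"
      by (simp add: z)
    also have "\<dots> = 0" using rel[of j] by (simp add: mult.assoc sum_distrib_left[symmetric])
    finally show ?thesis by (simp only: of_int_eq_0_iff)
  qed
  from exponents_independent_int[OF X this c0] show ?thesis using z[OF c0] N(1) by simp
qed

text \<open>The converse of \<open>exponent_relation\<close>, over the rationals: the difference
  vectors of \<open>a\<close> are linearly independent, so the matrix with these columns has a left
  inverse.\<close>

lemma exponents_affine:
  fixes a :: "'i \<Rightarrow> int ^ 'd::finite"
  assumes X: "X = toric_variety a"
  obtains B :: "'c \<Rightarrow> 'd \<Rightarrow> rat"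
  where "\<And>i c. c \<in> C \<Longrightarrow> of_nat (n i c) = (\<Sum>j\<in>UNIV. B c j * of_int (a i $ j - a i0 $ j))"
proof -
  \<comment> \<open>The columns run over the whole index type. The rows \<open>Inr c'\<close> put an
    identity block on the indices outside \<open>C\<close>, which makes the kernel trivial.\<close>
  define A :: "rat ^ 'c ^ ('d + 'c)" where
    "A = (\<chi> k. \<chi> c. case k of Inl j \<Rightarrow> if c \<in> C then of_int (a (idx c) $ j - a i0 $ j) else 0
                            | Inr c' \<Rightarrow> if c = c' \<and> c \<notin> C then 1 else 0)"
  have A_Inl: "(A *v x) $ Inl j = (\<Sum>c\<in>C. x $ c * of_int (a (idx c) $ j - a i0 $ j))" for x j
  proof -
    have "(A *v x) $ Inl j = (\<Sum>c\<in>UNIV. if c \<in> C then x $ c * of_int (a (idx c) $ j - a i0 $ j) else 0)"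
      unfolding A_def matrix_vector_mult_def by (auto intro: sum.cong)
    then show ?thesis by (simp add: sum.If_cases)
  qed
  have A_Inr: "(A *v x) $ Inr c' = (if c' \<in> C then 0 else x $ c')" for x c'
  proof -
    have "(A *v x) $ Inr c' = (\<Sum>c\<in>UNIV. if c = c' then (if c' \<in> C then 0 else x $ c') else 0)"
      unfolding A_def matrix_vector_mult_def vec_lambda_beta by (rule sum.cong) auto
    then show ?thesis by simp
  qed
  have "x = 0" if Ax: "A *v x = 0" for x
  proof (rule vec_eq_iff[THEN iffD2], rule allI)
    fix c show "x $ c = 0 $ c"
    proof (cases "c \<in> C")
      case True
      have "(\<Sum>c\<in>C. x $ c * of_int (a (idx c) $ j - a i0 $ j)) = 0" for j
        using A_Inl[of x j] Ax by simp
      from exponents_independent[OF X this True] show ?thesis by simp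
    next
      case False
      then show ?thesis using A_Inr[of x c] Ax by simp
    qed
  qed
  then have "\<exists>B'. B' ** A = mat 1" unfolding matrix_left_invertible_ker by simp
  then obtain B' where B': "B' ** A = mat 1" ..
  show thesis
  proof (rule that[of "\<lambda>c j. B' $ c $ Inl j"])
    fix i c assume "c \<in> C"
    define x :: "rat ^ 'c" where "x = (\<chi> c. if c \<in> C then of_nat (n i c) else 0)"
    have "x $ c = (B' *v (A *v x)) $ c" by (simp add: matrix_vector_mul_assoc B')
    also have "\<dots> = (\<Sum>k\<in>UNIV. B' $ c $ k * (A *v x) $ k)"
      unfolding matrix_vector_mult_def[of B'] by simp
    also have "\<dots> = (\<Sum>k\<in>range Inl. B' $ c $ k * (A *v x) $ k) + (\<Sum>k\<in>range Inr. B' $ c $ k * (A *v x) $ k)"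
      by (subst sum.union_disjoint[symmetric]) (auto simp: UNIV_sum)
    also have "(\<Sum>k\<in>range Inr. B' $ c $ k * (A *v x) $ k) = 0"
      by (rule sum.neutral) (auto simp: A_Inr x_def)
    also have "(\<Sum>k\<in>range Inl. B' $ c $ k * (A *v x) $ k) = (\<Sum>j\<in>UNIV. B' $ c $ Inl j * (A *v x) $ Inl j)"
      by (simp add: sum.reindex)
    also have "\<dots> = (\<Sum>j\<in>UNIV. B' $ c $ Inl j * of_int (a i $ j - a i0 $ j))"
    proof (intro sum.cong refl arg_cong[where f = "(*) _"])
      fix j
      have "(A *v x) $ Inl j = (\<Sum>c\<in>C. of_nat (n i c) * of_int (a (idx c) $ j - a i0 $ j))"
        unfolding A_Inl by (rule sum.cong) (auto simp: x_def)
      also have "\<dots> = of_int (\<Sum>c\<in>C. int (n i c) * (a (idx c) $ j - a i0 $ j))" by simp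
      finally show "(A *v x) $ Inl j = of_int (a i $ j - a i0 $ j)"
        by (simp only: exponent_relation[OF X, of i j])
    qed
    finally show "of_nat (n i c) = (\<Sum>j\<in>UNIV. B' $ c $ Inl j * of_int (a i $ j - a i0 $ j))"
      using \<open>c \<in> C\<close> by (simp add: x_def)
  qed
qed

text \<open>The hypothesis \<open>complete\<close> says that integral points in the convex hull of
  the exponents \<open>n\<close> are exponents. A point of the hull of \<open>a\<close> is carried
  there by the affine map \<open>B\<close>, and its image is integral because the point lies in the
  affine lattice; \<open>exponent_relation\<close> leads back to \<open>a\<close>.\<close>

lemma complete_in_affine_lattice:
  fixes a :: "'i \<Rightarrow> int ^ 'd::finite"
  assumes X: "X = toric_variety a" and "inj a"
    and complete: "\<And>w z. (\<And>i. w i \<ge> 0) \<Longrightarrow> (\<Sum>i\<in>UNIV. w i) = 1 \<Longrightarrow>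
       (\<And>c. c \<in> C \<Longrightarrow> (\<Sum>i\<in>UNIV. w i * real (n i c)) = of_int (z c)) \<Longrightarrow>
       \<exists>i. \<forall>c\<in>C. z c = int (n i c)"
  shows "complete_in (affine_lattice a) a"
  unfolding complete_in_def
proof (intro equalityI subsetI)
  fix u assume "u \<in> range a"
  then obtain i where i: "u = a i" by blast
  have "(\<Sum>i'\<in>UNIV. (if i' = i then 1 else 0) *s a i') = (\<Sum>i'\<in>UNIV. if i' = i then a i else 0)"
    by (rule sum.cong) auto
  then have "u \<in> affine_lattice a"
    unfolding affine_lattice_def i by (auto intro!: exI[of _ "\<lambda>i'. if i' = i then 1 else 0"])
  then show "u \<in> affine_lattice a \<inter> lattice_points (convex hull (real_point ` range a))"
    by (auto simp: lattice_points_def i intro: hull_inc)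
next
  fix u assume u: "u \<in> affine_lattice a \<inter> lattice_points (convex hull (real_point ` range a))"
  then obtain z where z: "u = (\<Sum>i\<in>UNIV. z i *s a i)" "(\<Sum>i\<in>UNIV. z i) = 1"
    unfolding affine_lattice_def by blast
  have inj: "inj (\<lambda>i. real_point (a i))"
    using \<open>inj a\<close> by (auto simp: inj_def real_point_def vec_eq_iff)
  have "real_point u \<in> convex hull (range (\<lambda>i. real_point (a i)))"
    using u by (simp add: lattice_points_def image_image)
  then obtain w' where w': "\<forall>x\<in>range (\<lambda>i. real_point (a i)). 0 \<le> w' x"
    "sum w' (range (\<lambda>i. real_point (a i))) = 1"
    "(\<Sum>x\<in>range (\<lambda>i. real_point (a i)). w' x *\<^sub>R x) = real_point u"
    by (auto simp: convex_hull_finite)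
  define w where "w i = w' (real_point (a i))" for i
  have w: "\<And>i. w i \<ge> 0" "(\<Sum>i\<in>UNIV. w i) = 1" "(\<Sum>i\<in>UNIV. w i *\<^sub>R real_point (a i)) = real_point u"
    using w' by (auto simp: w_def sum.reindex[OF inj] o_def)
  have u_real: "(\<Sum>i\<in>UNIV. w i * of_int (a i $ j)) = of_int (u $ j)" for j
  proof -
    have "(\<Sum>i\<in>UNIV. w i *\<^sub>R real_point (a i)) $ j = real_point u $ j" by (simp only: w(3))
    then show ?thesis by (simp add: real_point_def)
  qed
  have u_int: "u $ j = (\<Sum>i\<in>UNIV. z i * a i $ j)" for j
    unfolding z(1) by simp
  obtain B :: "'c \<Rightarrow> 'd \<Rightarrow> rat" where
    B: "\<And>i c. c \<in> C \<Longrightarrow> of_nat (n i c) = (\<Sum>j\<in>UNIV. B c j * of_int (a i $ j - a i0 $ j))"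
    using exponents_affine[OF X] by blast
  have B_real: "real (n i c) = (\<Sum>j\<in>UNIV. of_rat (B c j) * of_int (a i $ j - a i0 $ j))" if "c \<in> C" for i c
  proof -
    have "real (n i c) = of_rat (of_nat (n i c))" by simp
    also have "\<dots> = (\<Sum>j\<in>UNIV. of_rat (B c j) * of_int (a i $ j - a i0 $ j))"
      unfolding B[OF that] by (simp add: of_rat_sum of_rat_mult of_rat_diff)
    finally show ?thesis .
  qed
  have B_comb: "(\<Sum>i\<in>UNIV. f i * real (n i c)) = (\<Sum>j\<in>UNIV. of_rat (B c j) * ((\<Sum>i\<in>UNIV. f i * of_int (a i $ j)) - of_int (a i0 $ j)))"
    if "c \<in> C" "(\<Sum>i\<in>UNIV. f i) = 1" for f c
  proof -
    have diff: "(\<Sum>i\<in>UNIV. f i * of_int (a i $ j - a i0 $ j)) = (\<Sum>i\<in>UNIV. f i * of_int (a i $ j)) - of_int (a i0 $ j)" for j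
      using that(2) by (simp add: right_diff_distrib sum_subtractf sum_distrib_right[symmetric])
    have "(\<Sum>i\<in>UNIV. f i * real (n i c))
        = (\<Sum>i\<in>UNIV. \<Sum>j\<in>UNIV. of_rat (B c j) * (f i * of_int (a i $ j - a i0 $ j)))"
      unfolding B_real[OF that(1)] by (simp add: sum_distrib_left mult_ac)
    also have "\<dots> = (\<Sum>j\<in>UNIV. of_rat (B c j) * (\<Sum>i\<in>UNIV. f i * of_int (a i $ j - a i0 $ j)))"
      by (subst sum.swap) (simp add: sum_distrib_left)
    finally show ?thesis by (simp only: diff)
  qed
  \<comment> \<open>The image of \<open>u\<close>, computed with its integral weights. The real
    weights \<open>w\<close> give the same image because both sets of weights represent
    \<open>u\<close> and \<open>B\<close> is affine.\<close>
  define z' where "z' c = (\<Sum>i\<in>UNIV. z i * int (n i c))" for c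
  have "(\<Sum>i\<in>UNIV. w i * real (n i c)) = of_int (z' c)" if "c \<in> C" for c
  proof -
    have "of_int (z' c) = (\<Sum>i\<in>UNIV. of_int (z i) * real (n i c))" by (simp add: z'_def)
    moreover have "(\<Sum>i\<in>UNIV. real_of_int (z i)) = 1" using z(2) by (metis of_int_1 of_int_sum)
    moreover have "(\<Sum>i\<in>UNIV. real_of_int (z i) * of_int (a i $ j)) = of_int (u $ j)" for j
      by (simp add: u_int)
    ultimately show ?thesis
      using B_comb[OF that, of w] B_comb[OF that, of "\<lambda>i. of_int (z i)"] w(2) u_real by simp
  qed
  from complete[OF w(1,2) this] obtain i where i: "\<forall>c\<in>C. z' c = int (n i c)" by blast
  have "u = a i"
  proof (rule vec_eq_iff[THEN iffD2], rule allI)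
    fix j
    have "u $ j - a i0 $ j = (\<Sum>i\<in>UNIV. z i * (a i $ j - a i0 $ j))"
      using z(2) by (simp add: u_int right_diff_distrib sum_subtractf sum_distrib_right[symmetric])
    also have "\<dots> = (\<Sum>i\<in>UNIV. \<Sum>c\<in>C. z i * int (n i c) * (a (idx c) $ j - a i0 $ j))"
      by (intro sum.cong refl, subst exponent_relation[OF X]) (simp add: sum_distrib_left mult.assoc)
    also have "\<dots> = (\<Sum>c\<in>C. z' c * (a (idx c) $ j - a i0 $ j))"
      by (subst sum.swap) (simp add: z'_def sum_distrib_right)
    also have "\<dots> = a i $ j - a i0 $ j"
      unfolding exponent_relation[OF X, of i] using i by simp
    finally show "u $ j = a i $ j" by simp
  qed
  then show "u \<in> range a" by blast
qed

end

lemma complete_in_saturated: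
  assumes "complete_in (affine_lattice a) a" "saturated a"
  shows "complete_in UNIV a"
proof -
  have "lattice_points (convex hull (real_point ` range a)) \<subseteq> affine_lattice a"
    using assms(2) convex_hull_subset_affine_hull unfolding saturated_def lattice_points_def by blast
  then show ?thesis using assms(1) unfolding complete_in_def by blast
qed

section \<open>Functions of bounded degree on a configuration\<close>

text \<open>Polynomials of degree at most \<open>p\<close> in the generators \<open>x g\<close>, as
  functions of the index \<open>i\<close>. Only their values on the configuration matter for the
  kernel, so no polynomial ring is set up.\<close>

inductive poly_deg :: "'g set \<Rightarrow> ('g \<Rightarrow> 'i \<Rightarrow> 'k::comm_ring_1) \<Rightarrow> nat \<Rightarrow> ('i \<Rightarrow> 'k) \<Rightarrow> bool"
  for G :: "'g set" and x :: "'g \<Rightarrow> 'i \<Rightarrow> 'k" where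
  const: "poly_deg G x p (\<lambda>i. s)"
| add: "poly_deg G x p f \<Longrightarrow> poly_deg G x p f' \<Longrightarrow> poly_deg G x p (\<lambda>i. f i + f' i)"
| mult: "g \<in> G \<Longrightarrow> poly_deg G x p f \<Longrightarrow> poly_deg G x (Suc p) (\<lambda>i. x g i * f i)"

lemma poly_deg_scale: "poly_deg G x p f \<Longrightarrow> poly_deg G x p (\<lambda>i. s * f i)"
proof (induction rule: poly_deg.induct)
  case (mult g p f)
  then have "poly_deg G x (Suc p) (\<lambda>i. x g i * (s * f i))" by (intro poly_deg.mult)
  then show ?case by (simp add: mult_ac)
qed (auto simp: distrib_left intro: poly_deg.const poly_deg.add)

lemma poly_deg_mono: "poly_deg G x p f \<Longrightarrow> p \<le> p' \<Longrightarrow> poly_deg G x p' f"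
proof (induction arbitrary: p' rule: poly_deg.induct)
  case (mult g p f)
  then obtain p'' where "p' = Suc p''" "p \<le> p''" by (metis Suc_le_D Suc_le_mono)
  then show ?case using mult by (auto intro: poly_deg.mult)
qed (auto intro: poly_deg.const poly_deg.add)

lemma poly_deg_sum:
  "(\<And>a. a \<in> A \<Longrightarrow> poly_deg G x p (f a)) \<Longrightarrow> poly_deg G x p (\<lambda>i. \<Sum>a\<in>A. f a i)"
  by (induction A rule: infinite_finite_induct) (auto intro: poly_deg.const poly_deg.add)

text \<open>An affine substitution does not raise the degree. Applied from \<open>a\<close> to
  \<open>n\<close> and from \<open>n\<close> to \<open>a\<close>, it makes the kernel independent of
  the coordinates.\<close>

lemma poly_deg_affine:
  assumes "poly_deg G' y p f"
    and y: "\<And>g i. g \<in> G' \<Longrightarrow> y g i = s g + (\<Sum>h\<in>G. d g h * x h i)"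
  shows "poly_deg G x p f"
  using assms(1)
proof (induction rule: poly_deg.induct)
  case (mult g p f)
  have "poly_deg G x (Suc p) (\<lambda>i. s g * f i + (\<Sum>h\<in>G. d g h * (x h i * f i)))"
    by (intro poly_deg.add poly_deg_sum poly_deg_scale poly_deg.mult mult.IH poly_deg_mono[OF mult.IH]) auto
  then show ?case
    by (simp add: y[OF mult.hyps(1)] distrib_right sum_distrib_right mult.assoc)
qed (auto intro: poly_deg.const poly_deg.add)

lemma poly_deg_monomial:
  assumes "finite G"
  shows "(\<Sum>g\<in>G. \<beta> g) \<le> p \<Longrightarrow> poly_deg G x p (\<lambda>i. \<Prod>g\<in>G. x g i ^ \<beta> g)"
proof (induction p arbitrary: \<beta>)
  case 0
  then show ?case using assms by (simp add: poly_deg.const)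
next
  case (Suc p)
  show ?case
  proof (cases "\<forall>g\<in>G. \<beta> g = 0")
    case True
    then show ?thesis by (simp add: poly_deg.const)
  next
    case False
    then obtain g where g: "g \<in> G" "\<beta> g > 0" by auto
    let ?b = "\<beta>(g := \<beta> g - 1)"
    have "(\<Sum>h\<in>G. \<beta> h) = Suc (\<Sum>h\<in>G. ?b h)" using g assms by (simp add: sum.remove[of G g])
    then have "poly_deg G x (Suc p) (\<lambda>i. x g i * (\<Prod>h\<in>G. x h i ^ ?b h))"
      using Suc by (intro poly_deg.mult g(1) Suc.IH) simp
    moreover have "x g i * (\<Prod>h\<in>G. x h i ^ ?b h) = (\<Prod>h\<in>G. x h i ^ \<beta> h)" for i
    proof -
      have "x g i ^ \<beta> g = x g i * x g i ^ (\<beta> g - 1)" using g(2) by (metis power_eq_if less_not_refl)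
      then show ?thesis using g assms by (simp add: prod.remove[of G g] mult.assoc)
    qed
    ultimately show ?thesis by simp
  qed
qed

text \<open>The vector \<open>v\<close> is generalized in the induction: a factor \<open>x g\<close>
  of the function is moved over to \<open>v\<close>, which lowers the degree.\<close>

lemma annihilator_monomials:
  fixes v :: "'i::finite \<Rightarrow> 'k::comm_ring_1" and x :: "'g \<Rightarrow> 'i \<Rightarrow> 'k"
  assumes "finite G" "poly_deg G x p f"
    and "\<And>\<beta>. (\<Sum>g\<in>G. \<beta> g) \<le> p \<Longrightarrow> (\<Sum>i\<in>UNIV. (\<Prod>g\<in>G. x g i ^ \<beta> g) * v i) = 0"
  shows "(\<Sum>i\<in>UNIV. f i * v i) = 0"
  using assms(2,3)
proof (induction arbitrary: v rule: poly_deg.induct)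
  case (const p s)
  from const[of "\<lambda>_. 0"] show ?case by (simp add: sum_distrib_left[symmetric])
next
  case (add p f f')
  then show ?case by (simp add: distrib_right sum.distrib)
next
  case (mult g p f)
  have "(\<Sum>i\<in>UNIV. f i * (x g i * v i)) = 0"
  proof (rule mult.IH)
    fix \<beta> :: "'g \<Rightarrow> nat" assume b: "(\<Sum>g\<in>G. \<beta> g) \<le> p"
    let ?b = "\<beta>(g := Suc (\<beta> g))"
    have "(\<Sum>h\<in>G. ?b h) = Suc (\<Sum>h\<in>G. \<beta> h)" using mult.hyps(1) assms(1) by (simp add: sum.remove[of G g])
    then have "(\<Sum>i\<in>UNIV. (\<Prod>h\<in>G. x h i ^ ?b h) * v i) = 0" using b by (intro mult.prems) simp
    moreover have "(\<Prod>h\<in>G. x h i ^ ?b h) = (\<Prod>h\<in>G. x h i ^ \<beta> h) * x g i" for i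
      using mult.hyps(1) assms(1) by (simp add: prod.remove[of G g] mult_ac)
    ultimately show "(\<Sum>i\<in>UNIV. (\<Prod>g\<in>G. x g i ^ \<beta> g) * (x g i * v i)) = 0" by (simp add: mult.assoc)
  qed
  then show ?case by (simp add: mult_ac)
qed

text \<open>Multiplication by \<open>m\<close> in the basis of binomial coefficients, the recursion
  behind both passages between powers and binomials.\<close>

lemma binomial_shift: "m * (m choose e) = Suc e * (m choose Suc e) + e * (m choose e)"
proof (cases "e \<le> m")
  case True
  have "Suc e * (m choose Suc e) = (m - e) * (m choose e)" by (metis binomial_absorb_comp binomial_absorption)
  then show ?thesis using True by (metis add_mult_distrib le_add_diff_inverse2)
qed (simp add: binomial_eq_0)

text \<open>\<open>binomial_shift\<close> is solved for the higher binomial coefficient; the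
  division by \<open>e g\<close> is where characteristic zero enters.\<close>

lemma poly_deg_binomial:
  fixes n :: "'i \<Rightarrow> 'g \<Rightarrow> nat"
  assumes "finite G"
  shows "(\<Sum>g\<in>G. e g) \<le> p \<Longrightarrow>
    poly_deg G (\<lambda>g i. of_nat (n i g) :: 'k::field_char_0) p (\<lambda>i. \<Prod>g\<in>G. of_nat (n i g choose e g))"
proof (induction p arbitrary: e)
  case 0
  then show ?case using assms by (simp add: poly_deg.const)
next
  case (Suc p)
  show ?case
  proof (cases "\<forall>g\<in>G. e g = 0")
    case True
    then show ?thesis by (simp add: poly_deg.const)
  next
    case False
    then obtain g where g: "g \<in> G" "e g > 0" by auto
    let ?e = "e(g := e g - 1)"
    let ?f = "\<lambda>i. (\<Prod>h\<in>G. of_nat (n i h choose ?e h)) :: 'k"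
    have "(\<Sum>h\<in>G. e h) = Suc (\<Sum>h\<in>G. ?e h)" using g assms by (simp add: sum.remove[of G g])
    then have IH: "poly_deg G (\<lambda>g i. of_nat (n i g)) p ?f"
      using Suc.prems by (intro Suc.IH) simp
    have "poly_deg G (\<lambda>g i. of_nat (n i g)) (Suc p)
        (\<lambda>i. inverse (of_nat (e g)) * (of_nat (n i g) * ?f i + (- of_nat (e g - 1)) * ?f i))"
      by (intro poly_deg_scale poly_deg.add poly_deg.mult g(1) IH poly_deg_mono[OF IH]) simp
    moreover have "inverse (of_nat (e g)) * (of_nat (n i g) * ?f i + (- of_nat (e g - 1)) * ?f i)
        = (\<Prod>h\<in>G. of_nat (n i h choose e h))" for i
    proof -
      obtain e' where e': "e g = Suc e'" using g(2) by (cases "e g") auto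
      have "of_nat (n i g) * of_nat (n i g choose e')
          = (of_nat (Suc e') * of_nat (n i g choose Suc e') + of_nat e' * of_nat (n i g choose e') :: 'k)"
        using arg_cong[OF binomial_shift[of "n i g" e'], of "of_nat :: nat \<Rightarrow> 'k"]
        by (simp only: of_nat_mult of_nat_add)
      then have shift: "(of_nat (n i g) - of_nat e') * of_nat (n i g choose e')
          = (of_nat (Suc e') * of_nat (n i g choose Suc e') :: 'k)" by (simp add: algebra_simps)
      let ?r = "(\<Prod>h\<in>G - {g}. of_nat (n i h choose e h)) :: 'k"
      have f: "?f i = of_nat (n i g choose e') * ?r"
        using g assms e' by (simp add: prod.remove[of G g])
      have "of_nat (n i g) * ?f i + (- of_nat (e g - 1)) * ?f i
          = (of_nat (n i g) - of_nat e') * of_nat (n i g choose e') * ?r"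
        by (simp only: f) (simp add: e' algebra_simps)
      also have "\<dots> = of_nat (e g) * (of_nat (n i g choose e g) * ?r)"
        unfolding shift e' by (simp only: mult.assoc)
      also have "of_nat (n i g choose e g) * ?r = (\<Prod>h\<in>G. of_nat (n i h choose e h))"
        using g assms by (simp add: prod.remove[of G g])
      finally show ?thesis using g(2) by simp
    qed
    ultimately show ?thesis by simp
  qed
qed

lemma annihilator_binomials:
  fixes v :: "'i::finite \<Rightarrow> 'k::field_char_0" and n :: "'i \<Rightarrow> 'g \<Rightarrow> nat"
  assumes "finite G" "poly_deg G (\<lambda>g i. of_nat (n i g)) p f"
    and "\<And>e. (\<Sum>g\<in>G. e g) \<le> p \<Longrightarrow> (\<Sum>i\<in>UNIV. (\<Prod>g\<in>G. of_nat (n i g choose e g)) * v i) = 0"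
  shows "(\<Sum>i\<in>UNIV. f i * v i) = 0"
  using assms(2,3)
proof (induction arbitrary: v rule: poly_deg.induct)
  case (const p s)
  from const[of "\<lambda>_. 0"] show ?case by (simp add: sum_distrib_left[symmetric])
next
  case (add p f f')
  then show ?case by (simp add: distrib_right sum.distrib)
next
  case (mult g p f)
  have "(\<Sum>i\<in>UNIV. f i * (of_nat (n i g) * v i)) = 0"
  proof (rule mult.IH)
    fix e :: "'g \<Rightarrow> nat" assume e: "(\<Sum>g\<in>G. e g) \<le> p"
    let ?e = "e(g := Suc (e g))"
    let ?b = "\<lambda>e i. (\<Prod>h\<in>G. of_nat (n i h choose e h)) :: 'k"
    have "(\<Sum>h\<in>G. ?e h) = Suc (\<Sum>h\<in>G. e h)" using mult.hyps(1) assms(1) by (simp add: sum.remove[of G g])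
    then have "(\<Sum>i\<in>UNIV. ?b ?e i * v i) = 0" "(\<Sum>i\<in>UNIV. ?b e i * v i) = 0"
      using e by (intro mult.prems, simp)+
    moreover have "?b e i * (of_nat (n i g) * v i)
        = of_nat (Suc (e g)) * (?b ?e i * v i) + of_nat (e g) * (?b e i * v i)" for i
    proof -
      let ?r = "(\<Prod>h\<in>G - {g}. of_nat (n i h choose e h)) :: 'k"
      have "of_nat (n i g) * of_nat (n i g choose e g)
          = (of_nat (Suc (e g)) * of_nat (n i g choose Suc (e g)) + of_nat (e g) * of_nat (n i g choose e g) :: 'k)"
        using arg_cong[OF binomial_shift[of "n i g" "e g"], of "of_nat :: nat \<Rightarrow> 'k"]
        by (simp only: of_nat_mult of_nat_add)
      note shift = this
      have b: "?b e i = of_nat (n i g choose e g) * ?r" "?b ?e i = of_nat (n i g choose Suc (e g)) * ?r"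
        using mult.hyps(1) assms(1) by (simp_all add: prod.remove[of G g])
      have "?b e i * (of_nat (n i g) * v i) = (of_nat (n i g) * of_nat (n i g choose e g)) * (?r * v i)"
        by (simp only: b mult_ac)
      also have "\<dots> = of_nat (Suc (e g)) * (?b ?e i * v i) + of_nat (e g) * (?b e i * v i)"
        unfolding shift b by (simp only: distrib_right mult.assoc)
      finally show ?thesis .
    qed
    ultimately show "(\<Sum>i\<in>UNIV. ?b e i * (of_nat (n i g) * v i)) = 0"
      by (simp only: sum.distrib sum_distrib_left[symmetric] mult_zero_right add_0_left)
  qed
  then show ?case by (simp add: mult_ac)
qed

section \<open>The kernel of the power matrix in terms of the chart exponents\<close>

context monomial_chart
begin

text \<open>Powers of \<open>a\<close> and binomials in \<open>n\<close> have the same annihilator,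
  since both generate the functions of degree at most \<open>p\<close>: the two configurations are
  affine functions of each other, with rational coefficients, which embed in the field.\<close>

lemma power_matrix_kernel_iff:
  fixes a :: "'i \<Rightarrow> int ^ 'd::finite"
  assumes X: "X = toric_variety a"
  shows "(v :: 'k ^ 'i) \<in> power_matrix_kernel p a \<longleftrightarrow>
    (\<forall>e. (\<Sum>c\<in>C. e c) \<le> p \<longrightarrow> (\<Sum>i\<in>UNIV. (\<Prod>c\<in>C. of_nat (n i c choose e c)) * v $ i) = 0)"
proof -
  let ?y = "\<lambda>j i. of_int (a i $ j) :: 'k" and ?x = "\<lambda>c i. of_nat (n i c) :: 'k"
  have mono: "of_int (lattice_power (a i) \<beta>) = (\<Prod>j\<in>UNIV. ?y j i ^ \<beta> j)" for i \<beta>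
    by (simp add: lattice_power_def)
  have y: "?y j i = of_int (a i0 $ j) + (\<Sum>c\<in>C. of_int (a (idx c) $ j - a i0 $ j) * ?x c i)" for j i
  proof -
    have "of_int (a i $ j - a i0 $ j) = (of_int (\<Sum>c\<in>C. int (n i c) * (a (idx c) $ j - a i0 $ j)) :: 'k)"
      by (simp only: exponent_relation[OF X, of i j])
    then show ?thesis by (simp add: algebra_simps)
  qed
  obtain B :: "'c \<Rightarrow> 'd \<Rightarrow> rat" where
    B: "\<And>i c. c \<in> C \<Longrightarrow> of_nat (n i c) = (\<Sum>j\<in>UNIV. B c j * of_int (a i $ j - a i0 $ j))"
    using exponents_affine[OF X] by blast
  have x: "?x c i = (- (\<Sum>j\<in>UNIV. of_rat (B c j) * of_int (a i0 $ j))) + (\<Sum>j\<in>UNIV. of_rat (B c j) * ?y j i)"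
    if "c \<in> C" for c i
  proof -
    have "?x c i = of_rat (of_nat (n i c))" by simp
    also have "\<dots> = (\<Sum>j\<in>UNIV. of_rat (B c j) * of_int (a i $ j - a i0 $ j))"
      unfolding B[OF that] by (simp add: of_rat_sum of_rat_mult of_rat_diff)
    finally show ?thesis by (simp add: right_diff_distrib sum_subtractf)
  qed
  show ?thesis
  proof
    assume v: "v \<in> power_matrix_kernel p a"
    have ann: "(\<Sum>i\<in>UNIV. f i * v $ i) = 0" if "poly_deg UNIV ?y p f" for f
      by (rule annihilator_monomials[OF _ that])
         (use v in \<open>auto simp: power_matrix_kernel_def mono\<close>)
    show "\<forall>e. (\<Sum>c\<in>C. e c) \<le> p \<longrightarrow> (\<Sum>i\<in>UNIV. (\<Prod>c\<in>C. of_nat (n i c choose e c)) * v $ i) = 0"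
    proof (intro allI impI ann)
      fix e :: "'c \<Rightarrow> nat" assume "(\<Sum>c\<in>C. e c) \<le> p"
      from poly_deg_binomial[OF finite_C this, of n]
      show "poly_deg UNIV ?y p (\<lambda>i. \<Prod>c\<in>C. of_nat (n i c choose e c))"
        by (rule poly_deg_affine) (rule x)
    qed
  next
    assume v: "\<forall>e. (\<Sum>c\<in>C. e c) \<le> p \<longrightarrow> (\<Sum>i\<in>UNIV. (\<Prod>c\<in>C. of_nat (n i c choose e c)) * v $ i) = 0"
    have ann: "(\<Sum>i\<in>UNIV. f i * v $ i) = 0" if "poly_deg C ?x p f" for f
      by (rule annihilator_binomials[OF finite_C that]) (use v in auto)
    show "v \<in> power_matrix_kernel p a"
      unfolding power_matrix_kernel_def mono mem_Collect_eq
    proof (intro allI impI ann)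
      fix \<beta> :: "'d \<Rightarrow> nat" assume "(\<Sum>j\<in>UNIV. \<beta> j) \<le> p"
      from poly_deg_monomial[OF _ this, of ?y]
      have "poly_deg UNIV ?y p (\<lambda>i. \<Prod>j\<in>UNIV. ?y j i ^ \<beta> j)" by simp
      then show "poly_deg C ?x p (\<lambda>i. \<Prod>j\<in>UNIV. ?y j i ^ \<beta> j)"
        by (rule poly_deg_affine) (rule y)
    qed
  qed
qed

text \<open>
  The number of exponents of degree larger than \<open>p\<close> is the dimension, because in the basis of the
  products of binomial coefficients the matrix becomes unitriangular.
\<close>

lemma dim_power_matrix_kernel:
  fixes a :: "'i \<Rightarrow> int ^ 'd::finite"
  assumes X: "X = toric_variety a"
    and down: "\<And>i e. (\<And>c. c \<in> C \<Longrightarrow> e c \<le> n i c) \<Longrightarrow> \<exists>i'. \<forall>c\<in>C. n i' c = e c"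
  shows "vec.dim (power_matrix_kernel p a :: ('k ^ 'i) set) = card {i. deg i > p}"
proof -
  define T :: "'k ^ 'i ^ 'i" where "T = (\<chi> i'. \<chi> i. \<Prod>c\<in>C. of_nat (n i c choose n i' c))"
  have T: "(T *v v) $ i' = (\<Sum>i\<in>UNIV. (\<Prod>c\<in>C. of_nat (n i c choose n i' c)) * v $ i)" for v i'
    by (simp add: T_def matrix_vector_mult_def)
  have ker: "(power_matrix_kernel p a :: ('k ^ 'i) set) = {v. \<forall>i. i \<notin> {i. deg i > p} \<longrightarrow> (T *v v) $ i = 0}"
  proof (intro set_eqI iffI)
    fix v :: "'k ^ 'i" assume "v \<in> power_matrix_kernel p a"
    then show "v \<in> {v. \<forall>i. i \<notin> {i. deg i > p} \<longrightarrow> (T *v v) $ i = 0}"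
      unfolding power_matrix_kernel_iff[OF X] by (auto simp: T deg_def not_less)
  next
    fix v :: "'k ^ 'i" assume v: "v \<in> {v. \<forall>i. i \<notin> {i. deg i > p} \<longrightarrow> (T *v v) $ i = 0}"
    show "v \<in> power_matrix_kernel p a"
      unfolding power_matrix_kernel_iff[OF X]
    proof (intro allI impI)
      fix e :: "'c \<Rightarrow> nat" assume e: "(\<Sum>c\<in>C. e c) \<le> p"
      show "(\<Sum>i\<in>UNIV. (\<Prod>c\<in>C. of_nat (n i c choose e c)) * v $ i) = 0"
      proof (cases "\<exists>i'. \<forall>c\<in>C. n i' c = e c")
        case True
        then obtain i' where i': "\<forall>c\<in>C. n i' c = e c" by blast
        then have "deg i' \<le> p" using e by (simp add: deg_def)
        then show ?thesis using v i' T[of v i'] by (simp add: not_less)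
      next
        case False
        \<comment> \<open>By \<open>down\<close>, a vector \<open>e\<close> that is not an exponent
          vector lies below none, so it imposes no condition.\<close>
        have "(\<Prod>c\<in>C. of_nat (n i c choose e c)) = (0::'k)" for i
        proof -
          obtain c where "c \<in> C" "n i c < e c" using down[of e i] False by (meson not_less)
          then show ?thesis by (intro prod_zero) (auto simp: binomial_eq_0)
        qed
        then show ?thesis by (simp only: mult_zero_left sum.neutral_const)
      qed
    qed
  qed
  have "v = 0" if Tv: "T *v v = 0" for v
  proof (rule ccontr)
    assume "v \<noteq> 0"
    \<comment> \<open>Row \<open>i\<close> of \<open>T\<close> sees only indices whose exponents
      dominate \<open>n i\<close>. For \<open>i\<close> of maximal degree in the support of
      \<open>v\<close>, that leaves \<open>i\<close> alone, with coefficient 1.\<close>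
    define S where "S = {i. v $ i \<noteq> 0}"
    have "S \<noteq> {}" using \<open>v \<noteq> 0\<close> by (auto simp: vec_eq_iff S_def)
    then have "Max (deg ` S) \<in> deg ` S" by simp
    then obtain i where "i \<in> S" "deg i = Max (deg ` S)" by auto
    then have i: "v $ i \<noteq> 0" "\<And>i'. v $ i' \<noteq> 0 \<Longrightarrow> deg i' \<le> deg i" by (auto simp: S_def)
    have "(\<Prod>c\<in>C. of_nat (n i' c choose n i c)) * v $ i' = 0" if "i' \<noteq> i" for i'
    proof (rule ccontr)
      assume *: "\<not> ?thesis"
      then have le: "n i c \<le> n i' c" if "c \<in> C" for c using that by (auto simp: not_less[symmetric])
      have "deg i' \<le> deg i" using * i(2) by simp
      then have "(\<Sum>c\<in>C. n i c) = (\<Sum>c\<in>C. n i' c)"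
        unfolding deg_def using sum_mono[of C "n i" "n i'"] le by auto
      then have "n i c = n i' c" if "c \<in> C" for c
        using sum_mono_inv[of "n i" C "n i'" c] le that by simp
      then show False using n_inj[of i i'] \<open>i' \<noteq> i\<close> by blast
    qed
    then have "(\<Sum>i'\<in>UNIV - {i}. (\<Prod>c\<in>C. of_nat (n i' c choose n i c)) * v $ i') = 0"
      by (intro sum.neutral ballI) blast
    then have "(T *v v) $ i = (\<Prod>c\<in>C. of_nat (n i c choose n i c)) * v $ i"
      unfolding T by (subst sum.remove[of _ i]) (simp_all only: finite UNIV_I add_0_right)
    then show False using Tv i(1) by simp
  qed
  then have inj: "inj ((*v) T)"
    by (simp add: vec.inj_iff_eq_0)
  have surj: "surj ((*v) T)"
    using inj by (metis matrix_left_invertible_injective matrix_left_right_inverse matrix_right_invertible_surjective)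
  have "(*v) T ` power_matrix_kernel p a = {x. \<forall>i. i \<notin> {i. deg i > p} \<longrightarrow> x $ i = 0}"
    unfolding ker using surj by (auto simp: surj_def)
  then show ?thesis
    using dim_matrix_image[OF inj, of "power_matrix_kernel p a"] dim_substandard_cart[where 'a = 'k and d = "{i. deg i > p}"] by simp
qed

end

section \<open>Products of a projective space with projective lines\<close>

lemma form_coord_power: "form m (\<lambda>y. (y $ i) ^ m)"
  using form_power[OF form_coord, of m i] by simp

text \<open>An index is a pair of a coordinate \<open>sg i\<close> of the projective space and an
  exponent vector \<open>u i\<close> for the lines. The torus points are dehomogenized by
  \<open>w o0 = 1\<close> on the first factor and by the first coordinate of each line.\<close>

locale segre_veronese =
  fixes l :: "'m::finite \<Rightarrow> nat" and sg :: "'i::finite \<Rightarrow> 'o::finite" and u :: "'i \<Rightarrow> 'm \<Rightarrow> nat"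
    and o0 :: 'o and X :: "('k::field_char_0 ^ 'i) set"
  assumes l_pos: "l j \<ge> 1"
    and bij_index: "bij_betw (\<lambda>i. (sg i, u i)) UNIV (UNIV \<times> {f. \<forall>j. f j \<le> l j})"
    and X_closure: "X = zariski closure_of
      {(\<chi> i. w (sg i) * (\<Prod>j\<in>UNIV. t j ^ u i j)) | w t. w o0 = 1 \<and> (\<forall>\<sigma>. w \<sigma> \<noteq> 0) \<and> (\<forall>j. t j \<noteq> 0)}"
begin

definition ix :: "'o \<Rightarrow> ('m \<Rightarrow> nat) \<Rightarrow> 'i" where
  "ix \<sigma> f = (THE i. sg i = \<sigma> \<and> u i = f)"

lemma u_le: "u i j \<le> l j"
proof -
  have "(sg i, u i) \<in> UNIV \<times> {f. \<forall>j. f j \<le> l j}"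
    using bij_index by (metis (no_types, lifting) UNIV_I bij_betw_apply)
  then show ?thesis by simp
qed

lemma index_eqI: "sg i = sg i' \<Longrightarrow> u i = u i' \<Longrightarrow> i = i'"
  using bij_betw_imp_inj_on[OF bij_index] by (simp add: inj_on_def)

lemma ix:
  assumes "\<And>j. f j \<le> l j" shows "sg (ix \<sigma> f) = \<sigma>" "u (ix \<sigma> f) = f"
proof -
  have "(\<sigma>, f) \<in> (\<lambda>i. (sg i, u i)) ` UNIV"
    using bij_betw_imp_surj_on[OF bij_index] assms by simp
  then obtain i where i: "sg i = \<sigma> \<and> u i = f" by auto
  then have "sg (ix \<sigma> f) = \<sigma> \<and> u (ix \<sigma> f) = f"
    unfolding ix_def by (rule theI[where P = "\<lambda>i. sg i = \<sigma> \<and> u i = f"]) (use i index_eqI in metis)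
  then show "sg (ix \<sigma> f) = \<sigma>" "u (ix \<sigma> f) = f" by auto
qed

lemma ix_index: "ix (sg i) (u i) = i"
  by (rule index_eqI) (simp_all add: ix u_le)

text \<open>
  Homogeneous coordinates \<open>w\<close> on the projective space and \<open>s, t\<close> on the lines. For
  \<open>CARD('o) = 1\<close> the first factor is a point, which covers products of lines.
\<close>

definition phi :: "('o \<Rightarrow> 'k) \<Rightarrow> ('m \<Rightarrow> 'k) \<Rightarrow> ('m \<Rightarrow> 'k) \<Rightarrow> 'k ^ 'i" where
  "phi w s t = (\<chi> i. w (sg i) * (\<Prod>j\<in>UNIV. s j ^ (l j - u i j) * t j ^ u i j))"

definition valid :: "('o \<Rightarrow> 'k) \<Rightarrow> ('m \<Rightarrow> 'k) \<Rightarrow> ('m \<Rightarrow> 'k) \<Rightarrow> bool" where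
  "valid w s t \<longleftrightarrow> (\<exists>\<sigma>. w \<sigma> \<noteq> 0) \<and> (\<forall>j. s j \<noteq> 0 \<or> t j \<noteq> 0)"

lemma phi_nth: "phi w s t $ i = w (sg i) * (\<Prod>j\<in>UNIV. s j ^ (l j - u i j) * t j ^ u i j)"
  by (simp add: phi_def)

lemma phi_eq_0_iff: "phi w s t = 0 \<longleftrightarrow> \<not> valid w s t"
proof
  assume phi: "phi w s t = 0"
  show "\<not> valid w s t"
  proof
    assume v: "valid w s t"
    then obtain \<sigma> where "w \<sigma> \<noteq> 0" unfolding valid_def by blast
    \<comment> \<open>The vertex of the box that selects a nonzero one among \<open>s j\<close> and
      \<open>t j\<close> in every factor.\<close>
    let ?f = "\<lambda>j. if s j = 0 then l j else 0"
    have "phi w s t $ ix \<sigma> ?f = w \<sigma> * (\<Prod>j\<in>UNIV. s j ^ (l j - ?f j) * t j ^ ?f j)"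
      by (simp add: phi_nth ix)
    also have "\<dots> \<noteq> 0" using \<open>w \<sigma> \<noteq> 0\<close> v by (auto simp: valid_def)
    finally show False using phi by simp
  qed
next
  assume nv: "\<not> valid w s t"
  show "phi w s t = 0"
  proof (rule vec_eq_iff[THEN iffD2], rule allI)
    fix i show "phi w s t $ i = 0 $ i"
    proof (cases "\<exists>\<sigma>. w \<sigma> \<noteq> 0")
      case True
      then obtain j where "s j = 0" "t j = 0" using nv unfolding valid_def by blast
      then have "s j ^ (l j - u i j) * t j ^ u i j = 0" using l_pos[of j] by (auto simp: power_0_left)
      then have "(\<Prod>j\<in>UNIV. s j ^ (l j - u i j) * t j ^ u i j) = 0" by (intro prod_zero) auto
      then show ?thesis by (simp add: phi_nth)
    qed (simp add: phi_nth)
  qed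
qed

abbreviation torus_points :: "('k ^ 'i) set" where
  "torus_points \<equiv> {(\<chi> i. w (sg i) * (\<Prod>j\<in>UNIV. t j ^ u i j)) | w t. w o0 = 1 \<and> (\<forall>\<sigma>. w \<sigma> \<noteq> 0) \<and> (\<forall>j. t j \<noteq> 0)}"

lemma torus_point_phi: "(\<chi> i. w (sg i) * (\<Prod>j\<in>UNIV. t j ^ u i j)) = phi w (\<lambda>_. 1) t"
  by (simp add: phi_def)

lemma zero_notin_torus: "0 \<notin> torus_points"
proof
  assume "0 \<in> torus_points"
  then obtain w t where "phi w (\<lambda>_. 1) t = 0" "\<forall>\<sigma>. w \<sigma> \<noteq> 0" unfolding torus_point_phi by auto
  then show False by (auto simp: phi_eq_0_iff valid_def)
qed

lemma mem_X_iff: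
  "y \<in> X \<longleftrightarrow> y \<noteq> 0 \<and> (\<forall>d F. form d F \<and> (\<forall>s\<in>torus_points. F s = 0) \<longrightarrow> F y = 0)"
  unfolding X_closure closure_of_zariski[OF zero_notin_torus] by blast

lemma zero_notin_X: "0 \<notin> X" by (simp add: mem_X_iff)

lemma closed_X: "closedin zariski X" unfolding X_closure by simp

section \<open>The variety is the image of the homogeneous parametrization\<close>

lemma phi_line:
  obtains c where "\<And>x. phi (\<lambda>\<sigma>. w \<sigma> + x * w' \<sigma>) (\<lambda>j. s j + x * s' j) (\<lambda>j. t j + x * t' j) = (\<chi> i. poly (c i) x)"
proof -
  let ?c = "\<lambda>i. [:w (sg i), w' (sg i):] * (\<Prod>j\<in>UNIV. [:s j, s' j:] ^ (l j - u i j) * [:t j, t' j:] ^ u i j)"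
  show thesis by (rule that[of ?c]) (simp add: phi_def poly_prod distrib_right mult_ac)
qed

lemma form_phi_line:
  assumes "form d F"
  obtains p where "\<And>x. F (phi (\<lambda>\<sigma>. w \<sigma> + x * w' \<sigma>) (\<lambda>j. s j + x * s' j) (\<lambda>j. t j + x * t' j)) = poly p x"
proof -
  obtain c where c: "\<And>x. phi (\<lambda>\<sigma>. w \<sigma> + x * w' \<sigma>) (\<lambda>j. s j + x * s' j) (\<lambda>j. t j + x * t' j) = (\<chi> i. poly (c i) x)"
    by (rule phi_line[of w w' s s' t t']) blast
  obtain p where "\<And>x. F (\<chi> i. poly (c i) x) = poly p x" by (rule form_poly_curve[OF assms, of c]) blast
  then show thesis by (intro that[of p]) (simp add: c)
qed

text \<open>For nonzero parameters the point is a multiple of a torus point. In general all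
  parameters are shifted by the same \<open>x\<close>, which makes them nonzero for all but finitely
  many \<open>x\<close>; a form vanishing on the torus points thus restricts to a polynomial with
  infinitely many zeros.\<close>

lemma phi_mem:
  assumes v: "valid w s t" shows "phi w s t \<in> X"
  unfolding mem_X_iff
proof (intro conjI allI impI, simp add: phi_eq_0_iff v, elim conjE)
  fix d F assume F: "form d F" "\<forall>s\<in>torus_points. F s = 0"
  have gen: "F (phi w s t) = 0"
    if w: "\<And>\<sigma>. w \<sigma> \<noteq> 0" and s: "\<And>j. s j \<noteq> 0" and t: "\<And>j. t j \<noteq> 0" for w s t
  proof -
    let ?a = "w o0 * (\<Prod>j\<in>UNIV. s j ^ l j)"
    have "phi w s t = ?a *s phi (\<lambda>\<sigma>. w \<sigma> / w o0) (\<lambda>_. 1) (\<lambda>j. t j / s j)"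
    proof (rule vec_eq_iff[THEN iffD2], rule allI)
      fix i
      have "(\<Prod>j\<in>UNIV. s j ^ (l j - u i j) * t j ^ u i j) = (\<Prod>j\<in>UNIV. s j ^ l j) * (\<Prod>j\<in>UNIV. (t j / s j) ^ u i j)"
        unfolding prod.distrib[symmetric]
        by (rule prod.cong) (auto simp: power_divide power_diff s u_le)
      then show "phi w s t $ i = (?a *s phi (\<lambda>\<sigma>. w \<sigma> / w o0) (\<lambda>_. 1) (\<lambda>j. t j / s j)) $ i"
        using w by (simp add: phi_nth)
    qed
    moreover have "phi (\<lambda>\<sigma>. w \<sigma> / w o0) (\<lambda>_. 1) (\<lambda>j. t j / s j) \<in> torus_points"
      unfolding torus_point_phi using w s t
      by (intro CollectI exI[of _ "\<lambda>\<sigma>. w \<sigma> / w o0"] exI[of _ "\<lambda>j. t j / s j"]) simp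
    ultimately show ?thesis using F by (simp add: form_homogeneous)
  qed
  obtain p where p: "\<And>x. F (phi (\<lambda>\<sigma>. w \<sigma> + x * 1) (\<lambda>j. s j + x * 1) (\<lambda>j. t j + x * 1)) = poly p x"
    by (rule form_phi_line[OF F(1), of w "\<lambda>_. 1" s "\<lambda>_. 1" t "\<lambda>_. 1"]) blast
  let ?Z = "range (\<lambda>\<sigma>. - w \<sigma>) \<union> range (\<lambda>j. - s j) \<union> range (\<lambda>j. - t j)"
  have "poly p x = 0" if x: "x \<notin> ?Z" for x
  proof -
    have "w \<sigma> + x * 1 \<noteq> 0" for \<sigma> using x by (auto simp: add_eq_0_iff)
    moreover have "s j + x * 1 \<noteq> 0" "t j + x * 1 \<noteq> 0" for j using x by (auto simp: add_eq_0_iff)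
    ultimately show ?thesis unfolding p[symmetric] by (rule gen)
  qed
  then have "- ?Z \<subseteq> {x. poly p x = 0}" by blast
  moreover have "finite ?Z" by simp
  then have "finite (- ?Z) \<longleftrightarrow> finite (UNIV :: 'k set)" by (rule finite_compl)
  then have "infinite (- ?Z)" using infinite_UNIV_char_0[where 'a = 'k] by blast
  ultimately have "infinite {x. poly p x = 0}" using finite_subset by metis
  then have "p = 0" using poly_roots_finite[of p] by blast
  then show "F (phi w s t) = 0" using p[of 0] by simp
qed

lemma torus_coord:
  assumes "\<And>j. f j \<le> l j"
  shows "phi w (\<lambda>_. 1) t $ ix \<sigma> f = w \<sigma> * (\<Prod>j\<in>UNIV. t j ^ f j)"
  by (simp add: phi_nth ix assms)

lemma torus_coord_update:
  assumes "\<And>j. f j \<le> l j" "b \<le> l j" "f j \<le> b"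
  shows "phi w (\<lambda>_. 1) t $ ix \<sigma> (f(j := b)) = phi w (\<lambda>_. 1) t $ ix \<sigma> f * t j ^ (b - f j)"
proof -
  have "(\<Prod>j'\<in>UNIV. t j' ^ (f(j := b)) j') = (\<Prod>j'\<in>UNIV. t j' ^ f j') * t j ^ (b - f j)"
  proof -
    have "(\<Prod>j'\<in>UNIV. t j' ^ (f(j := b)) j') = t j ^ b * (\<Prod>j'\<in>UNIV - {j}. t j' ^ f j')"
      by (simp add: prod.remove[of _ j])
    also have "t j ^ b = t j ^ f j * t j ^ (b - f j)" using assms(3) by (simp add: power_add[symmetric])
    finally show ?thesis by (simp add: prod.remove[of _ j] mult_ac)
  qed
  moreover have "(f(j := b)) j' \<le> l j'" for j' using assms by simp
  ultimately show ?thesis using assms(1) by (simp add: torus_coord del: fun_upd_apply)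
qed

text \<open>On the edge in direction \<open>j\<close>, \<open>l j\<close> times the position
  \<open>f j\<close> is \<open>f j\<close> times the upper end plus \<open>l j - f j\<close> times
  the lower end. The resulting binomial vanishes on \<open>X\<close>, so the coordinate at the upper
  end cannot be zero.\<close>

lemma X_vertex_step:
  assumes y: "y \<in> X" and f: "\<And>j. f j \<le> l j" and nz: "y $ ix \<sigma> f \<noteq> 0" and fj: "f j > 0"
  shows "y $ ix \<sigma> (f(j := l j)) \<noteq> 0"
proof -
  let ?F = "\<lambda>y. (y $ ix \<sigma> f) ^ (f j + (l j - f j))
    - (y $ ix \<sigma> (f(j := l j))) ^ f j * (y $ ix \<sigma> (f(j := 0))) ^ (l j - f j)"
  have "form (f j + (l j - f j)) ?F"
    by (intro form_diff form_mult form_coord_power)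
  moreover have "?F z = 0" if z_mem: "z \<in> torus_points" for z
  proof -
    obtain w t where z: "z = phi w (\<lambda>_. 1) t" using z_mem unfolding torus_point_phi by blast
    have up: "z $ ix \<sigma> (f(j := l j)) = z $ ix \<sigma> f * t j ^ (l j - f j)"
      unfolding z using f by (intro torus_coord_update) auto
    have "z $ ix \<sigma> ((f(j := 0))(j := f j)) = z $ ix \<sigma> (f(j := 0)) * t j ^ (f j - (f(j := 0)) j)"
      unfolding z using f by (intro torus_coord_update) auto
    then have down: "z $ ix \<sigma> f = z $ ix \<sigma> (f(j := 0)) * t j ^ f j" by simp
    have "(z $ ix \<sigma> f) ^ (l j - f j) = (z $ ix \<sigma> (f(j := 0))) ^ (l j - f j) * t j ^ (f j * (l j - f j))"
      by (subst down) (simp add: power_mult_distrib power_mult)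
    moreover have "(z $ ix \<sigma> (f(j := l j))) ^ f j = (z $ ix \<sigma> f) ^ f j * t j ^ (f j * (l j - f j))"
      by (subst up) (simp add: power_mult_distrib power_mult[symmetric] mult.commute)
    ultimately show ?thesis by (simp only: power_add mult_ac) simp
  qed
  ultimately have "?F y = 0" using y unfolding mem_X_iff by blast
  then show ?thesis using nz fj by (auto simp: power_0_left)
qed

lemma X_vertex:
  assumes y: "y \<in> X"
  obtains \<sigma> f where "\<And>j. f j = 0 \<or> f j = l j" "y $ ix \<sigma> f \<noteq> 0"
proof -
  have "y \<noteq> 0" using y by (simp add: mem_X_iff)
  then obtain i where i: "y $ i \<noteq> 0" by (auto simp: vec_eq_iff)
  have "\<exists>f. (\<forall>j. f j \<le> l j) \<and> y $ ix (sg i) f \<noteq> 0 \<and> (\<forall>j\<in>J. f j = 0 \<or> f j = l j)"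
    if "finite J" for J
    using that
  proof (induction J rule: finite_induct)
    case empty
    show ?case by (intro exI[of _ "u i"]) (simp add: u_le ix_index i)
  next
    case (insert j J)
    then obtain f where f: "\<forall>j. f j \<le> l j" "y $ ix (sg i) f \<noteq> 0" "\<forall>j\<in>J. f j = 0 \<or> f j = l j" by blast
    show ?case
    proof (cases "f j = 0")
      case True
      then show ?thesis using f by (intro exI[of _ f]) auto
    next
      case False
      then have "y $ ix (sg i) (f(j := l j)) \<noteq> 0"
        using X_vertex_step[OF y _ f(2), of j] f(1) by blast
      moreover have "\<forall>j'. (f(j := l j)) j' \<le> l j'" "\<forall>j'\<in>insert j J. (f(j := l j)) j' = 0 \<or> (f(j := l j)) j' = l j'"
        using f by auto
      ultimately show ?thesis by blast
    qed
  qed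
  from this[of UNIV] show thesis using that by auto
qed

text \<open>Some coordinate at a vertex \<open>g\<close> of the box is nonzero. In the affine chart
  given by it, binomial relations express every coordinate through those at the vertex and at its
  neighbours, which yields the parameters explicitly.\<close>

lemma X_subset_phi:
  assumes y: "y \<in> X" obtains w s t where "valid w s t" "y = phi w s t"
proof -
  obtain \<sigma>0 g where g: "\<And>j. g j = 0 \<or> g j = l j" and nz: "y $ ix \<sigma>0 g \<noteq> 0"
    by (rule X_vertex[OF y]) blast
  have g_le: "g j \<le> l j" for j using g[of j] by auto
  \<comment> \<open>\<open>g' j\<close> is the neighbour of the vertex \<open>g\<close> in direction
    \<open>j\<close>, \<open>N f j\<close> the number of steps from \<open>g\<close> to
    \<open>f\<close> in that direction, and \<open>q j\<close> the corresponding affine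
    coordinate.\<close>
  define g' where "g' j = g(j := if g j = 0 then 1 else l j - 1)" for j
  define N where "N f j = (if g j = 0 then f j else l j - f j)" for f :: "'m \<Rightarrow> nat" and j
  define q where "q j = y $ ix \<sigma>0 (g' j) / y $ ix \<sigma>0 g" for j
  have rel: "y $ ix \<sigma> f * (y $ ix \<sigma>0 g) ^ (\<Sum>j\<in>UNIV. N f j)
      = y $ ix \<sigma> g * (\<Prod>j\<in>UNIV. (y $ ix \<sigma>0 (g' j)) ^ N f j)" if f: "\<And>j. f j \<le> l j" for \<sigma> f
  proof -
    let ?F = "\<lambda>y. y $ ix \<sigma> f * (y $ ix \<sigma>0 g) ^ (\<Sum>j\<in>UNIV. N f j)
      - y $ ix \<sigma> g * (\<Prod>j\<in>UNIV. (y $ ix \<sigma>0 (g' j)) ^ N f j)"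
    have "form (1 + (\<Sum>j\<in>UNIV. N f j)) ?F"
      by (intro form_diff form_mult form_coord form_prod form_coord_power)
    moreover have "?F z = 0" if z_mem: "z \<in> torus_points" for z
    proof -
      obtain w t where z: "z = phi w (\<lambda>_. 1) t" and w: "\<And>\<sigma>. w \<sigma> \<noteq> 0" and t: "\<And>j. t j \<noteq> 0"
        using z_mem unfolding torus_point_phi by blast
      \<comment> \<open>The value of \<open>q j\<close> at a torus point: on a factor where
        \<open>g\<close> is the upper end, the local coordinate is the inverse of
        \<open>t j\<close>.\<close>
      define r where "r j = (if g j = 0 then t j else inverse (t j))" for j
      have 1: "z $ ix \<sigma>0 (g' j) = z $ ix \<sigma>0 g * r j" for j
      proof (cases "g j = 0")
        case True
        then show ?thesis
          unfolding z g'_def r_def using torus_coord_update[OF g_le, of 1 j w t \<sigma>0] l_pos[of j] by simp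
      next
        case False
        then have "g j = l j" using g[of j] by auto
        have "z $ ix \<sigma>0 ((g' j)(j := l j)) = z $ ix \<sigma>0 (g' j) * t j ^ (l j - g' j j)"
          unfolding z using g_le l_pos by (intro torus_coord_update) (auto simp: g'_def Suc_le_eq)
        moreover have "(g' j)(j := l j) = g" using \<open>g j = l j\<close> by (auto simp: g'_def)
        moreover have "l j - g' j j = 1" using False l_pos[of j] by (simp add: g'_def)
        ultimately show ?thesis using False t[of j] by (simp add: r_def)
      qed
      have 2: "z $ ix \<sigma> f = z $ ix \<sigma> g * (\<Prod>j\<in>UNIV. r j ^ N f j)"
      proof -
        have "t j ^ f j = t j ^ g j * r j ^ N f j" for j
        proof (cases "g j = 0")
          case False
          then have "g j = l j" using g[of j] by auto
          have "t j ^ l j = t j ^ f j * t j ^ (l j - f j)" using f by (simp add: power_add[symmetric])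
          then show ?thesis using False \<open>g j = l j\<close> t[of j] by (simp add: r_def N_def power_inverse)
        qed (simp add: r_def N_def)
        then show ?thesis
          unfolding z torus_coord[OF f] torus_coord[OF g_le] by (simp add: prod.distrib mult.assoc)
      qed
      have "(\<Prod>j\<in>UNIV. (z $ ix \<sigma>0 (g' j)) ^ N f j) = (z $ ix \<sigma>0 g) ^ (\<Sum>j\<in>UNIV. N f j) * (\<Prod>j\<in>UNIV. r j ^ N f j)"
        unfolding 1 by (simp add: power_mult_distrib prod.distrib power_sum)
      then show ?thesis unfolding 2 by simp
    qed
    ultimately have "?F y = 0" using y unfolding mem_X_iff by blast
    then show ?thesis by simp
  qed
  let ?w = "\<lambda>\<sigma>. y $ ix \<sigma> g"
  let ?s = "\<lambda>j. if g j = 0 then 1 else q j" and ?t = "\<lambda>j. if g j = 0 then q j else 1"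
  have "y = phi ?w ?s ?t"
  proof (rule vec_eq_iff[THEN iffD2], rule allI)
    fix i
    have "y $ i = y $ ix (sg i) g * ((\<Prod>j\<in>UNIV. (y $ ix \<sigma>0 (g' j)) ^ N (u i) j) / (y $ ix \<sigma>0 g) ^ (\<Sum>j\<in>UNIV. N (u i) j))"
      using rel[of "u i" "sg i"] nz by (simp add: ix_index u_le field_simps)
    also have "(\<Prod>j\<in>UNIV. (y $ ix \<sigma>0 (g' j)) ^ N (u i) j) / (y $ ix \<sigma>0 g) ^ (\<Sum>j\<in>UNIV. N (u i) j) = (\<Prod>j\<in>UNIV. q j ^ N (u i) j)"
      by (simp add: q_def power_divide prod_dividef power_sum)
    also have "\<dots> = (\<Prod>j\<in>UNIV. ?s j ^ (l j - u i j) * ?t j ^ u i j)"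
      by (rule prod.cong) (auto simp: N_def)
    finally show "y $ i = phi ?w ?s ?t $ i" by (simp add: phi_nth)
  qed
  moreover have "valid ?w ?s ?t" unfolding valid_def using nz by auto
  ultimately show thesis using that by blast
qed

text \<open>Parameters of two points are joined by a line, along which each form is a polynomial. A
  third polynomial, for a coordinate nonzero at \<open>x\<close>, keeps the parameters on the line
  valid.\<close>

lemma irreducible_X: "zariski_irreducible X"
proof (rule irreducibleI[OF zero_notin_X])
  have "valid (\<lambda>_. 1) (\<lambda>_. 1) (\<lambda>_. 1)" by (simp add: valid_def)
  then show "X \<noteq> {}" using phi_mem by blast
next
  fix d F d' G x y
  assume F: "form d F" "x \<in> X" "F x \<noteq> 0" and G: "form d' G" "y \<in> X" "G y \<noteq> 0"
  obtain w s t where x: "x = phi w s t" by (rule X_subset_phi[OF F(2)])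
  obtain w' s' t' where y: "y = phi w' s' t'" by (rule X_subset_phi[OF G(2)])
  have "x \<noteq> 0" using F(2) zero_notin_X by auto
  then obtain i where i: "x $ i \<noteq> 0" by (auto simp: vec_eq_iff)
  define z where "z e = phi (\<lambda>\<sigma>. w \<sigma> + e * (w' \<sigma> - w \<sigma>)) (\<lambda>j. s j + e * (s' j - s j)) (\<lambda>j. t j + e * (t' j - t j))" for e
  obtain p where p: "\<And>e. F (z e) = poly p e"
    unfolding z_def by (rule form_phi_line[OF F(1), of w "\<lambda>\<sigma>. w' \<sigma> - w \<sigma>" s "\<lambda>j. s' j - s j" t "\<lambda>j. t' j - t j"]) blast
  obtain p' where p': "\<And>e. G (z e) = poly p' e"
    unfolding z_def by (rule form_phi_line[OF G(1), of w "\<lambda>\<sigma>. w' \<sigma> - w \<sigma>" s "\<lambda>j. s' j - s j" t "\<lambda>j. t' j - t j"]) blast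
  obtain p'' where p'': "\<And>e. z e $ i = poly p'' e"
    unfolding z_def by (rule form_phi_line[OF form_coord[of i], of w "\<lambda>\<sigma>. w' \<sigma> - w \<sigma>" s "\<lambda>j. s' j - s j" t "\<lambda>j. t' j - t j"]) blast
  have z: "z 0 = x" "z 1 = y" by (simp_all add: z_def x y)
  have "poly p 0 \<noteq> 0" "poly p' 1 \<noteq> 0" "poly p'' 0 \<noteq> 0"
    unfolding p[symmetric] p'[symmetric] p''[symmetric] z using F G i by auto
  then have "p * p' * p'' \<noteq> 0" by auto
  then obtain e where e: "poly (p * p' * p'') e \<noteq> 0" using poly_all_0_iff_0[of "p * p' * p''"] by blast
  then have nz: "F (z e) \<noteq> 0" "G (z e) \<noteq> 0" "z e $ i \<noteq> 0" unfolding p p' p'' by auto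
  then have "z e \<noteq> 0" by auto
  then have "z e \<in> X" unfolding z_def by (intro phi_mem) (simp add: phi_eq_0_iff)
  then show "\<exists>z\<in>X. F z \<noteq> 0 \<and> G z \<noteq> 0" using nz by blast
qed

section \<open>The standard chart\<close>

definition C :: "('o + 'm) set" where
  "C = Inl ` (- {o0}) \<union> range Inr"

definition n :: "'i \<Rightarrow> 'o + 'm \<Rightarrow> nat" where
  "n i c = (case c of Inl \<sigma> \<Rightarrow> if sg i = \<sigma> then 1 else 0 | Inr j \<Rightarrow> u i j)"

definition idx :: "'o + 'm \<Rightarrow> 'i" where
  "idx c = (case c of Inl \<sigma> \<Rightarrow> ix \<sigma> (\<lambda>_. 0) | Inr j \<Rightarrow> ix o0 (\<lambda>j'. if j' = j then 1 else 0))"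

abbreviation i0 :: 'i where
  "i0 \<equiv> ix o0 (\<lambda>_. 0)"

lemma n_simps [simp]: "n i (Inl \<sigma>) = (if sg i = \<sigma> then 1 else 0)" "n i (Inr j) = u i j"
  by (simp_all add: n_def)

lemma idx_simps [simp]: "sg (idx (Inl \<sigma>)) = \<sigma>" "u (idx (Inl \<sigma>)) = (\<lambda>_. 0)"
  "sg (idx (Inr j)) = o0" "u (idx (Inr j)) = (\<lambda>j'. if j' = j then 1 else 0)"
  "sg i0 = o0" "u i0 = (\<lambda>_. 0)"
proof -
  have "(if j' = j then 1 else 0) \<le> l j'" for j' using l_pos[of j'] by auto
  then show "sg (idx (Inr j)) = o0" "u (idx (Inr j)) = (\<lambda>j'. if j' = j then 1 else 0)"
    by (simp_all add: idx_def ix)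
qed (simp_all add: idx_def ix)

lemma prod_C: "(\<Prod>c\<in>C. f c) = (\<Prod>\<sigma>\<in>- {o0}. f (Inl \<sigma>)) * (\<Prod>j\<in>UNIV. f (Inr j))"
proof -
  have "(\<Prod>c\<in>C. f c) = (\<Prod>c\<in>Inl ` (- {o0}). f c) * (\<Prod>c\<in>range Inr. f c)"
    unfolding C_def by (rule prod.union_disjoint) auto
  then show ?thesis by (simp add: prod.reindex)
qed

lemma sum_C: "(\<Sum>c\<in>C. f c) = (\<Sum>\<sigma>\<in>- {o0}. f (Inl \<sigma>)) + (\<Sum>j\<in>UNIV. f (Inr j))"
proof -
  have "(\<Sum>c\<in>C. f c) = (\<Sum>c\<in>Inl ` (- {o0}). f c) + (\<Sum>c\<in>range Inr. f c)"
    unfolding C_def by (rule sum.union_disjoint) auto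
  then show ?thesis by (simp add: sum.reindex)
qed

lemma prod_C_powers:
  "(\<Prod>c\<in>C. q c ^ n i c) = (if sg i = o0 then 1 else q (Inl (sg i))) * (\<Prod>j\<in>UNIV. q (Inr j) ^ u i j)"
proof -
  have "(\<Prod>\<sigma>\<in>- {o0}. q (Inl \<sigma>) ^ n i (Inl \<sigma>)) = (\<Prod>\<sigma>\<in>- {o0}. if \<sigma> = sg i then q (Inl \<sigma>) else 1)"
    by (rule prod.cong) auto
  then show ?thesis unfolding prod_C by simp
qed

lemma phi_param:
  "(\<chi> i. \<Prod>c\<in>C. q c ^ n i c) = phi (\<lambda>\<sigma>. if \<sigma> = o0 then 1 else q (Inl \<sigma>)) (\<lambda>_. 1) (\<lambda>j. q (Inr j))"
  unfolding prod_C_powers by (simp add: phi_def)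

end

text \<open>The chart where \<open>w o0\<close> and all \<open>s j\<close> are nonzero, with the
  affine coordinates \<open>w \<sigma> / w o0\<close> and \<open>t j / s j\<close>.\<close>

sublocale segre_veronese \<subseteq> monomial_chart X i0 C n idx
proof
  fix c assume "c \<in> C" then show "n i0 c = 0" by (auto simp: C_def split: if_splits)
next
  fix i i' assume eq: "\<And>c. c \<in> C \<Longrightarrow> n i c = n i' c"
  have "u i = u i'" using eq[of "Inr _"] by (auto simp: C_def)
  moreover have "sg i = sg i'"
  proof (rule ccontr)
    assume "sg i \<noteq> sg i'"
    then show False using eq[of "Inl (sg i)"] eq[of "Inl (sg i')"] by (cases "sg i = o0") (auto simp: C_def)
  qed
  ultimately show "i = i'" by (intro index_eqI)
next
  fix c c' assume "c \<in> C" "c' \<in> C"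
  then show "n (idx c) c' = (if c = c' then 1 else 0)" by (auto simp: C_def split: if_splits)
next
  fix y i assume y: "y \<in> X" "y $ i0 \<noteq> 0"
  obtain w s t where v: "valid w s t" and p: "y = phi w s t" by (rule X_subset_phi[OF y(1)])
  have w: "w o0 \<noteq> 0" and s: "s j \<noteq> 0" for j using y(2) l_pos[of j] by (auto simp: p phi_nth)
  have ratio: "y $ i / y $ i0 = w (sg i) / w o0 * (\<Prod>j\<in>UNIV. (t j / s j) ^ u i j)" for i
  proof -
    have "(\<Prod>j\<in>UNIV. s j ^ (l j - u i j) * t j ^ u i j) = (\<Prod>j\<in>UNIV. s j ^ l j) * (\<Prod>j\<in>UNIV. (t j / s j) ^ u i j)"
      unfolding prod.distrib[symmetric]
      by (rule prod.cong) (auto simp: power_divide power_diff s u_le)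
    then have "y $ i = w (sg i) * ((\<Prod>j\<in>UNIV. s j ^ l j) * (\<Prod>j\<in>UNIV. (t j / s j) ^ u i j))"
      by (simp add: p phi_nth)
    moreover have "y $ i0 = w o0 * (\<Prod>j\<in>UNIV. s j ^ l j)" by (simp add: p phi_nth)
    moreover have "(\<Prod>j\<in>UNIV. s j ^ l j) \<noteq> 0" unfolding prod_zero_iff[OF finite] using s by auto
    moreover have "W * (A * B) / (V * A) = W / V * B" if "A \<noteq> 0" for W V A B :: 'k
      using that by simp
    ultimately show ?thesis by metis
  qed
  have "y $ idx (Inl \<sigma>) / y $ i0 = w \<sigma> / w o0" for \<sigma> unfolding ratio by simp
  moreover have "y $ idx (Inr j) / y $ i0 = t j / s j" for j
  proof -
    have "(\<Prod>j'\<in>UNIV. (t j' / s j') ^ (if j' = j then 1 else 0)) = (\<Prod>j'\<in>UNIV. if j' = j then t j / s j else 1)"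
      by (rule prod.cong) auto
    then show ?thesis unfolding ratio using w by simp
  qed
  ultimately show "y $ i / y $ i0 = (\<Prod>c\<in>C. (y $ idx c / y $ i0) ^ n i c)"
    unfolding prod_C_powers ratio[of i] using w by simp
next
  fix q show "(\<chi> i. \<Prod>c\<in>C. q c ^ n i c) \<in> X"
    unfolding phi_param by (rule phi_mem) (auto simp: valid_def)
qed (rule zero_notin_X irreducible_X)+

section \<open>Homogeneity under linear coordinate changes\<close>

lemma binary_form_mult:
  fixes c :: "nat \<Rightarrow> 'k::field"
  shows "\<exists>c'. \<forall>s t. (p * s + q * t) * (\<Sum>k\<le>m. c k * s ^ (m - k) * t ^ k)
    = (\<Sum>k\<le>Suc m. c' k * s ^ (Suc m - k) * t ^ k)"
proof (intro exI allI)
  let ?c' = "\<lambda>k. (if k \<le> m then p * c k else 0) + (if k = 0 then 0 else q * c (k - 1))"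
  fix s t
  have "(\<Sum>k\<le>Suc m. (if k \<le> m then p * c k else 0) * s ^ (Suc m - k) * t ^ k)
      = (\<Sum>k\<le>m. p * s * (c k * s ^ (m - k) * t ^ k))"
    by (simp add: Suc_diff_le mult_ac)
  moreover have "(\<Sum>k\<le>Suc m. (if k = 0 then 0 else q * c (k - 1)) * s ^ (Suc m - k) * t ^ k)
      = (\<Sum>k\<le>m. q * t * (c k * s ^ (m - k) * t ^ k))"
    unfolding sum.atMost_Suc_shift by (simp add: mult_ac)
  ultimately show "(p * s + q * t) * (\<Sum>k\<le>m. c k * s ^ (m - k) * t ^ k)
      = (\<Sum>k\<le>Suc m. ?c' k * s ^ (Suc m - k) * t ^ k)"
    by (simp only: distrib_right sum.distrib sum_distrib_left)
qed

lemma binary_form_product: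
  fixes p q r v :: "'k::field"
  shows "\<exists>c. \<forall>s t. (p * s + q * t) ^ a * (r * s + v * t) ^ b = (\<Sum>k\<le>a + b. c k * s ^ (a + b - k) * t ^ k)"
proof (induction a)
  case 0
  show ?case
  proof (induction b)
    case 0
    show ?case by (intro exI[of _ "\<lambda>_. 1"]) simp
  next
    case (Suc b)
    then obtain c where c: "\<And>s t. (r * s + v * t) ^ b = (\<Sum>k\<le>b. c k * s ^ (b - k) * t ^ k)" by auto
    obtain c' where "\<And>s t. (r * s + v * t) * (\<Sum>k\<le>b. c k * s ^ (b - k) * t ^ k)
      = (\<Sum>k\<le>Suc b. c' k * s ^ (Suc b - k) * t ^ k)" using binary_form_mult[where p = r and q = v and m = b and c = c] by blast
    then show ?case by (intro exI[of _ c'] allI) (simp only: power_0 mult_1_left add_0_left power_Suc c)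
  qed
next
  case (Suc a)
  then obtain c where c: "\<And>s t. (p * s + q * t) ^ a * (r * s + v * t) ^ b = (\<Sum>k\<le>a + b. c k * s ^ (a + b - k) * t ^ k)"
    by blast
  obtain c' where "\<And>s t. (p * s + q * t) * (\<Sum>k\<le>a + b. c k * s ^ (a + b - k) * t ^ k)
    = (\<Sum>k\<le>Suc (a + b). c' k * s ^ (Suc (a + b) - k) * t ^ k)" using binary_form_mult[where p = p and q = q and m = "a + b" and c = c] by blast
  then show ?case by (intro exI[of _ c'] allI) (simp only: add_Suc power_Suc mult.assoc c)
qed

text \<open>\<open>w0\<close> is completed to a basis by all unit vectors except the one at
  \<open>\<sigma>1\<close>, where \<open>w0\<close> is nonzero. The transposition only serves to put
  \<open>w0\<close> into column \<open>o0\<close>.\<close>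

lemma matrix_moving_axis:
  fixes w0 :: "'o::finite \<Rightarrow> 'k::field"
  assumes "w0 \<sigma>1 \<noteq> 0"
  obtains A A' :: "'k ^ 'o ^ 'o" where "A ** A' = mat 1" "A' ** A = mat 1" "\<And>\<sigma>. A $ \<sigma> $ o0 = w0 \<sigma>"
proof -
  define \<pi> where "\<pi> = Transposition.transpose o0 \<sigma>1"
  define A :: "'k ^ 'o ^ 'o" where
    "A = (\<chi> \<sigma>. \<chi> \<tau>. if \<tau> = o0 then w0 \<sigma> else if \<tau> = \<pi> \<sigma> then 1 else 0)"
  have \<pi>: "\<pi> (\<pi> \<sigma>) = \<sigma>" "\<pi> \<sigma>1 = o0" for \<sigma> by (simp_all add: \<pi>_def)
  have A: "(A *v x) $ \<sigma> = w0 \<sigma> * x $ o0 + (if \<pi> \<sigma> = o0 then 0 else x $ \<pi> \<sigma>)" for x \<sigma>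
  proof -
    have "(A *v x) $ \<sigma> = (\<Sum>\<tau>\<in>UNIV. (if \<tau> = o0 then w0 \<sigma> * x $ o0 else 0)
        + (if \<tau> = \<pi> \<sigma> then if \<pi> \<sigma> = o0 then 0 else x $ \<pi> \<sigma> else 0))"
      unfolding A_def matrix_vector_mult_def vec_lambda_beta by (rule sum.cong) auto
    then show ?thesis by (simp add: sum.distrib)
  qed
  have "x = 0" if "A *v x = 0" for x
  proof -
    have 0: "w0 \<sigma> * x $ o0 + (if \<pi> \<sigma> = o0 then 0 else x $ \<pi> \<sigma>) = 0" for \<sigma>
      unfolding A[symmetric] that by simp
    have o0: "x $ o0 = 0" using 0[of \<sigma>1] assms by (simp add: \<pi>)
    have "x $ \<tau> = 0" for \<tau> using 0[of "\<pi> \<tau>"] o0 by (cases "\<tau> = o0") (auto simp: \<pi>)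
    then show ?thesis by (simp add: vec_eq_iff)
  qed
  then have "\<exists>A'. A' ** A = mat 1" unfolding matrix_left_invertible_ker by simp
  then obtain A' where "A' ** A = mat 1" ..
  moreover then have "A ** A' = mat 1" by (simp add: matrix_left_right_inverse)
  moreover have "A $ \<sigma> $ o0 = w0 \<sigma>" for \<sigma> by (simp add: A_def)
  ultimately show thesis using that by blast
qed

context segre_veronese
begin

text \<open>Coefficients that factor over the projective space and the lines give a product of a
  linear form and binary forms. The group action and the binomial diagonal matrix are both
  instances.\<close>

lemma lin_phi_expand:
  "lin (\<chi> i. \<omega> (sg i) * (\<Prod>j\<in>UNIV. c j (u i j))) (phi w s t)
    = (\<Sum>\<sigma>\<in>UNIV. \<omega> \<sigma> * w \<sigma>) * (\<Prod>j\<in>UNIV. \<Sum>k\<le>l j. c j k * s j ^ (l j - k) * t j ^ k)"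
proof -
  let ?G = "\<lambda>j k. c j k * s j ^ (l j - k) * t j ^ k"
  have "lin (\<chi> i. \<omega> (sg i) * (\<Prod>j\<in>UNIV. c j (u i j))) (phi w s t)
      = (\<Sum>i\<in>UNIV. (\<lambda>x. \<omega> (fst x) * w (fst x) * (\<Prod>j\<in>UNIV. ?G j (snd x j))) (sg i, u i))"
    unfolding lin_def by (rule sum.cong) (auto simp: phi_nth prod.distrib mult_ac)
  also have "\<dots> = (\<Sum>x\<in>UNIV \<times> {f. \<forall>j. f j \<le> l j}. \<omega> (fst x) * w (fst x) * (\<Prod>j\<in>UNIV. ?G j (snd x j)))"
    by (rule sum.reindex_bij_betw[OF bij_index])
  also have "\<dots> = (\<Sum>\<sigma>\<in>UNIV. \<omega> \<sigma> * w \<sigma>) * (\<Sum>f\<in>{f. \<forall>j. f j \<le> l j}. \<Prod>j\<in>UNIV. ?G j (f j))"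
    unfolding sum_product sum.cartesian_product by (rule sum.cong) auto
  also have "{f. \<forall>j. f j \<le> l j} = (\<Pi>\<^sub>E j\<in>UNIV. {..l j})" by (auto simp: PiE_iff)
  also have "(\<Sum>f\<in>(\<Pi>\<^sub>E j\<in>UNIV. {..l j}). \<Prod>j\<in>UNIV. ?G j (f j)) = (\<Prod>j\<in>UNIV. \<Sum>k\<le>l j. ?G j k)"
    by (rule prod_sum_PiE[symmetric]) auto
  finally show ?thesis .
qed

text \<open>\<open>X\<close> is nondegenerate. Vectors and matrices are therefore compared below by
  their effect on the points \<open>phi w s t\<close> only.\<close>

lemma lin_phi_zero:
  assumes "\<And>w s t. lin h (phi w s t) = 0" shows "h = 0"
proof (rule vec_eq_iff[THEN iffD2], rule allI)
  fix i
  have "(\<Sum>i\<in>UNIV. h $ i * (\<Prod>c\<in>C. q c ^ n i c)) = 0" for q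
    using assms[of "\<lambda>\<sigma>. if \<sigma> = o0 then 1 else q (Inl \<sigma>)" "\<lambda>_. 1" "\<lambda>j. q (Inr j)"]
    unfolding phi_param[symmetric] by (simp add: lin_def)
  from multivariate_zero[where n = n and h = "\<lambda>i. h $ i" and I = UNIV, OF finite_C _ _ this]
  show "h $ i = 0 $ i" using n_inj by simp
qed

lemma lin_diff: "lin (h - h') y = lin h y - lin h' y"
  by (simp add: lin_def left_diff_distrib sum_subtractf)

lemma lin_phi_eqI:
  assumes "\<And>w s t. lin h (phi w s t) = lin h' (phi w s t)" shows "h = h'"
  using lin_phi_zero[of "h - h'"] assms by (simp add: lin_diff)

definition act :: "'k ^ 'o ^ 'o \<Rightarrow> ('o \<Rightarrow> 'k) \<Rightarrow> 'o \<Rightarrow> 'k" where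
  "act A w \<sigma> = (\<Sum>\<tau>\<in>UNIV. A $ \<sigma> $ \<tau> * w \<tau>)"

lemma act_act: "A ** A' = mat 1 \<Longrightarrow> act A (act A' w) = w"
proof
  fix \<sigma> assume AA: "A ** A' = mat 1"
  have "act A (act A' w) \<sigma> = (A *v (A' *v (\<chi> \<tau>. w \<tau>))) $ \<sigma>"
    by (simp add: act_def matrix_vector_mult_def)
  then show "act A (act A' w) \<sigma> = w \<sigma>" by (simp add: matrix_vector_mul_assoc AA)
qed

text \<open>Multihomogeneous polynomials of the given type are stable under linear substitutions;
  the rows of \<open>L\<close> are the coefficients of the transformed monomials.\<close>

lemma matrix_on_phi:
  fixes A :: "'k ^ 'o ^ 'o" and p q r v :: "'m \<Rightarrow> 'k"
  obtains L where "\<And>w s t. L *v phi w s t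
    = phi (act A w) (\<lambda>j. p j * s j + q j * t j) (\<lambda>j. r j * s j + v j * t j)"
proof -
  have "\<forall>i j. \<exists>c. \<forall>s t. (p j * s + q j * t) ^ (l j - u i j) * (r j * s + v j * t) ^ u i j
      = (\<Sum>k\<le>l j. c k * s ^ (l j - k) * t ^ k)"
  proof (intro allI)
    fix i j
    show "\<exists>c. \<forall>s t. (p j * s + q j * t) ^ (l j - u i j) * (r j * s + v j * t) ^ u i j
      = (\<Sum>k\<le>l j. c k * s ^ (l j - k) * t ^ k)"
      using binary_form_product[of "p j" "q j" "l j - u i j" "r j" "v j" "u i j"] u_le[of i j] by simp
  qed
  then obtain c where c: "\<And>i j s t. (p j * s + q j * t) ^ (l j - u i j) * (r j * s + v j * t) ^ u i j
      = (\<Sum>k\<le>l j. c i j k * s ^ (l j - k) * t ^ k)" by metis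
  define L :: "'k ^ 'i ^ 'i" where "L = (\<chi> i. \<chi> i'. A $ sg i $ sg i' * (\<Prod>j\<in>UNIV. c i j (u i' j)))"
  have "L *v phi w s t = phi (act A w) (\<lambda>j. p j * s j + q j * t j) (\<lambda>j. r j * s j + v j * t j)" for w s t
  proof (rule vec_eq_iff[THEN iffD2], rule allI)
    fix i
    have "(L *v phi w s t) $ i = lin (\<chi> i'. A $ sg i $ sg i' * (\<Prod>j\<in>UNIV. c i j (u i' j))) (phi w s t)"
      by (simp add: L_def matrix_vector_mult_def lin_def)
    also have "\<dots> = phi (act A w) (\<lambda>j. p j * s j + q j * t j) (\<lambda>j. r j * s j + v j * t j) $ i"
      unfolding lin_phi_expand c[symmetric] by (simp add: phi_nth act_def)
    finally show "(L *v phi w s t) $ i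
      = phi (act A w) (\<lambda>j. p j * s j + q j * t j) (\<lambda>j. r j * s j + v j * t j) $ i" .
  qed
  then show thesis using that by blast
qed

lemma matrix_identity_on_phi:
  assumes "\<And>w s t. N *v phi w s t = phi w s t" shows "N = mat 1"
proof -
  have "N $ i = axis i 1" for i
  proof (rule lin_phi_eqI)
    fix w s t
    have "lin (N $ i) (phi w s t) = (N *v phi w s t) $ i" by (simp add: lin_def matrix_vector_mult_def)
    then show "lin (N $ i) (phi w s t) = lin (axis i 1) (phi w s t)" by (simp add: assms lin_axis)
  qed
  then show ?thesis by (simp add: vec_eq_iff mat_def axis_def)
qed

lemma linear_aut_action:
  assumes AA: "A ** A' = mat 1" "A' ** A = mat 1" and det: "\<And>j. p j * v j - q j * r j \<noteq> 0"
  obtains L L' p' q' r' v' where "linear_aut X L L'"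
    "\<And>w s t. L *v phi w s t = phi (act A w) (\<lambda>j. p j * s j + q j * t j) (\<lambda>j. r j * s j + v j * t j)"
    "\<And>w s t. L' *v phi w s t = phi (act A' w) (\<lambda>j. p' j * s j + q' j * t j) (\<lambda>j. r' j * s j + v' j * t j)"
proof -
  define d where "d j = p j * v j - q j * r j" for j
  have d: "d j \<noteq> 0" for j using det by (simp add: d_def)
  let ?p = "\<lambda>j. v j / d j" and ?q = "\<lambda>j. - q j / d j" and ?r = "\<lambda>j. - r j / d j" and ?v = "\<lambda>j. p j / d j"
  obtain L where L: "\<And>w s t. L *v phi w s t
      = phi (act A w) (\<lambda>j. p j * s j + q j * t j) (\<lambda>j. r j * s j + v j * t j)"
    by (rule matrix_on_phi[of A p q r v]) blast
  obtain L' where L': "\<And>w s t. L' *v phi w s t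
      = phi (act A' w) (\<lambda>j. ?p j * s j + ?q j * t j) (\<lambda>j. ?r j * s j + ?v j * t j)"
    by (rule matrix_on_phi[of A' ?p ?q ?r ?v]) blast
  have inv1: "?p j * (p j * x + q j * y) + ?q j * (r j * x + v j * y) = x"
    "?r j * (p j * x + q j * y) + ?v j * (r j * x + v j * y) = y" for j x y
  proof -
    have "?p j * (p j * x + q j * y) + ?q j * (r j * x + v j * y) = d j * x / d j"
      by (simp add: d_def algebra_simps add_divide_distrib diff_divide_distrib)
    then show "?p j * (p j * x + q j * y) + ?q j * (r j * x + v j * y) = x" using d by simp
    have "?r j * (p j * x + q j * y) + ?v j * (r j * x + v j * y) = d j * y / d j"
      by (simp add: d_def algebra_simps add_divide_distrib diff_divide_distrib)
    then show "?r j * (p j * x + q j * y) + ?v j * (r j * x + v j * y) = y" using d by simp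
  qed
  have inv2: "p j * (?p j * x + ?q j * y) + q j * (?r j * x + ?v j * y) = x"
    "r j * (?p j * x + ?q j * y) + v j * (?r j * x + ?v j * y) = y" for j x y
  proof -
    have "p j * (?p j * x + ?q j * y) + q j * (?r j * x + ?v j * y) = d j * x / d j"
      by (simp add: d_def algebra_simps add_divide_distrib diff_divide_distrib)
    then show "p j * (?p j * x + ?q j * y) + q j * (?r j * x + ?v j * y) = x" using d by simp
    have "r j * (?p j * x + ?q j * y) + v j * (?r j * x + ?v j * y) = d j * y / d j"
      by (simp add: d_def algebra_simps add_divide_distrib diff_divide_distrib)
    then show "r j * (?p j * x + ?q j * y) + v j * (?r j * x + ?v j * y) = y" using d by simp
  qed
  have "L' *v (L *v phi w s t) = phi w s t" for w s t
    unfolding L L' inv1 act_act[OF AA(2)] ..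
  then have 1: "L' ** L = mat 1" by (intro matrix_identity_on_phi) (simp add: matrix_vector_mul_assoc)
  have "L *v (L' *v phi w s t) = phi w s t" for w s t
    unfolding L L' inv2 act_act[OF AA(1)] ..
  then have 2: "L ** L' = mat 1" by (intro matrix_identity_on_phi) (simp add: matrix_vector_mul_assoc)
  have "L *v y \<in> X" if y: "y \<in> X" for y
  proof -
    obtain w s t where "y = phi w s t" by (rule X_subset_phi[OF y])
    \<comment> \<open>Invertibility of \<open>L\<close> replaces a check that the transformed
      parameters are valid, by \<open>phi_eq_0_iff\<close>.\<close>
    moreover have "L *v y \<noteq> 0"
    proof
      assume "L *v y = 0"
      then have "L' *v (L *v y) = 0" by simp
      then show False using y zero_notin_X by (simp add: matrix_vector_mul_assoc 1)
    qed
    ultimately show ?thesis by (simp add: L phi_eq_0_iff phi_mem)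
  qed
  moreover have "L' *v y \<in> X" if y: "y \<in> X" for y
  proof -
    obtain w s t where "y = phi w s t" by (rule X_subset_phi[OF y])
    moreover have "L' *v y \<noteq> 0"
    proof
      assume "L' *v y = 0"
      then have "L *v (L' *v y) = 0" by simp
      then show False using y zero_notin_X by (simp add: matrix_vector_mul_assoc 2)
    qed
    ultimately show ?thesis unfolding \<open>y = _\<close> L' phi_eq_0_iff by (intro phi_mem) simp
  qed
  ultimately have "linear_aut X L L'" unfolding linear_aut_def using 1 2 by blast
  then show thesis by (rule that[OF _ L L'])
qed

lemma origin_phi: "axis i0 1 = phi (\<lambda>\<sigma>. if \<sigma> = o0 then 1 else 0) (\<lambda>_. 1) (\<lambda>_. 0)"
  using param_0 phi_param[of "\<lambda>_. 0"] by (simp add: param_def)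

text \<open>The formulas for \<open>L\<close> and its inverse on all parameters are kept in the
  conclusion, because \<open>dual_points\<close> has to know what becomes of a linear form, not only
  of the point.\<close>

lemma homogeneous:
  assumes v: "valid w0 s0 t0"
  obtains L L' A A' q v p' q' r' v' where "linear_aut X L L'" "L *v axis i0 1 = phi w0 s0 t0"
    "\<And>\<sigma>. A $ \<sigma> $ o0 = w0 \<sigma>"
    "\<And>w s t. L *v phi w s t = phi (act A w) (\<lambda>j. s0 j * s j + q j * t j) (\<lambda>j. t0 j * s j + v j * t j)"
    "\<And>w s t. L' *v phi w s t = phi (act A' w) (\<lambda>j. p' j * s j + q' j * t j) (\<lambda>j. r' j * s j + v' j * t j)"
proof -
  obtain \<sigma>1 where "w0 \<sigma>1 \<noteq> 0" using v unfolding valid_def by blast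
  then obtain A A' :: "'k ^ 'o ^ 'o" where A: "A ** A' = mat 1" "A' ** A = mat 1" "\<And>\<sigma>. A $ \<sigma> $ o0 = w0 \<sigma>"
    by (rule matrix_moving_axis) blast
  \<comment> \<open>A second column completing \<open>(s0 j, t0 j)\<close> to an invertible
    matrix.\<close>
  let ?q = "\<lambda>j. if s0 j = 0 then 1 else 0 :: 'k" and ?v = "\<lambda>j. if s0 j = 0 then 0 else 1 :: 'k"
  have "s0 j * ?v j - ?q j * t0 j \<noteq> 0" for j using v by (auto simp: valid_def)
  then obtain L L' p' q' r' v' where L: "linear_aut X L L'"
    "\<And>w s t. L *v phi w s t = phi (act A w) (\<lambda>j. s0 j * s j + ?q j * t j) (\<lambda>j. t0 j * s j + ?v j * t j)"
    "\<And>w s t. L' *v phi w s t = phi (act A' w) (\<lambda>j. p' j * s j + q' j * t j) (\<lambda>j. r' j * s j + v' j * t j)"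
    by (rule linear_aut_action[OF A(1,2)]) (rule that)
  have "act A (\<lambda>\<sigma>. if \<sigma> = o0 then 1 else 0) = w0"
    by (rule ext) (simp add: act_def A(3) if_distrib[of "\<lambda>x. _ * x"] cong: if_cong)
  then have "L *v axis i0 1 = phi w0 s0 t0" unfolding origin_phi L(2) by simp
  from that[OF L(1) this A(3) L(2,3)] show thesis .
qed

lemma homogeneous_origin:
  assumes "x \<in> X" obtains L L' where "linear_aut X L L'" "x = L *v axis i0 1"
proof -
  obtain w s t where v: "valid w s t" and x: "x = phi w s t" by (rule X_subset_phi[OF assms])
  obtain L L' where "linear_aut X L L'" "L *v axis i0 1 = phi w s t"
    by (rule homogeneous[OF v]) (rule that)
  then show thesis using that x by simp
qed

lemma smooth_X:
  assumes "x \<in> X" shows "smooth_at X x"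
proof -
  obtain L L' where L: "linear_aut X L L'" and x: "x = L *v axis i0 1" by (rule homogeneous_origin[OF assms])
  show ?thesis unfolding x by (rule smooth_at_linear_aut[OF L zero_notin_X smooth_origin])
qed

lemma smooth_variety_X: "smooth_variety X"
  unfolding smooth_variety_def using irreducible_X closed_X smooth_X by blast

lemma equivariant_toric_X: "equivariant_toric X"
proof (rule equivariant_toricI[OF closed_X])
  fix \<tau> :: "'o + 'm \<Rightarrow> 'k" and y assume \<tau>: "\<forall>c. \<tau> c \<noteq> 0" and y: "y \<in> X"
  obtain w s t where v: "valid w s t" and p: "y = phi w s t" by (rule X_subset_phi[OF y])
  let ?w = "\<lambda>\<sigma>. (if \<sigma> = o0 then 1 else \<tau> (Inl \<sigma>)) * w \<sigma>" and ?t = "\<lambda>j. \<tau> (Inr j) * t j"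
  have "(\<chi> i. (\<Prod>c\<in>C. \<tau> c ^ n i c) * y $ i) = phi ?w s ?t"
    unfolding prod_C_powers p by (simp add: vec_eq_iff phi_nth power_mult_distrib prod.distrib mult_ac)
  moreover have "valid ?w s ?t" using v \<tau> by (auto simp: valid_def)
  ultimately show "(\<chi> i. (\<Prod>c\<in>C. \<tau> c ^ n i c) * y $ i) \<in> X" using phi_mem by simp
qed

section \<open>The dual variety\<close>

text \<open>By homogeneity all points are smooth with the same jet rank, so \<open>X\<close> itself
  is one of the open sets in the union.\<close>

lemma const_rank_locus_X: "const_rank_locus p X = X"
proof
  show "const_rank_locus p X \<subseteq> X"
    unfolding const_rank_locus_def dense_open_def using openin_subset by fastforce
  have "jet_rank p X x = jet_rank p X (axis i0 1)" if x: "x \<in> X" for x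
  proof -
    obtain L L' where L: "linear_aut X L L'" and xL: "x = L *v axis i0 1" by (rule homogeneous_origin[OF x])
    show ?thesis unfolding xL by (rule jet_rank_linear_aut[OF L zero_notin_X origin_mem])
  qed
  moreover have "dense_open X X"
    using dense_open_nonvanishing[OF zero_notin_X irreducible_X form_const[of 1] origin_mem] by simp
  ultimately show "X \<subseteq> const_rank_locus p X"
    unfolding const_rank_locus_def using smooth_X by blast
qed

text \<open>A hyperplane through the osculating space must be shown to have its equation in the
  kernel. This is known at the origin, where the kernel is a coordinate subspace, and is transported
  from there.\<close>

lemma osculating_subset_hyperplane_iff:
  assumes x: "x \<in> X"
  shows "osculating_space p X x \<subseteq> hyperplane h \<longleftrightarrow> h \<in> jet_kernel p X x"
proof
  assume "h \<in> jet_kernel p X x"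
  then show "osculating_space p X x \<subseteq> hyperplane h"
    unfolding osculating_space_def hyperplane_def by blast
next
  assume sub: "osculating_space p X x \<subseteq> hyperplane h"
  obtain L L' where L: "linear_aut X L L'" and xL: "x = L *v axis i0 1" by (rule homogeneous_origin[OF x])
  have "osculating_space p X (axis i0 1) \<subseteq> hyperplane (Finite_Cartesian_Product.transpose L *v h)"
  proof
    fix y assume y: "y \<in> osculating_space p X (axis i0 1)"
    then have "y \<noteq> 0" by (simp add: osculating_space_def)
    have "L *v y \<noteq> 0" using linear_aut_inverse(2)[OF L, of y] \<open>y \<noteq> 0\<close> by (metis matrix_vector_mult_0_right)
    moreover have "lin h' (L *v y) = 0" if "h' \<in> jet_kernel p X x" for h'
      using that y unfolding xL jet_kernel_linear_aut[OF L zero_notin_X origin_mem] lin_matrix osculating_space_def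
      by blast
    ultimately have "L *v y \<in> osculating_space p X x" unfolding osculating_space_def by blast
    then have "lin h (L *v y) = 0" using sub by (auto simp: hyperplane_def)
    then show "y \<in> hyperplane (Finite_Cartesian_Product.transpose L *v h)"
      unfolding lin_matrix hyperplane_def using \<open>y \<noteq> 0\<close> by blast
  qed
  from osculating_origin[OF this] show "h \<in> jet_kernel p X x"
    unfolding xL jet_kernel_linear_aut[OF L zero_notin_X origin_mem] .
qed

definition dual_matrix :: "'k ^ 'i ^ 'i" where
  "dual_matrix = (\<chi> i. \<chi> i'. if i = i' then (\<Prod>j\<in>UNIV. of_nat (l j choose u i j)) else 0)"

lemma dual_matrix_nth: "(dual_matrix *v y) $ i = (\<Prod>j\<in>UNIV. of_nat (l j choose u i j)) * y $ i"
proof -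
  have "(dual_matrix *v y) $ i
      = (\<Sum>i'\<in>UNIV. if i = i' then (\<Prod>j\<in>UNIV. of_nat (l j choose u i j)) * y $ i else 0)"
    unfolding dual_matrix_def matrix_vector_mult_def vec_lambda_beta by (rule sum.cong) auto
  then show ?thesis by simp
qed

lemma lin_dual_matrix_phi:
  "lin (dual_matrix *v phi \<omega> \<alpha> \<beta>) (phi w s t)
    = (\<Sum>\<sigma>\<in>UNIV. \<omega> \<sigma> * w \<sigma>) * (\<Prod>j\<in>UNIV. (\<alpha> j * s j + \<beta> j * t j) ^ l j)"
proof -
  let ?c = "\<lambda>j k. of_nat (l j choose k) * \<alpha> j ^ (l j - k) * \<beta> j ^ k"
  have "dual_matrix *v phi \<omega> \<alpha> \<beta> = (\<chi> i. \<omega> (sg i) * (\<Prod>j\<in>UNIV. ?c j (u i j)))"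
    by (rule vec_eq_iff[THEN iffD2]) (simp add: dual_matrix_nth phi_nth prod.distrib mult_ac)
  moreover have "(\<Sum>k\<le>l j. ?c j k * s j ^ (l j - k) * t j ^ k) = (\<alpha> j * s j + \<beta> j * t j) ^ l j" for j
    by (subst add.commute, subst binomial_ring) (simp add: power_mult_distrib mult_ac)
  ultimately show ?thesis using lin_phi_expand[of \<omega> ?c w s t] by simp
qed

lemma binomials_nonzero: "(\<Prod>j\<in>UNIV. of_nat (l j choose u i j)) \<noteq> (0 :: 'k)"
  using u_le[of i] by (simp add: not_less[symmetric])

lemma dual_matrix_eq_0_iff: "dual_matrix *v y = 0 \<longleftrightarrow> y = 0"
  using binomials_nonzero by (simp add: vec_eq_iff dual_matrix_nth)

text \<open>
  At the origin of the chart the kernel of the \<open>p\<close>-jets consists of the forms with exponents of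
  degree larger than \<open>p\<close>. Here \<open>p\<close> is so large that the only such forms are
  \<open>\<omega>(w) \<Prod>\<^sub>j t\<^sub>j\<^bsup>l j\<^esup>\<close>.
\<close>

lemma dual_points:
  assumes top: "\<And>i. deg i > p \<Longrightarrow> u i = l"
    and top_index: "\<And>\<sigma>. \<sigma> \<noteq> o0 \<Longrightarrow> deg (ix \<sigma> l) > p"
    and point: "\<And>\<omega> :: 'o \<Rightarrow> 'k. \<exists>w0 \<sigma>. w0 \<sigma> \<noteq> (0 :: 'k) \<and> (deg (ix o0 l) \<le> p \<longrightarrow> (\<Sum>\<sigma>\<in>UNIV. \<omega> \<sigma> * w0 \<sigma>) = 0)"
  shows "{h. h \<noteq> 0 \<and> (\<exists>x\<in>X. h \<in> jet_kernel p X x)} = (*v) dual_matrix ` X"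
proof (intro set_eqI iffI)
  fix h assume "h \<in> {h. h \<noteq> 0 \<and> (\<exists>x\<in>X. h \<in> jet_kernel p X x)}"
  then obtain x where h: "h \<noteq> 0" "x \<in> X" "h \<in> jet_kernel p X x" by blast
  obtain w0 s0 t0 where valid0: "valid w0 s0 t0" and x: "x = phi w0 s0 t0" by (rule X_subset_phi[OF h(2)])
  obtain L L' A' p' q' r' v' where L: "linear_aut X L L'" "L *v axis i0 1 = phi w0 s0 t0"
    "\<And>w s t. L' *v phi w s t = phi (act A' w) (\<lambda>j. p' j * s j + q' j * t j) (\<lambda>j. r' j * s j + v' j * t j)"
    by (rule homogeneous[OF valid0]) (rule that)
  define h' where "h' = Finite_Cartesian_Product.transpose L *v h"
  have "h' \<in> jet_kernel p X (axis i0 1)"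
    using h(3) unfolding x L(2)[symmetric] jet_kernel_linear_aut[OF L(1) zero_notin_X origin_mem] h'_def .
  then have h'_low: "h' $ i = 0" if "deg i \<le> p" for i using that by (simp add: jet_kernel_origin)
  define \<omega> where "\<omega> \<sigma> = h' $ ix \<sigma> l" for \<sigma>
  \<comment> \<open>With all first parameters 0, the factor \<open>0 ^ (l j - u i j)\<close> leaves
    only coordinates with \<open>u i = l\<close>, where the binomial coefficients are 1.\<close>
  have h'_eq: "h' = dual_matrix *v phi \<omega> (\<lambda>_. 0) (\<lambda>_. 1)"
  proof (rule vec_eq_iff[THEN iffD2], rule allI)
    fix i show "h' $ i = (dual_matrix *v phi \<omega> (\<lambda>_. 0) (\<lambda>_. 1)) $ i"
    proof (cases "u i = l")
      case True
      then have "ix (sg i) l = i" using ix_index[of i] by simp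
      then show ?thesis using True by (simp add: dual_matrix_nth phi_nth \<omega>_def)
    next
      case False
      then obtain j where "u i j \<noteq> l j" by auto
      then have "u i j < l j" using u_le[of i j] by simp
      then have "(\<Prod>j\<in>UNIV. 0 ^ (l j - u i j) * 1 ^ u i j) = (0 :: 'k)" by (intro prod_zero) auto
      moreover have "deg i \<le> p" using top[of i] False by (meson not_less)
      ultimately show ?thesis using h'_low by (simp only: dual_matrix_nth phi_nth mult_zero_right)
    qed
  qed
  \<comment> \<open>The linear form \<open>\<omega>\<close> composed with \<open>A'\<close>, which
    brings \<open>h'\<close> back to \<open>h\<close>.\<close>
  define \<omega>' where "\<omega>' \<tau> = (\<Sum>\<sigma>\<in>UNIV. \<omega> \<sigma> * A' $ \<sigma> $ \<tau>)" for \<tau>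
  have "h = dual_matrix *v phi \<omega>' r' v'"
  proof (rule lin_phi_eqI)
    fix w s t
    have "lin h (phi w s t) = lin h (L *v (L' *v phi w s t))" by (simp only: linear_aut_inverse[OF L(1)])
    also have "\<dots> = lin h' (L' *v phi w s t)" by (simp only: lin_matrix h'_def)
    also have "\<dots> = (\<Sum>\<sigma>\<in>UNIV. \<omega> \<sigma> * act A' w \<sigma>) * (\<Prod>j\<in>UNIV. (r' j * s j + v' j * t j) ^ l j)"
      unfolding L(3) h'_eq lin_dual_matrix_phi by simp
    also have "(\<Sum>\<sigma>\<in>UNIV. \<omega> \<sigma> * act A' w \<sigma>) = (\<Sum>\<tau>\<in>UNIV. \<omega>' \<tau> * w \<tau>)"
      unfolding act_def \<omega>'_def sum_distrib_left sum_distrib_right by (subst sum.swap) (simp add: mult.assoc)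
    finally show "lin h (phi w s t) = lin (dual_matrix *v phi \<omega>' r' v') (phi w s t)"
      by (simp only: lin_dual_matrix_phi)
  qed
  moreover then have "phi \<omega>' r' v' \<noteq> 0" using h(1) by (auto simp: dual_matrix_eq_0_iff)
  then have "phi \<omega>' r' v' \<in> X" by (intro phi_mem) (simp add: phi_eq_0_iff)
  ultimately show "h \<in> (*v) dual_matrix ` X" by blast
next
  fix h assume "h \<in> (*v) dual_matrix ` X"
  then obtain y where y: "y \<in> X" "h = dual_matrix *v y" by blast
  obtain \<omega> \<alpha> \<beta> where v: "valid \<omega> \<alpha> \<beta>" and p: "y = phi \<omega> \<alpha> \<beta>" by (rule X_subset_phi[OF y(1)])
  have "y \<noteq> 0" using y(1) zero_notin_X by auto
  then have "h \<noteq> 0" using y(2) by (simp add: dual_matrix_eq_0_iff)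
  obtain w0 \<sigma>1 where w0: "w0 \<sigma>1 \<noteq> 0" "deg (ix o0 l) \<le> p \<Longrightarrow> (\<Sum>\<sigma>\<in>UNIV. \<omega> \<sigma> * w0 \<sigma>) = 0"
    using point[of \<omega>] by (elim exE conjE) (rule that, assumption, blast)
  \<comment> \<open>On each line the point \<open>(- \<beta> j, \<alpha> j)\<close> is the zero of
    \<open>\<alpha> j * s + \<beta> j * t\<close>. Moving it to the origin of the chart removes the
    \<open>s\<close>-part of the form and leaves the multiple \<open>\<gamma> j\<close> of
    \<open>t\<close>.\<close>
  define s0 where "s0 j = - \<beta> j" for j
  have valid0: "valid w0 s0 \<alpha>" using w0(1) v unfolding valid_def s0_def by auto
  obtain L L' A q v where L: "linear_aut X L L'" "L *v axis i0 1 = phi w0 s0 \<alpha>" "\<And>\<sigma>. A $ \<sigma> $ o0 = w0 \<sigma>"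
    "\<And>w s t. L *v phi w s t = phi (act A w) (\<lambda>j. s0 j * s j + q j * t j) (\<lambda>j. \<alpha> j * s j + v j * t j)"
    by (rule homogeneous[OF valid0]) (rule that)
  define \<omega>' where "\<omega>' \<tau> = (\<Sum>\<sigma>\<in>UNIV. \<omega> \<sigma> * A $ \<sigma> $ \<tau>)" for \<tau>
  define \<gamma> where "\<gamma> j = \<alpha> j * q j + \<beta> j * v j" for j
  have tr: "Finite_Cartesian_Product.transpose L *v h = dual_matrix *v phi \<omega>' (\<lambda>_. 0) \<gamma>"
  proof (rule lin_phi_eqI)
    fix w s t
    have "lin (Finite_Cartesian_Product.transpose L *v h) (phi w s t) = lin h (L *v phi w s t)"
      by (simp only: lin_matrix)
    also have "\<dots> = (\<Sum>\<sigma>\<in>UNIV. \<omega> \<sigma> * act A w \<sigma>)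
        * (\<Prod>j\<in>UNIV. (\<alpha> j * (s0 j * s j + q j * t j) + \<beta> j * (\<alpha> j * s j + v j * t j)) ^ l j)"
      unfolding L(4) y(2) p lin_dual_matrix_phi ..
    also have "(\<Sum>\<sigma>\<in>UNIV. \<omega> \<sigma> * act A w \<sigma>) = (\<Sum>\<tau>\<in>UNIV. \<omega>' \<tau> * w \<tau>)"
      unfolding act_def \<omega>'_def sum_distrib_left sum_distrib_right by (subst sum.swap) (simp add: mult.assoc)
    also have "(\<Prod>j\<in>UNIV. (\<alpha> j * (s0 j * s j + q j * t j) + \<beta> j * (\<alpha> j * s j + v j * t j)) ^ l j)
        = (\<Prod>j\<in>UNIV. (0 * s j + \<gamma> j * t j) ^ l j)"
      by (rule prod.cong) (simp_all add: s0_def \<gamma>_def algebra_simps)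
    finally show "lin (Finite_Cartesian_Product.transpose L *v h) (phi w s t)
        = lin (dual_matrix *v phi \<omega>' (\<lambda>_. 0) \<gamma>) (phi w s t)"
      by (simp only: lin_dual_matrix_phi)
  qed
  have "(dual_matrix *v phi \<omega>' (\<lambda>_. 0) \<gamma>) $ i = 0" if "deg i \<le> p" for i
  proof (cases "u i = l")
    case True
    then have i: "ix (sg i) l = i" using ix_index[of i] by simp
    \<comment> \<open>Only the top index over \<open>o0\<close> can have degree at most
      \<open>p\<close>. Its coefficient is the value of \<open>\<omega>\<close> at
      \<open>w0\<close>, which \<open>point\<close> makes zero in just this situation.\<close>
    then have "sg i = o0" using top_index[of "sg i"] that by (metis not_less)
    then have "\<omega>' (sg i) = 0" using w0(2) i that by (simp add: \<omega>'_def L(3))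
    then show ?thesis by (simp add: dual_matrix_nth phi_nth)
  next
    case False
    then obtain j where "u i j \<noteq> l j" by auto
    then have "u i j < l j" using u_le[of i j] by simp
    then have "(\<Prod>j\<in>UNIV. 0 ^ (l j - u i j) * \<gamma> j ^ u i j) = 0" by (intro prod_zero) auto
    then show ?thesis by (simp only: dual_matrix_nth phi_nth mult_zero_right)
  qed
  then have "h \<in> jet_kernel p X (L *v axis i0 1)"
    unfolding jet_kernel_linear_aut[OF L(1) zero_notin_X origin_mem] tr jet_kernel_origin by blast
  moreover have "L *v axis i0 1 \<in> X" using L(1) origin_mem by (rule linear_aut_mem)
  ultimately show "h \<in> {h. h \<noteq> 0 \<and> (\<exists>x\<in>X. h \<in> jet_kernel p X x)}" using \<open>h \<noteq> 0\<close> by blast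
qed

text \<open>The set found in \<open>dual_points\<close> is the image of the closed set
  \<open>X\<close> under an invertible matrix, hence closed, and the closure in
  \<open>dual_variety\<close> adds nothing.\<close>

lemma selfdualI:
  assumes top: "\<And>i. deg i > p \<Longrightarrow> u i = l"
    and top_index: "\<And>\<sigma>. \<sigma> \<noteq> o0 \<Longrightarrow> deg (ix \<sigma> l) > p"
    and point: "\<And>\<omega> :: 'o \<Rightarrow> 'k. \<exists>w0 \<sigma>. w0 \<sigma> \<noteq> (0 :: 'k) \<and> (deg (ix o0 l) \<le> p \<longrightarrow> (\<Sum>\<sigma>\<in>UNIV. \<omega> \<sigma> * w0 \<sigma>) = 0)"
  shows "selfdual p X"
proof -
  have "\<exists>M. M ** dual_matrix = mat 1"
    unfolding matrix_left_invertible_ker by (simp add: dual_matrix_eq_0_iff)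
  then obtain M where M: "M ** dual_matrix = mat 1" ..
  then have M': "dual_matrix ** M = mat 1" by (simp add: matrix_left_right_inverse)
  let ?D = "(*v) dual_matrix ` X"
  have zero: "0 \<notin> ?D" using zero_notin_X by (auto simp: dual_matrix_eq_0_iff eq_commute[of 0])
  have "{h. h \<noteq> 0 \<and> (\<exists>x\<in>X. osculating_space p X x \<subseteq> hyperplane h)}
      = {h. h \<noteq> 0 \<and> (\<exists>x\<in>X. h \<in> jet_kernel p X x)}"
    using osculating_subset_hyperplane_iff by blast
  then have "dual_variety p X = zariski closure_of {h. h \<noteq> 0 \<and> (\<exists>x\<in>X. h \<in> jet_kernel p X x)}"
    unfolding dual_variety_def const_rank_locus_X by (simp only:)
  also have "{h. h \<noteq> 0 \<and> (\<exists>x\<in>X. h \<in> jet_kernel p X x)} = ?D"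
    by (rule dual_points[OF top top_index point])
  also have "zariski closure_of ?D = ?D"
  proof
    show "?D \<subseteq> zariski closure_of ?D"
      by (rule closure_of_subset) (use zero in \<open>auto simp: topspace_zariski\<close>)
    show "zariski closure_of ?D \<subseteq> ?D"
    proof
      fix y assume y: "y \<in> zariski closure_of ?D"
      have "M *v y \<in> zariski closure_of X"
        unfolding closure_of_zariski[OF zero_notin_X]
      proof (intro CollectI conjI allI impI)
        show "M *v y \<noteq> 0"
        proof
          assume "M *v y = 0"
          then have "dual_matrix *v (M *v y) = 0" by simp
          then show False using y by (simp add: matrix_vector_mul_assoc M' closure_of_zariski[OF zero])
        qed
      next
        fix d F assume F: "form d F \<and> (\<forall>s\<in>X. F s = 0)"
        have "F (M *v s) = 0" if "s \<in> ?D" for s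
          using that F by (auto simp: matrix_vector_mul_assoc M)
        then show "F (M *v y) = 0"
          using y form_matrix[of d F M] F unfolding closure_of_zariski[OF zero] by blast
      qed
      then have "M *v y \<in> X" using closed_X by (simp add: closure_of_closedin)
      moreover have "y = dual_matrix *v (M *v y)" by (simp add: matrix_vector_mul_assoc M')
      ultimately show "y \<in> ?D" by blast
    qed
  qed
  finally show ?thesis
    unfolding selfdual_def using M M' by (intro exI[of _ dual_matrix]) (auto simp: invertible_def)
qed

end

section \<open>Degrees and exponents of the Segre--Veronese chart\<close>

context segre_veronese
begin

lemma deg_eq: "deg i = (if sg i = o0 then 0 else 1) + (\<Sum>j\<in>UNIV. u i j)"
proof -
  have "(\<Sum>\<sigma>\<in>- {o0}. n i (Inl \<sigma>)) = (if sg i = o0 then 0 else 1)"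
    by (simp add: n_simps(1) sum.delta')
  then show ?thesis unfolding deg_def sum_C by simp
qed

lemma sum_u_le: "(\<Sum>j\<in>UNIV. u i j) \<le> (\<Sum>j\<in>UNIV. l j)"
  by (intro sum_mono u_le)

lemma sum_u_eqD:
  assumes "(\<Sum>j\<in>UNIV. l j) \<le> (\<Sum>j\<in>UNIV. u i j)" shows "u i = l"
proof
  fix j
  have "(\<Sum>j\<in>UNIV. u i j) = (\<Sum>j\<in>UNIV. l j)" using assms sum_u_le[of i] by simp
  then show "u i j = l j" using sum_mono_inv[of "u i" UNIV l j] u_le by simp
qed

text \<open>The exponents satisfy linear inequalities, which pass to convex combinations; the
  integral solutions of these inequalities are exponents again.\<close>

lemma exponents_complete:
  assumes w: "\<And>i. w i \<ge> 0" "(\<Sum>i\<in>UNIV. w i) = (1::real)"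
    and z: "\<And>c. c \<in> C \<Longrightarrow> (\<Sum>i\<in>UNIV. w i * real (n i c)) = of_int (z c)"
  shows "\<exists>i. \<forall>c\<in>C. z c = int (n i c)"
proof -
  have nonneg: "z c \<ge> 0" if "c \<in> C" for c
  proof -
    have "real_of_int (z c) \<ge> 0" unfolding z[OF that, symmetric] by (intro sum_nonneg) (simp add: w)
    then show ?thesis by simp
  qed
  have upper: "z (Inr j) \<le> int (l j)" for j
  proof -
    have "Inr j \<in> C" by (simp add: C_def)
    have "real_of_int (z (Inr j)) \<le> (\<Sum>i\<in>UNIV. w i * real (l j))"
      unfolding z[OF \<open>Inr j \<in> C\<close>, symmetric] by (intro sum_mono mult_left_mono) (simp_all add: w u_le)
    also have "\<dots> = real (l j)" using w(2) by (simp add: sum_distrib_right[symmetric])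
    finally show ?thesis by linarith
  qed
  \<comment> \<open>Each index has at most one nonzero exponent among the \<open>Inl\<close>
    coordinates, so weights summing to 1 give at most 1.\<close>
  have "(\<Sum>\<sigma>\<in>- {o0}. real_of_int (z (Inl \<sigma>))) \<le> 1"
  proof -
    have "(\<Sum>\<sigma>\<in>- {o0}. real_of_int (z (Inl \<sigma>))) = (\<Sum>\<sigma>\<in>- {o0}. \<Sum>i\<in>UNIV. w i * real (n i (Inl \<sigma>)))"
      by (rule sum.cong) (simp_all only: z[symmetric] C_def UnI1 imageI)
    also have "\<dots> = (\<Sum>i\<in>UNIV. \<Sum>\<sigma>\<in>- {o0}. if sg i = \<sigma> then w i else 0)"
      by (subst sum.swap) (intro sum.cong refl, simp)
    also have "\<dots> \<le> (\<Sum>i\<in>UNIV. w i)" by (rule sum_mono) (simp add: w)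
    finally show ?thesis by (simp add: w(2))
  qed
  then have sum_le: "(\<Sum>\<sigma>\<in>- {o0}. z (Inl \<sigma>)) \<le> 1" by (simp flip: of_int_sum)
  have nonneg': "z (Inl \<sigma>) \<ge> 0" if "\<sigma> \<noteq> o0" for \<sigma> using that by (intro nonneg) (simp add: C_def)
  \<comment> \<open>Nonnegative integers with sum at most 1: all zero, which is the case of
    \<open>o0\<close>, or a single 1.\<close>
  obtain \<sigma> where \<sigma>: "\<And>\<tau>. \<tau> \<noteq> o0 \<Longrightarrow> z (Inl \<tau>) = (if \<sigma> = \<tau> then 1 else 0)"
  proof (cases "\<forall>\<tau>. \<tau> \<noteq> o0 \<longrightarrow> z (Inl \<tau>) = 0")
    case True
    then show thesis by (intro that[of o0]) auto
  next
    case False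
    then obtain \<sigma> where \<sigma>: "\<sigma> \<noteq> o0" "z (Inl \<sigma>) \<noteq> 0" by blast
    have split: "(\<Sum>\<sigma>\<in>- {o0}. z (Inl \<sigma>)) = z (Inl \<sigma>) + (\<Sum>\<tau>\<in>- {o0} - {\<sigma>}. z (Inl \<tau>))"
      using \<sigma>(1) by (simp add: sum.remove)
    have rest: "(\<Sum>\<tau>\<in>- {o0} - {\<sigma>}. z (Inl \<tau>)) \<ge> 0" by (rule sum_nonneg) (simp add: nonneg')
    have one: "z (Inl \<sigma>) = 1" using split rest sum_le \<sigma>(2) nonneg'[OF \<sigma>(1)] by linarith
    show thesis
    proof (rule that[of \<sigma>])
      fix \<tau> assume \<tau>: "\<tau> \<noteq> o0"
      show "z (Inl \<tau>) = (if \<sigma> = \<tau> then 1 else 0)"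
      proof (cases "\<sigma> = \<tau>")
        case False
        have "z (Inl \<tau>) \<le> (\<Sum>\<tau>\<in>- {o0} - {\<sigma>}. z (Inl \<tau>))"
          by (rule member_le_sum[of \<tau> _ "\<lambda>\<tau>. z (Inl \<tau>)"]) (use \<tau> False in \<open>auto simp: nonneg'\<close>)
        then show ?thesis using False split one sum_le nonneg'[OF \<tau>] by simp
      qed (use one in simp)
    qed
  qed
  define f where "f j = nat (z (Inr j))" for j
  have f: "f j \<le> l j" "z (Inr j) = int (f j)" for j
    using upper[of j] nonneg[of "Inr j"] by (auto simp: f_def C_def)
  have "z c = int (n (ix \<sigma> f) c)" if c: "c \<in> C" for c
  proof (cases c)
    case (Inl \<tau>)
    then have "\<tau> \<noteq> o0" using c by (auto simp: C_def)
    then show ?thesis using Inl by (simp add: \<sigma> f ix)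
  qed (simp add: f ix)
  then show ?thesis by blast
qed

lemma exponents_down_closed:
  assumes "\<And>c. c \<in> C \<Longrightarrow> e c \<le> n i c"
  shows "\<exists>i'. \<forall>c\<in>C. n i' c = e c"
proof -
  \<comment> \<open>If \<open>e\<close> lowers the simplex exponent from 1 to 0, the index moves to
    \<open>o0\<close>, whose \<open>Inl\<close> exponents are all 0.\<close>
  define \<sigma> where "\<sigma> = (if sg i \<noteq> o0 \<and> e (Inl (sg i)) = 1 then sg i else o0)"
  define f where "f j = e (Inr j)" for j
  have f: "f j \<le> l j" for j
    using assms[of "Inr j"] u_le[of i j] by (simp add: f_def C_def)
  have "n (ix \<sigma> f) c = e c" if c: "c \<in> C" for c
  proof (cases c)
    case (Inl \<tau>)
    then have "\<tau> \<noteq> o0" using c by (auto simp: C_def)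
    then show ?thesis using assms[OF c] Inl by (auto simp: ix f \<sigma>_def split: if_splits)
  next
    case (Inr j)
    then show ?thesis by (simp add: ix f) (simp add: f_def)
  qed
  then show ?thesis by blast
qed

lemma linear_form_zero:
  fixes \<omega> :: "'o \<Rightarrow> 'k"
  assumes "CARD('o) \<ge> 2"
  shows "\<exists>w0 \<sigma>. w0 \<sigma> \<noteq> 0 \<and> (\<Sum>\<sigma>\<in>UNIV. \<omega> \<sigma> * w0 \<sigma>) = 0"
proof -
  obtain \<sigma> \<tau> :: 'o where "\<sigma> \<noteq> \<tau>"
    using assms by (metis (full_types) UNIV_I card_le_Suc0_iff_eq finite numeral_2_eq_2 not_less_eq_eq)
  have delta: "(\<Sum>\<rho>\<in>UNIV. \<omega> \<rho> * (if \<rho> = \<sigma> then x else if \<rho> = \<tau> then y else 0)) = \<omega> \<sigma> * x + \<omega> \<tau> * y" for x y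
  proof -
    have "(\<Sum>\<rho>\<in>UNIV. \<omega> \<rho> * (if \<rho> = \<sigma> then x else if \<rho> = \<tau> then y else 0))
        = (\<Sum>\<rho>\<in>UNIV. (if \<rho> = \<sigma> then \<omega> \<sigma> * x else 0) + (if \<rho> = \<tau> then \<omega> \<tau> * y else 0))"
      by (rule sum.cong) (use \<open>\<sigma> \<noteq> \<tau>\<close> in auto)
    then show ?thesis by (simp add: sum.distrib)
  qed
  show ?thesis
  proof (cases "\<omega> \<sigma> = 0")
    case True
    then show ?thesis
      using delta[of 1 0] by (intro exI[of _ "\<lambda>\<rho>. if \<rho> = \<sigma> then 1 else if \<rho> = \<tau> then 0 else 0"] exI[of _ \<sigma>]) simp
  next
    case False
    then show ?thesis
      using delta[of "\<omega> \<tau>" "- \<omega> \<sigma>"] \<open>\<sigma> \<noteq> \<tau>\<close>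
      by (intro exI[of _ "\<lambda>\<rho>. if \<rho> = \<sigma> then \<omega> \<tau> else if \<rho> = \<tau> then - \<omega> \<sigma> else 0"] exI[of _ \<tau>]) simp
  qed
qed

text \<open>Both cases at once: \<open>p\<close> is one less than the largest value of
  \<open>deg\<close>, and \<open>c\<close> counts the indices that reach this value.\<close>

lemma toric_selfdual:
  fixes a :: "'i \<Rightarrow> int ^ 'd::finite"
  assumes X: "X = toric_variety a" and "inj a"
    and p: "CARD('o) = 1 \<and> Suc p = (\<Sum>j\<in>UNIV. l j) \<and> c = 1 \<or>
            CARD('o) \<ge> 2 \<and> p = (\<Sum>j\<in>UNIV. l j) \<and> c = CARD('o) - 1"
  shows "smooth_variety X \<and> equivariant_toric X \<and>
     complete_in (affine_lattice a) a \<and> (saturated a \<longrightarrow> complete_in UNIV a) \<and>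
     selfdual p X \<and> vec.dim (power_matrix_kernel p a :: ('k ^ 'i) set) = c"
proof (intro conjI impI)
  let ?k = "\<Sum>j\<in>UNIV. l j"
  have deg_top: "deg (ix \<sigma> l) = (if \<sigma> = o0 then 0 else 1) + ?k" for \<sigma> by (simp add: deg_eq ix)
  have single: "\<sigma> = o0" if "CARD('o) = 1" for \<sigma> :: 'o
    using that by (metis UNIV_I card_1_singletonE singletonD)
  have top: "u i = l" if "deg i > p" for i
  proof (rule sum_u_eqD)
    show "?k \<le> (\<Sum>j\<in>UNIV. u i j)"
      using p that single[of "sg i"] by (auto simp: deg_eq split: if_splits)
  qed
  have top_index: "deg (ix \<sigma> l) > p" if "\<sigma> \<noteq> o0" for \<sigma>
    using p that single[of \<sigma>] by (auto simp: deg_top)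
  show "complete_in (affine_lattice a) a"
    by (rule complete_in_affine_lattice[OF X \<open>inj a\<close> exponents_complete])
  then show "complete_in UNIV a" if "saturated a" using that by (rule complete_in_saturated)
  show "selfdual p X"
  proof (rule selfdualI[OF top top_index])
    fix \<omega> :: "'o \<Rightarrow> 'k"
    show "\<exists>w0 \<sigma>. w0 \<sigma> \<noteq> 0 \<and> (deg (ix o0 l) \<le> p \<longrightarrow> (\<Sum>\<sigma>\<in>UNIV. \<omega> \<sigma> * w0 \<sigma>) = 0)"
    proof (cases "CARD('o) \<ge> 2")
      case True
      then show ?thesis using linear_form_zero[of \<omega>] by blast
    next
      case False
      then have "Suc p = ?k" using p by auto
      then have "\<not> deg (ix o0 l) \<le> p" by (simp add: deg_top)
      then show ?thesis by (intro exI[of _ "\<lambda>_. 1"] exI[of _ o0]) simp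
    qed
  qed
  have "card {i. deg i > p} = c"
  proof (cases "CARD('o) \<ge> 2")
    case True
    then have pk: "p = ?k" "c = CARD('o) - 1" using p by auto
    have "{i. deg i > p} = (\<lambda>\<sigma>. ix \<sigma> l) ` (- {o0})"
    proof (intro set_eqI iffI)
      fix i assume "i \<in> {i. deg i > p}"
      then have i: "deg i > p" "u i = l" using top by auto
      then have "i = ix (sg i) l" using ix_index[of i] by simp
      moreover have "sg i \<noteq> o0" using i pk(1) by (auto simp: deg_eq)
      ultimately show "i \<in> (\<lambda>\<sigma>. ix \<sigma> l) ` (- {o0})" by blast
    qed (use top_index in auto)
    moreover have "inj_on (\<lambda>\<sigma>. ix \<sigma> l) (- {o0})"
      by (rule inj_on_inverseI[of _ sg]) (simp add: ix)
    ultimately show ?thesis using pk(2) by (simp add: card_image Compl_eq_Diff_UNIV)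
  next
    case False
    then have pk: "CARD('o) = 1" "Suc p = ?k" "c = 1" using p by auto
    have "{i. deg i > p} = {ix o0 l}"
    proof (intro set_eqI iffI)
      fix i assume "i \<in> {i. deg i > p}"
      then have "u i = l" using top by auto
      then have "i = ix (sg i) l" using ix_index[of i] by simp
      then show "i \<in> {ix o0 l}" using single[OF pk(1), of "sg i"] by simp
    qed (use pk(2) in \<open>simp add: deg_top\<close>)
    then show ?thesis using pk(3) by simp
  qed
  moreover have "vec.dim (power_matrix_kernel p a :: ('k ^ 'i) set) = card {i. deg i > p}"
    by (rule dim_power_matrix_kernel[OF X]) (rule exponents_down_closed)
  ultimately show "vec.dim (power_matrix_kernel p a :: ('k ^ 'i) set) = c" by simp
qed (rule smooth_variety_X equivariant_toric_X)+

end

section \<open>The Segre--Veronese configurations\<close>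

lemma mem_segre_veronese_box:
  "v \<in> segre_veronese_box l \<longleftrightarrow> (\<forall>j. 0 \<le> v $ j \<and> v $ j \<le> int (l j))"
proof -
  have "real_of_int x \<le> real m \<longleftrightarrow> x \<le> int m" for x m by linarith
  then show ?thesis by (simp add: segre_veronese_box_def lattice_points_def mem_box_cart real_point_def)
qed

lemma Basis_cart: "(Basis :: (real ^ 's::finite) set) = range (\<lambda>s. axis s 1)"
  by (auto simp: Basis_vec_def)

lemma mem_segre_veronese_simplex_box:
  "v \<in> segre_veronese_simplex_box l \<longleftrightarrow>
    (\<forall>s. 0 \<le> v $ Inl s) \<and> (\<Sum>s\<in>UNIV. v $ Inl s) \<le> 1 \<and> (\<forall>j. 0 \<le> v $ Inr j \<and> v $ Inr j \<le> int (l j))"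
  for v :: "int ^ ('s::finite + 'm::finite)"
proof -
  have le: "real_of_int x \<le> real m \<longleftrightarrow> x \<le> int m" for x m by linarith
  have "inj (\<lambda>s. axis s (1::real) :: real ^ 's)" by (auto simp: inj_def axis_eq_axis)
  then have simplex: "x \<in> convex hull (insert 0 Basis) \<longleftrightarrow> (\<forall>s. 0 \<le> x $ s) \<and> (\<Sum>s\<in>UNIV. x $ s) \<le> 1" for x :: "real ^ 's"
    unfolding std_simplex unfolding Basis_cart by (simp add: sum.reindex inner_axis)
  have "(\<Sum>s\<in>UNIV. real_of_int (v $ Inl s)) \<le> 1 \<longleftrightarrow> (\<Sum>s\<in>UNIV. v $ Inl s) \<le> 1"
    by (metis of_int_le_1_iff of_int_sum)
  then show ?thesis
    unfolding segre_veronese_simplex_box_def lattice_points_def mem_Collect_eq simplex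
    by (simp add: mem_box_cart real_point_def le)
qed

lemma segre_veronese_box:
  fixes b :: "'i::finite \<Rightarrow> int ^ 'm::finite" and X :: "('k::field_char_0 ^ 'i) set"
  assumes "\<forall>j. l j \<ge> 1" and b: "bij_betw b UNIV (segre_veronese_box l)" and X: "X = toric_variety b"
  shows "segre_veronese l (\<lambda>_. ()) (\<lambda>i j. nat (b i $ j)) () X"
proof
  have box: "0 \<le> b i $ j" "b i $ j \<le> int (l j)" for i j
    using bij_betwE[OF b] by (auto simp: mem_segre_veronese_box)
  have "bij_betw (\<lambda>v. ((), \<lambda>j. nat (v $ j))) (segre_veronese_box l) (UNIV \<times> {f. \<forall>j. f j \<le> l j})"
    by (rule bij_betw_byWitness[where f' = "\<lambda>(_, f). \<chi> j. int (f j)"])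
       (auto simp: mem_segre_veronese_box vec_eq_iff nat_le_iff)
  from bij_betw_trans[OF b this]
  show "bij_betw (\<lambda>i. ((), \<lambda>j. nat (b i $ j))) UNIV (UNIV \<times> {f. \<forall>j. f j \<le> l j})"
    by (simp add: o_def)
  have mono: "monomial (b i) t = (\<Prod>j\<in>UNIV. (t $ j) ^ nat (b i $ j))" for i and t :: "'k ^ 'm"
    unfolding monomial_def by (rule prod.cong) (simp_all add: power_int_def box)
  have "{(\<chi> i. monomial (b i) t) | t :: 'k ^ 'm. \<forall>j. t $ j \<noteq> 0}
      = {(\<chi> i. w () * (\<Prod>j\<in>UNIV. t j ^ nat (b i $ j))) | w t. w () = 1 \<and> (\<forall>\<sigma>. w \<sigma> \<noteq> 0) \<and> (\<forall>j. t j \<noteq> 0)}"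
  proof (intro set_eqI iffI)
    fix y assume "y \<in> {(\<chi> i. monomial (b i) t) | t :: 'k ^ 'm. \<forall>j. t $ j \<noteq> 0}"
    then obtain t :: "'k ^ 'm" where "y = (\<chi> i. monomial (b i) t)" "\<forall>j. t $ j \<noteq> 0" by blast
    then show "y \<in> {(\<chi> i. w () * (\<Prod>j\<in>UNIV. t j ^ nat (b i $ j))) | w t. w () = 1 \<and> (\<forall>\<sigma>. w \<sigma> \<noteq> 0) \<and> (\<forall>j. t j \<noteq> 0)}"
      by (intro CollectI exI[of _ "\<lambda>_. 1"] exI[of _ "\<lambda>j. t $ j"]) (simp add: mono)
  next
    fix y :: "'k ^ 'i" assume "y \<in> {(\<chi> i. w () * (\<Prod>j\<in>UNIV. t j ^ nat (b i $ j))) | w t. w () = 1 \<and> (\<forall>\<sigma>. w \<sigma> \<noteq> 0) \<and> (\<forall>j. t j \<noteq> 0)}"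
    then obtain w :: "unit \<Rightarrow> 'k" and t where "y = (\<chi> i. w () * (\<Prod>j\<in>UNIV. t j ^ nat (b i $ j)))" "w () = 1" "\<forall>j. t j \<noteq> 0" by blast
    then show "y \<in> {(\<chi> i. monomial (b i) t) | t :: 'k ^ 'm. \<forall>j. t $ j \<noteq> 0}"
      by (intro CollectI exI[of _ "\<chi> j. t j"]) (simp add: mono)
  qed
  then show "X = zariski closure_of
      {(\<chi> i. w () * (\<Prod>j\<in>UNIV. t j ^ nat (b i $ j))) | w t. w () = 1 \<and> (\<forall>\<sigma>. w \<sigma> \<noteq> 0) \<and> (\<forall>j. t j \<noteq> 0)}"
    unfolding X toric_variety_def by simp
qed (use assms in simp)

text \<open>\<open>None\<close> stands for the vertex 0 of the unit simplex and plays the part of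
  \<open>o0\<close>; \<open>Some s\<close> stands for the unit vector at \<open>s\<close>.\<close>

lemma segre_veronese_simplex_box:
  fixes b :: "'i::finite \<Rightarrow> int ^ ('s::finite + 'm::finite)" and X :: "('k::field_char_0 ^ 'i) set"
  assumes "\<forall>j. l j \<ge> 1" and b: "bij_betw b UNIV (segre_veronese_simplex_box l)" and X: "X = toric_variety b"
  obtains sg :: "'i \<Rightarrow> 's option" and u where "segre_veronese l sg u None X"
proof -
  define g :: "'s option \<times> ('m \<Rightarrow> nat) \<Rightarrow> int ^ ('s + 'm)" where
    "g x = (\<chi> c. case c of Inl s \<Rightarrow> if fst x = Some s then 1 else 0 | Inr j \<Rightarrow> int (snd x j))" for x
  have g_Inl: "g x $ Inl s = (if fst x = Some s then 1 else 0)" and g_Inr: "g x $ Inr j = int (snd x j)" for x s j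
    by (simp_all add: g_def)
  let ?F = "UNIV \<times> {f. \<forall>j. f j \<le> l j} :: ('s option \<times> ('m \<Rightarrow> nat)) set"
  have "bij_betw g ?F (segre_veronese_simplex_box l)"
    unfolding bij_betw_def
  proof
    show "inj_on g ?F"
    proof (rule inj_onI)
      fix x y assume "g x = g y"
      then have "(if fst x = Some s then 1 else 0) = (if fst y = Some s then 1 else (0::int))"
        "int (snd x j) = int (snd y j)" for s j
        by (metis g_Inl, metis g_Inr)
      then have "fst x = Some s \<longleftrightarrow> fst y = Some s" "snd x j = snd y j" for s j
        by (metis one_neq_zero, simp)
      then show "x = y" by (intro prod_eqI ext) (metis not_None_eq)+
    qed
    show "g ` ?F = segre_veronese_simplex_box l"
    proof (intro equalityI subsetI)
      fix v assume "v \<in> g ` ?F"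
      then obtain \<sigma> f where v: "v = g (\<sigma>, f)" "\<forall>j. f j \<le> l j" by auto
      have "(\<Sum>s\<in>UNIV. if \<sigma> = Some s then 1 else 0) \<le> (1::int)" by (cases \<sigma>) simp_all
      then show "v \<in> segre_veronese_simplex_box l"
        using v by (simp add: mem_segre_veronese_simplex_box g_Inl g_Inr)
    next
      fix v :: "int ^ ('s + 'm)" assume "v \<in> segre_veronese_simplex_box l"
      then have v: "\<And>s. 0 \<le> v $ Inl s" "(\<Sum>s\<in>UNIV. v $ Inl s) \<le> 1" "\<And>j. 0 \<le> v $ Inr j" "\<And>j. v $ Inr j \<le> int (l j)"
        by (auto simp: mem_segre_veronese_simplex_box)
      obtain \<sigma> where \<sigma>: "\<And>s. v $ Inl s = (if \<sigma> = Some s then 1 else 0)"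
      proof (cases "\<forall>s. v $ Inl s = 0")
        case True
        then show thesis by (intro that[of None]) simp
      next
        case False
        then obtain s where s: "v $ Inl s \<noteq> 0" by blast
        have split: "(\<Sum>s\<in>UNIV. v $ Inl s) = v $ Inl s + (\<Sum>s'\<in>UNIV - {s}. v $ Inl s')"
          by (simp add: sum.remove)
        have rest: "(\<Sum>s'\<in>UNIV - {s}. v $ Inl s') \<ge> 0" by (rule sum_nonneg) (simp add: v)
        have one: "v $ Inl s = 1" using split rest v(2) s v(1)[of s] by linarith
        have "v $ Inl s' = 0" if "s' \<noteq> s" for s'
        proof -
          have "v $ Inl s' \<le> (\<Sum>s'\<in>UNIV - {s}. v $ Inl s')"
            by (rule member_le_sum[of s' _ "\<lambda>s'. v $ Inl s'"]) (use that v in auto)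
          then show ?thesis using split one v(2) v(1)[of s'] by simp
        qed
        then show thesis using one by (intro that[of "Some s"]) auto
      qed
      have "v = g (\<sigma>, \<lambda>j. nat (v $ Inr j))"
        unfolding vec_eq_iff
      proof
        fix c show "v $ c = g (\<sigma>, \<lambda>j. nat (v $ Inr j)) $ c"
          by (cases c) (simp_all add: g_Inl g_Inr \<sigma> v)
      qed
      moreover have "(\<sigma>, \<lambda>j. nat (v $ Inr j)) \<in> ?F" using v(4) by (simp add: nat_le_iff)
      ultimately show "v \<in> g ` ?F" by blast
    qed
  qed
  note g = this
  define h where "h = the_inv_into ?F g"
  define sg where "sg i = fst (h (b i))" for i
  define u where "u i = snd (h (b i))" for i
  have bg: "b i = g (sg i, u i)" for i
    unfolding sg_def u_def h_def prod.collapse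
    by (rule f_the_inv_into_f_bij_betw[OF g, symmetric]) (use bij_betwE[OF b] in auto)
  have mono: "monomial (b i) t = (case sg i of None \<Rightarrow> 1 | Some s \<Rightarrow> t $ Inl s) * (\<Prod>j\<in>UNIV. (t $ Inr j) ^ u i j)"
    for i and t :: "'k ^ ('s + 'm)"
  proof -
    have "monomial (b i) t = (\<Prod>c\<in>range Inl. t $ c powi (b i $ c)) * (\<Prod>c\<in>range Inr. t $ c powi (b i $ c))"
      unfolding monomial_def by (subst prod.union_disjoint[symmetric]) (auto simp: UNIV_sum)
    also have "(\<Prod>c\<in>range Inl. t $ c powi (b i $ c)) = (\<Prod>s\<in>UNIV. if sg i = Some s then t $ Inl s else 1)"
      by (simp add: prod.reindex, rule prod.cong) (simp_all add: bg g_Inl)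
    also have "\<dots> = (case sg i of None \<Rightarrow> 1 | Some s \<Rightarrow> t $ Inl s)" by (cases "sg i") simp_all
    also have "(\<Prod>c\<in>range Inr. t $ c powi (b i $ c)) = (\<Prod>j\<in>UNIV. (t $ Inr j) ^ u i j)"
      by (simp add: prod.reindex bg g_Inr)
    finally show ?thesis .
  qed
  have "{(\<chi> i. monomial (b i) t) | t :: 'k ^ ('s + 'm). \<forall>c. t $ c \<noteq> 0}
      = {(\<chi> i. w (sg i) * (\<Prod>j\<in>UNIV. t j ^ u i j)) | w t. w None = 1 \<and> (\<forall>\<sigma>. w \<sigma> \<noteq> 0) \<and> (\<forall>j. t j \<noteq> 0)}"
    (is "?L = ?R")
  proof (intro set_eqI iffI)
    fix y assume "y \<in> ?L"
    then obtain t :: "'k ^ ('s + 'm)" where "y = (\<chi> i. monomial (b i) t)" "\<forall>c. t $ c \<noteq> 0" by blast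
    then show "y \<in> ?R"
      by (intro CollectI exI[of _ "\<lambda>\<sigma>. case \<sigma> of None \<Rightarrow> 1 | Some s \<Rightarrow> t $ Inl s"] exI[of _ "\<lambda>j. t $ Inr j"])
         (simp add: mono split: option.split)
  next
    fix y assume "y \<in> ?R"
    then obtain w t where y: "y = (\<chi> i. w (sg i) * (\<Prod>j\<in>UNIV. t j ^ u i j))" "w None = 1"
      "\<forall>\<sigma>. w \<sigma> \<noteq> 0" "\<forall>j. t j \<noteq> 0" by blast
    let ?t = "\<chi> c. case c of Inl s \<Rightarrow> w (Some s) | Inr j \<Rightarrow> t j"
    have "(case \<sigma> of None \<Rightarrow> 1 | Some s \<Rightarrow> ?t $ Inl s) = w \<sigma>" for \<sigma> using y(2) by (cases \<sigma>) simp_all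
    then have "y = (\<chi> i. monomial (b i) ?t)" unfolding mono y(1) by simp
    moreover have "\<forall>c. ?t $ c \<noteq> 0" using y by (simp split: sum.split)
    ultimately show "y \<in> ?L" by blast
  qed
  then have closure: "X = zariski closure_of
      {(\<chi> i. w (sg i) * (\<Prod>j\<in>UNIV. t j ^ u i j)) | w t. w None = 1 \<and> (\<forall>\<sigma>. w \<sigma> \<noteq> 0) \<and> (\<forall>j. t j \<noteq> 0)}"
    unfolding X toric_variety_def by simp
  have "bij_betw h (segre_veronese_simplex_box l) ?F" unfolding h_def by (rule bij_betw_the_inv_into[OF g])
  from bij_betw_trans[OF b this] have "bij_betw (\<lambda>i. (sg i, u i)) UNIV ?F"
    by (simp add: o_def sg_def u_def)
  with closure have "segre_veronese l sg u None X"
    by unfold_locales (use assms in simp_all)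
  then show thesis by (rule that)
qed

theorem theorem5p14:
  fixes l :: "'m::finite \<Rightarrow> nat"
    and k r :: nat
    and a :: "'i::finite \<Rightarrow> int ^ 'n::finite"
    and X :: "('k::{alg_closed_field, field_char_0} ^ 'i) set"
    and b :: "'i \<Rightarrow> int ^ 'm"
    and b' :: "'i \<Rightarrow> int ^ ('s::finite + 'm)"
  assumes "\<forall>j. l j \<ge> 1"
    and "k = (\<Sum>j\<in>UNIV. l j)"
    and "inj a"
    and "X = toric_variety a"
  shows
    "(bij_betw b UNIV (segre_veronese_box l) \<and> X = toric_variety b \<longrightarrow>
       smooth_variety X \<and> equivariant_toric X \<and>
       complete_in (affine_lattice a) a \<and> (saturated a \<longrightarrow> complete_in UNIV a) \<and>
       selfdual (k - 1) X \<and>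
       vec.dim (power_matrix_kernel (k - 1) a :: ('k ^ 'i) set) = 1) \<and>
     (r \<ge> 3 \<and> CARD('s) = r - 1 \<and>
      bij_betw b' UNIV (segre_veronese_simplex_box l) \<and> X = toric_variety b' \<longrightarrow>
       smooth_variety X \<and> equivariant_toric X \<and>
       complete_in (affine_lattice a) a \<and> (saturated a \<longrightarrow> complete_in UNIV a) \<and>
       selfdual k X \<and>
       vec.dim (power_matrix_kernel k a :: ('k ^ 'i) set) = r - 1)"
proof (intro conjI[of "_ \<longrightarrow> _"] impI; elim conjE)
  assume b: "bij_betw b UNIV (segre_veronese_box l)" "X = toric_variety b"
  interpret segre_veronese l "\<lambda>_. ()" "\<lambda>i j. nat (b i $ j)" "()" X
    by (rule segre_veronese_box[OF assms(1) b])
  have "k \<ge> 1"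
  proof -
    have "l undefined \<le> k" unfolding assms(2) by (rule member_le_sum) auto
    then show ?thesis using assms(1) le_trans by blast
  qed
  then show "smooth_variety X \<and> equivariant_toric X \<and>
       complete_in (affine_lattice a) a \<and> (saturated a \<longrightarrow> complete_in UNIV a) \<and>
       selfdual (k - 1) X \<and> vec.dim (power_matrix_kernel (k - 1) a :: ('k ^ 'i) set) = 1"
    by (intro toric_selfdual assms) (simp add: assms(2))
next
  assume r: "r \<ge> 3" "CARD('s) = r - 1"
    and b': "bij_betw b' UNIV (segre_veronese_simplex_box l)" "X = toric_variety b'"
  obtain sg :: "'i \<Rightarrow> 's option" and u where "segre_veronese l sg u None X"
    by (rule segre_veronese_simplex_box[OF assms(1) b'])
  then interpret segre_veronese l sg u None X .
  have "CARD('s option) = r" using r by (simp add: card_UNIV_option)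
  then show "smooth_variety X \<and> equivariant_toric X \<and>
       complete_in (affine_lattice a) a \<and> (saturated a \<longrightarrow> complete_in UNIV a) \<and>
       selfdual k X \<and> vec.dim (power_matrix_kernel k a :: ('k ^ 'i) set) = r - 1"
    using r by (intro toric_selfdual assms) (simp add: assms(2))
qed

end
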